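(* Let $\alpha>0$, $\theta_0\in\Theta$, and let $X_1,X_2,\dots$ be i.i.d. with distribution $P_{\theta_0}$. Put $$h(x,\theta)=\frac{p_\theta^\alpha(x)}{C_\alpha(\theta)},\qquad C_\alpha(\theta)=\left(\int p_\theta^{1+\alpha}\,\mathrm{d}\lambda\right)^{\alpha/(1+\alpha)},$$ $$R_\alpha(\theta_0)=\sup_{\theta}\int h(x,\theta)\,\mathrm{d}P_{\theta_0}(x),\qquad \widehat R_\alpha(\theta_0)=\sup_{\theta}\frac1n\sum_{i=1}^nh(X_i,\theta).$$ Assume: (i) the density $p_\theta(x)$ has continuous partial derivatives with respect to $\theta$ up to third order (for all $x$ $\lambda$-a.e.); (ii) there exists a neighborhood $N(\theta_0)$ of $\theta_0$ such that the first, second and third order partial derivatives (with respect to $\theta$) of $h(x,\theta)$ are dominated on $N(\theta_0)$ by some $P_{\theta_0}$-integrable functions; (iii) the integrals $\int(\partial^2/\partial\theta^2)h(x,\theta_0)\,\mathrm{d}P_{\theta_0}(x)$ and $\int(\partial/\partial\theta)h(x,\theta_0)\,(\partial/\partial\theta)^th(x,\theta_0)\,\mathrm{d}P_{\theta_0}(x)$ exist. Then: (a) Let $B=\{\theta\in\Theta:\ \|\theta-\theta_0\|\le n^{-1/3}\}$. Then, as $n\to\infty$, with probability one, the function $\theta\mapsto\frac1n\sum_{i=1}^nh(X_i,\theta)$ attains a local maximal value at some point $\widehat\theta_n$ in the interior of $B$, which implies that the estimate $\widehat\theta_n$ is $n^{1/3}$-consistent. (b) $\sqrt n\,(\widehat\theta_n-\theta_0)$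 converges in distribution to a centered multivariate normal random variable with covariance matrix $$V=S^{-1}MS^{-1},$$ with $$S=-\int\frac{\partial^2}{\partial\theta^2}h(x,\theta_0)\,\mathrm{d}P_{\theta_0}(x),\qquad M=\int\frac{\partial}{\partial\theta}h(x,\theta_0)\left(\frac{\partial}{\partial\theta}\right)^th(x,\theta_0)\,\mathrm{d}P_{\theta_0}(x).$$ (c) $\sqrt n\,(\widehat R_\alpha(\theta_0)-R_\alpha(\theta_0))$ converges in distribution to a centered normal variable with variance $$\sigma^2(\theta_0)=\int h(x,\theta_0)^2\,\mathrm{d}P_{\theta_0}(x)-\left(\int h(x,\theta_0)\,\mathrm{d}P_{\theta_0}(x)\right)^2.$$
   Context: $\mathcal{P}=\{P_\theta:\theta\in\Theta\}$ is a parametric family of probability measures on $(\mathbb{R}^d,\mathcal{B}(\mathbb{R}^d))$ with Euclidean parameter space $\Theta$, all sharing the same support; $p_\theta$ is the density of $P_\theta$ with respect to Lebesgue measure $\lambda$. $\mathcal{P}^{+}=\mathcal{P}\cup\mathcal{P}_0$, where $\mathcal{P}_0$ is a further family of probability measures (possible data-generating distributions considered for robustness). Standing assumption: for some $\beta>0$ with $\alpha\le\beta$, the functions $p^\beta,\ q^\beta,\ \ln p$ belong to $\mathbb{L}_1(Q)$ for all $P\in\mathcal{P}$, $Q\in\mathcal{P}^{+}$, where $p,q$ are the densities of $P,Q$ and $\mathbb{L}_1(Q)=\{f:\mathbb{R}^d\to\mathbb{R}:\int|f|\,\mathrm{d}Q<\infty\}$. The pseudodistance is $$\mathfrak{R}_\alpha(P,Q)=\frac{1}{1+\alpha}\ln\left(\int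 p^\alpha\,\mathrm{d}P\right)+\frac{1}{\alpha(1+\alpha)}\ln\left(\int q^\alpha\,\mathrm{d}Q\right)-\frac1\alpha\ln\left(\int p^\alpha\,\mathrm{d}Q\right);$$ it is nonnegative, and $\mathfrak{R}_\alpha(P_\theta,P_{\tilde\theta})=0$ if and only if $\theta=\tilde\theta$. Consequently $\theta_0$ is the only maximizer of $\theta\mapsto\int h(x,\theta)\,\mathrm{d}P_{\theta_0}(x)$. The $\min\mathfrak{R}_\alpha$-estimator is defined through $\widehat\theta_n=\arg\sup_\theta\frac1n\sum_{i=1}^nh(X_i,\theta)$; this optimum need not be uniquely defined, and $\widehat\theta_n$ in (b) is the estimate of (a). Here $(\partial/\partial\theta)h$ denotes the (column) gradient and $(\partial^2/\partial\theta^2)h$ the Hessian matrix in $\theta$, and superscript $t$ denotes transpose. $n^{1/3}$-consistent means $\|\widehat\theta_n-\theta_0\|=O(n^{-1/3})$.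
   Formalization: Added: S is invertible; for (c) also that h(·,θ₀)² is P_θ₀-integrable, that R̂_α(θ₀) is measurable, and that almost surely for large n its supremum over Θ is attained in the interior of B. Without attainment (c) fails for N(μ,s²): with μ=X₁, s→0 the supremum is infinite. *)

theory Defs
  imports "HOL-Probability.Probability" "HOL-Library.Landau_Symbols"
begin

section \<open>Iterated partial derivatives on Euclidean space\<close>

definition partial_deriv :: "'m::finite \<Rightarrow> (real^'m \<Rightarrow> real) \<Rightarrow> real^'m \<Rightarrow> real" where
  "partial_deriv i f \<theta> = deriv (\<lambda>t. f (\<theta> + t *\<^sub>R axis i 1)) 0"

text \<open>The list \<open>[i, j, k]\<close> stands for the operator \<open>\<partial>\<^sub>i \<partial>\<^sub>j \<partial>\<^sub>k\<close>; the last index acts first.\<close>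

fun partials :: "'m::finite list \<Rightarrow> (real^'m \<Rightarrow> real) \<Rightarrow> real^'m \<Rightarrow> real" where
  "partials [] f = f"
| "partials (i # is) f = partial_deriv i (partials is f)"

text \<open>Since \<open>deriv\<close> is total, existence of the derivatives has to be stated separately. The set
  \<open>U\<close> is meant to be open; values of \<open>f\<close> outside \<open>U\<close> are then irrelevant.\<close>

definition partials_exist_on :: "nat \<Rightarrow> (real^'m) set \<Rightarrow> (real^'m::finite \<Rightarrow> real) \<Rightarrow> bool" where
  "partials_exist_on k U f \<longleftrightarrow>
     (\<forall>is i. length is < k \<longrightarrow>
        (\<forall>\<theta>\<in>U. (\<lambda>t. partials is f (\<theta> + t *\<^sub>R axis i 1)) field_differentiable at 0))"

definition grad :: "(real^'m::finite \<Rightarrow> real) \<Rightarrow> real^'m \<Rightarrow> real^'m" where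
  "grad f \<theta> = (\<chi> i. partials [i] f \<theta>)"

definition hessian :: "(real^'m::finite \<Rightarrow> real) \<Rightarrow> real^'m \<Rightarrow> real^'m^'m" where
  "hessian f \<theta> = (\<chi> i j. partials [i, j] f \<theta>)"

definition outer_prod :: "real^'m \<Rightarrow> real^'m \<Rightarrow> real^'m^'m" where
  "outer_prod u v = (\<chi> i j. u $ i * v $ j)"

section \<open>Measures\<close>

definition law_of :: "('a::euclidean_space \<Rightarrow> real) \<Rightarrow> 'a measure" where
  "law_of f = density lborel (\<lambda>x. ennreal (f x))"

definition prob_density :: "('a::euclidean_space \<Rightarrow> real) \<Rightarrow> bool" where
  "prob_density f \<longleftrightarrow> f \<in> borel_measurable borel \<and> (\<forall>x. 0 \<le> f x) \<and> prob_space (law_of f)"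

definition measure_support :: "'a::topological_space measure \<Rightarrow> 'a set" where
  "measure_support \<mu> = {x. \<forall>U. open U \<and> x \<in> U \<longrightarrow> emeasure \<mu> U \<noteq> 0}"

text \<open>The second argument is the variance; variance 0 gives the point mass.\<close>

definition normal_law :: "real \<Rightarrow> real \<Rightarrow> real measure" where
  "normal_law m v =
     (if v = 0 then return borel m else density lborel (\<lambda>x. ennreal (normal_density m (sqrt v) x)))"

text \<open>A random vector is (centered, possibly degenerate) multivariate normal iff each of its linear
  combinations is univariate normal, the variance of \<open>a \<bullet> x\<close> being \<open>a\<^sup>T V a\<close>.\<close>

definition centered_normal :: "real^'m^'m \<Rightarrow> (real^'m) measure \<Rightarrow> bool" where
  "centered_normal V \<mu> \<longleftrightarrow>
     prob_space \<mu> \<and> sets \<mu> = sets borel \<and> transpose V = V \<and>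
     (\<forall>a. distr \<mu> borel (\<lambda>x. a \<bullet> x) = normal_law 0 (a \<bullet> (V *v a)))"

text \<open>The library's \<open>weak_conv_m\<close> only covers measures on the real line.\<close>

definition weak_conv_vec :: "(nat \<Rightarrow> 'a::euclidean_space measure) \<Rightarrow> 'a measure \<Rightarrow> bool" where
  "weak_conv_vec \<mu>s \<mu> \<longleftrightarrow>
     (\<forall>f::'a \<Rightarrow> real. continuous_on UNIV f \<and> bounded (range f) \<longrightarrow>
        (\<lambda>n. \<integral>x. f x \<partial>(\<mu>s n)) \<longlonglongrightarrow> (\<integral>x. f x \<partial>\<mu>))"

section \<open>The estimator\<close>

text \<open>Throughout, \<open>p \<theta>\<close> is the Lebesgue density of the model distribution with parameter \<open>\<theta>\<close>.\<close>

definition C_fun :: "real \<Rightarrow> ('t \<Rightarrow> 'a::euclidean_space \<Rightarrow> real) \<Rightarrow> 't \<Rightarrow> real" where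
  "C_fun \<alpha> p \<theta> = (\<integral>x. p \<theta> x powr (1 + \<alpha>) \<partial>lborel) powr (\<alpha> / (1 + \<alpha>))"

definition h_fun :: "real \<Rightarrow> ('t \<Rightarrow> 'a::euclidean_space \<Rightarrow> real) \<Rightarrow> 'a \<Rightarrow> 't \<Rightarrow> real" where
  "h_fun \<alpha> p x \<theta> = p \<theta> x powr \<alpha> / C_fun \<alpha> p \<theta>"

text \<open>A sample \<open>X\<^sub>1, \<dots>, X\<^sub>n\<close> is indexed as \<open>X 0, \<dots>, X (n - 1)\<close>.\<close>

definition emp_mean ::
  "real \<Rightarrow> ('t \<Rightarrow> 'a::euclidean_space \<Rightarrow> real) \<Rightarrow> (nat \<Rightarrow> 'w \<Rightarrow> 'a) \<Rightarrow> nat \<Rightarrow> 'w \<Rightarrow> 't \<Rightarrow> real" where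
  "emp_mean \<alpha> p X n \<omega> \<theta> = (\<Sum>i<n. h_fun \<alpha> p (X i \<omega>) \<theta>) / real n"

definition R_true :: "real \<Rightarrow> ('t \<Rightarrow> 'a::euclidean_space \<Rightarrow> real) \<Rightarrow> 't set \<Rightarrow> 't \<Rightarrow> real" where
  "R_true \<alpha> p \<Theta> \<theta>0 = (SUP \<theta>\<in>\<Theta>. \<integral>x. h_fun \<alpha> p x \<theta> \<partial>(law_of (p \<theta>0)))"

definition R_emp ::
  "real \<Rightarrow> ('t \<Rightarrow> 'a::euclidean_space \<Rightarrow> real) \<Rightarrow> 't set \<Rightarrow> (nat \<Rightarrow> 'w \<Rightarrow> 'a) \<Rightarrow> nat \<Rightarrow> 'w \<Rightarrow> real" where
  "R_emp \<alpha> p \<Theta> X n \<omega> = (SUP \<theta>\<in>\<Theta>. emp_mean \<alpha> p X n \<omega> \<theta>)"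

definition B_set :: "(real^'m) set \<Rightarrow> real^'m \<Rightarrow> nat \<Rightarrow> (real^'m) set" where
  "B_set \<Theta> \<theta>0 n = {\<theta> \<in> \<Theta>. norm (\<theta> - \<theta>0) \<le> real n powr (- (1/3))}"

definition is_local_max_on :: "'t::topological_space set \<Rightarrow> ('t \<Rightarrow> real) \<Rightarrow> 't \<Rightarrow> bool" where
  "is_local_max_on \<Theta> f \<theta> \<longleftrightarrow> \<theta> \<in> \<Theta> \<and> (\<forall>\<^sub>F \<theta>' in at \<theta> within \<Theta>. f \<theta>' \<le> f \<theta>)"

text \<open>Sequences of random vectors which almost surely are, for all sufficiently large \<open>n\<close>, local
  maximizers of the empirical mean in the interior of the ball of radius \<open>n\<^sup>-\<^sup>1\<^sup>/\<^sup>3\<close>.\<close>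

definition local_max_estimate ::
  "'w measure \<Rightarrow> real \<Rightarrow> (real^'m \<Rightarrow> 'a::euclidean_space \<Rightarrow> real) \<Rightarrow> (real^'m) set \<Rightarrow> real^'m \<Rightarrow>
     (nat \<Rightarrow> 'w \<Rightarrow> 'a) \<Rightarrow> (nat \<Rightarrow> 'w \<Rightarrow> real^'m) \<Rightarrow> bool" where
  "local_max_estimate W \<alpha> p \<Theta> \<theta>0 X est \<longleftrightarrow>
     (\<forall>n. est n \<in> borel_measurable W) \<and>
     (AE \<omega> in W. \<forall>\<^sub>F n in sequentially.
        est n \<omega> \<in> interior (B_set \<Theta> \<theta>0 n) \<and>
        is_local_max_on \<Theta> (emp_mean \<alpha> p X n \<omega>) (est n \<omega>))"

definition S_mat ::
  "real \<Rightarrow> (real^'m::finite \<Rightarrow> 'a::euclidean_space \<Rightarrow> real) \<Rightarrow> real^'m \<Rightarrow> real^'m^'m" where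
  "S_mat \<alpha> p \<theta>0 = - (\<integral>x. hessian (h_fun \<alpha> p x) \<theta>0 \<partial>(law_of (p \<theta>0)))"

definition M_mat ::
  "real \<Rightarrow> (real^'m::finite \<Rightarrow> 'a::euclidean_space \<Rightarrow> real) \<Rightarrow> real^'m \<Rightarrow> real^'m^'m" where
  "M_mat \<alpha> p \<theta>0 =
     (\<integral>x. outer_prod (grad (h_fun \<alpha> p x) \<theta>0) (grad (h_fun \<alpha> p x) \<theta>0) \<partial>(law_of (p \<theta>0)))"

definition V_mat ::
  "real \<Rightarrow> (real^'m::finite \<Rightarrow> 'a::euclidean_space \<Rightarrow> real) \<Rightarrow> real^'m \<Rightarrow> real^'m^'m" where
  "V_mat \<alpha> p \<theta>0 = matrix_inv (S_mat \<alpha> p \<theta>0) ** M_mat \<alpha> p \<theta>0 ** matrix_inv (S_mat \<alpha> p \<theta>0)"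

definition sigma2 :: "real \<Rightarrow> ('t \<Rightarrow> 'a::euclidean_space \<Rightarrow> real) \<Rightarrow> 't \<Rightarrow> real" where
  "sigma2 \<alpha> p \<theta>0 =
     (\<integral>x. (h_fun \<alpha> p x \<theta>0)\<^sup>2 \<partial>(law_of (p \<theta>0))) - (\<integral>x. h_fun \<alpha> p x \<theta>0 \<partial>(law_of (p \<theta>0)))\<^sup>2"

end

theory Submission
  imports Defs
begin

text \<open>The estimator maximizes \<open>F\<^sub>n(\<theta>)\<close>, the mean of \<open>n\<close> independent copies of \<open>h(x, \<theta>)\<close>, and the
whole proof compares \<open>F\<^sub>n\<close> near \<open>\<theta>\<^sub>0\<close> with a concave quadratic function. Let \<open>s\<^sub>n\<close> be the gradient of
\<open>F\<^sub>n\<close> at \<open>\<theta>\<^sub>0\<close>, called the score below.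

Hoelder's inequality says that \<open>\<theta>\<^sub>0\<close> maximizes the mean of \<open>h(x, \<theta>)\<close> under \<open>P\<^bsub>\<theta>\<^sub>0\<^esub>\<close>
(\<open>h_mean_maximal\<close>). Integrating a Taylor expansion of \<open>h\<close> with a cubic remainder, which the dominated
third derivatives provide, one reads off that the score has mean zero and that \<open>S\<close> is positive
semidefinite (\<open>mean_jet_at_maximum\<close>). Being invertible, \<open>S\<close> then satisfies
\<open>\<kappa> |u|\<^sup>2 \<le> u \<bullet> S u\<close> for some \<open>\<kappa> > 0\<close>. By the strong law of large numbers, applied to the Hessian and
to the dominating function, the gradient of \<open>F\<^sub>n\<close> changes on the ball of radius \<open>n\<^sup>-\<^sup>1\<^sup>/\<^sup>3\<close> like
the linear map \<open>- S\<close>, up to a relative error which tends to zero almost surely (\<open>quadratic_regime\<close>).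

For (a), square integrability makes the score \<open>o(n\<^sup>-\<^sup>1\<^sup>/\<^sup>3)\<close> almost surely
(\<open>iid_partial_sum_rate\<close>). On a sphere whose radius is a fixed fraction of \<open>n\<^sup>-\<^sup>1\<^sup>/\<^sup>3\<close> the linear
term of \<open>F\<^sub>n\<close> is therefore beaten by the quadratic one, so the maximum over the closed ball is
attained inside. It is attained only once, because the gradient is injective there; this uniqueness
is what makes the maximizer a measurable function of the sample, as the limit of the best points
among the first \<open>k\<close> members of a dense sequence.

For (b), any critical point \<open>\<theta>\<close> in the ball satisfies \<open>|S (\<theta> - \<theta>\<^sub>0) - s\<^sub>n| \<le> o(1) |s\<^sub>n|\<close>. Hence
\<open>sqrt n (\<theta> - \<theta>\<^sub>0)\<close> has the same limit law as \<open>S\<^sup>-\<^sup>1 sqrt n s\<^sub>n\<close>, whose linear functionals are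
normalized sums. The central limit theorem on the real line, and a continuity theorem for
characteristic functions of random vectors
(\<open>weak_convergence_from_characteristic_functions\<close>), give the limit.

For (c), the quadratic comparison bounds \<open>F\<^sub>n(\<theta>) - F\<^sub>n(\<theta>\<^sub>0)\<close> on the ball by \<open>|s\<^sub>n|\<^sup>2 / \<kappa>\<close>. This is of order
\<open>1/n\<close>, and thus negligible after multiplication by \<open>sqrt n\<close>: the maximal value behaves like the
ordinary mean \<open>F\<^sub>n(\<theta>\<^sub>0)\<close>.\<close>

section \<open>Taylor expansions from partial derivatives\<close>

text \<open>Partial derivatives control a function along paths that change one coordinate at a time, and the
length of such a path is the distance in this norm.\<close>

definition l1norm :: "real^'m \<Rightarrow> real" where
  "l1norm u = (\<Sum>i\<in>UNIV. \<bar>u $ i\<bar>)"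

lemma l1norm_nonneg [simp]: "0 \<le> l1norm u"
  by (simp add: l1norm_def sum_nonneg)

lemma l1norm_mono: "(\<And>i. \<bar>u $ i\<bar> \<le> \<bar>v $ i\<bar>) \<Longrightarrow> l1norm u \<le> l1norm v"
  by (simp add: l1norm_def sum_mono)

lemma l1norm_le_norm: "l1norm (u :: real^'m) \<le> CARD('m) * norm u"
proof -
  have "l1norm u \<le> (\<Sum>i\<in>(UNIV :: 'm set). norm u)"
    unfolding l1norm_def by (intro sum_mono component_le_norm_cart)
  then show ?thesis by simp
qed

lemma l1norm_scaleR [simp]: "l1norm (c *\<^sub>R u) = \<bar>c\<bar> * l1norm u"
  by (simp add: l1norm_def abs_mult sum_distrib_left)

lemma l1norm_axis [simp]: "l1norm (axis i c) = \<bar>c\<bar>"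
  by (simp add: l1norm_def axis_def if_distrib[of abs] cong: if_cong)

lemma l1norm_triangle: "l1norm (u + v) \<le> l1norm u + l1norm v"
  unfolding l1norm_def sum.distrib[symmetric] by (intro sum_mono) simp

text \<open>Derivatives along an axis are given at time 0 of a line through the point in question; mean value
arguments need them at an arbitrary time of one fixed line.\<close>

lemma has_axis_derivative_shift:
  fixes f :: "'a::real_vector \<Rightarrow> real"
  assumes "((\<lambda>t. f ((z + s *\<^sub>R e) + t *\<^sub>R e)) has_real_derivative D) (at 0)"
  shows "((\<lambda>t. f (z + t *\<^sub>R e)) has_real_derivative D) (at s)"
proof -
  have "((\<lambda>t. f (z + (t + s) *\<^sub>R e)) has_real_derivative D) (at 0)"
  proof -
    have "(\<lambda>t. f (z + (t + s) *\<^sub>R e)) = (\<lambda>t. f ((z + s *\<^sub>R e) + t *\<^sub>R e))"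
      by (intro ext arg_cong[of _ _ f]) (simp add: algebra_simps)
    then show ?thesis using assms by simp
  qed
  then show ?thesis
    using DERIV_shift[of "\<lambda>t. f (z + t *\<^sub>R e)" D 0 s] by simp
qed

text \<open>The point \<open>x\<close> is moved to \<open>y\<close> one coordinate at a time. Every intermediate point has its coordinates
between those of \<open>x\<close> and \<open>y\<close>, so derivatives are only needed on that box, and no joint
differentiability is assumed.\<close>

lemma mean_value_along_axes:
  fixes f :: "real^'m \<Rightarrow> real"
  assumes deriv: "\<And>z i. (\<And>j. z $ j \<in> closed_segment (x $ j) (y $ j)) \<Longrightarrow>
      ((\<lambda>t. f (z + t *\<^sub>R axis i 1)) has_real_derivative D z i) (at 0)"
    and bound: "\<And>z i. (\<And>j. z $ j \<in> closed_segment (x $ j) (y $ j)) \<Longrightarrow> \<bar>D z i\<bar> \<le> K"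
  shows "\<bar>f y - f x\<bar> \<le> K * l1norm (y - x)"
proof -
  define z where "z A = (\<chi> i. if i \<in> A then y $ i else x $ i)" for A :: "'m set"
  have "finite A \<Longrightarrow> \<bar>f (z A) - f x\<bar> \<le> (\<Sum>i\<in>A. K * \<bar>y $ i - x $ i\<bar>)" for A
  proof (induction A rule: finite_induct)
    case empty
    have "z {} = x" by (simp add: z_def vec_eq_iff)
    then show ?case by simp
  next
    case (insert k A)
    define S where "S = closed_segment 0 (y $ k - x $ k)"
    have seg: "(z A + s *\<^sub>R axis k 1) $ j \<in> closed_segment (x $ j) (y $ j)" if "s \<in> S" for s j
    proof (cases "j = k")
      case True
      then have "(z A + s *\<^sub>R axis k 1) $ j = x $ k + s" using insert by (simp add: z_def)
      moreover have "x $ k + s \<in> closed_segment (x $ k + 0) (x $ k + (y $ k - x $ k))"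
        using that unfolding S_def closed_segment_translation[of "x $ k" 0] by blast
      ultimately show ?thesis using True by simp
    next
      case False then show ?thesis by (simp add: z_def axis_def)
    qed
    have "norm (f (z A + (y $ k - x $ k) *\<^sub>R axis k 1) - f (z A + 0 *\<^sub>R axis k 1))
        \<le> K * norm ((y $ k - x $ k) - 0)"
    proof (rule field_differentiable_bound[of S "\<lambda>s. f (z A + s *\<^sub>R axis k 1)"
          "\<lambda>s. D (z A + s *\<^sub>R axis k 1) k"])
      fix s assume s: "s \<in> S"
      show "((\<lambda>s. f (z A + s *\<^sub>R axis k 1)) has_field_derivative D (z A + s *\<^sub>R axis k 1) k)
          (at s within S)"
        by (rule has_field_derivative_at_within, rule has_axis_derivative_shift) (intro deriv seg s)
      show "norm (D (z A + s *\<^sub>R axis k 1) k) \<le> K"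
        unfolding real_norm_def by (intro bound seg s)
    qed (auto simp: S_def)
    moreover have "z A + (y $ k - x $ k) *\<^sub>R axis k 1 = z (insert k A)"
      using insert by (auto simp: z_def vec_eq_iff axis_def)
    ultimately have "\<bar>f (z (insert k A)) - f (z A)\<bar> \<le> K * \<bar>y $ k - x $ k\<bar>" by simp
    then show ?case using insert by simp
  qed
  from this[of UNIV] have "\<bar>f (z UNIV) - f x\<bar> \<le> K * l1norm (y - x)"
    by (simp add: l1norm_def sum_distrib_left)
  moreover have "z UNIV = y" by (simp add: z_def vec_eq_iff)
  ultimately show ?thesis by simp
qed

lemma closed_segment_box_cart:
  fixes x y z :: "real^'m"
  assumes "x \<in> box a b" "y \<in> box a b" "\<And>j. z $ j \<in> closed_segment (x $ j) (y $ j)"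
  shows "z \<in> box a b"
proof -
  have "a $ j < z $ j \<and> z $ j < b $ j" for j
  proof -
    have "x $ j \<in> {a $ j<..<b $ j}" "y $ j \<in> {a $ j<..<b $ j}"
      using assms by (auto simp: mem_box_cart)
    then have "closed_segment (x $ j) (y $ j) \<subseteq> {a $ j<..<b $ j}"
      by (intro closed_segment_subset) auto
    then show ?thesis using assms(3)[of j] by auto
  qed
  then show ?thesis by (simp add: mem_box_cart)
qed

lemma l1norm_segment_le:
  fixes x y z :: "real^'m"
  assumes "\<And>j. z $ j \<in> closed_segment (x $ j) (y $ j)"
  shows "l1norm (z - x) \<le> l1norm (y - x)"
proof (rule l1norm_mono)
  fix i
  show "\<bar>(z - x) $ i\<bar> \<le> \<bar>(y - x) $ i\<bar>"
    using segment_bound1[OF assms[of i]] by simp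
qed

text \<open>The second order data of a function: gradient, Hessian, and a Lipschitz constant for the Hessian.
All Taylor expansions below depend on these data only, and the predicate is stable under averaging,
which carries it from single observations to the empirical mean. As for iterated partial
derivatives, the row index of the Hessian belongs to the derivative taken last.\<close>

definition jet :: "(real^'m) set \<Rightarrow> real \<Rightarrow> (real^'m \<Rightarrow> real) \<Rightarrow> (real^'m \<Rightarrow> real^'m) \<Rightarrow>
    (real^'m \<Rightarrow> real^'m^'m) \<Rightarrow> bool" where
  "jet U L f g H \<longleftrightarrow> 0 \<le> L \<and>
     (\<forall>\<theta>\<in>U. \<forall>j. ((\<lambda>t. f (\<theta> + t *\<^sub>R axis j 1)) has_real_derivative g \<theta> $ j) (at 0)) \<and>
     (\<forall>\<theta>\<in>U. \<forall>i j. ((\<lambda>t. g (\<theta> + t *\<^sub>R axis i 1) $ j) has_real_derivative H \<theta> $ i $ j) (at 0)) \<and>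
     (\<forall>\<theta>\<in>U. \<forall>\<theta>'\<in>U. \<forall>i j. \<bar>H \<theta> $ i $ j - H \<theta>' $ i $ j\<bar> \<le> L * l1norm (\<theta> - \<theta>'))"

lemma
  assumes "jet U L f g H"
  shows jet_nonneg: "0 \<le> L"
    and jet_has_partial: "\<theta> \<in> U \<Longrightarrow> ((\<lambda>t. f (\<theta> + t *\<^sub>R axis j 1)) has_real_derivative g \<theta> $ j) (at 0)"
    and jet_has_second_partial: "\<theta> \<in> U \<Longrightarrow>
      ((\<lambda>t. g (\<theta> + t *\<^sub>R axis i 1) $ j) has_real_derivative H \<theta> $ i $ j) (at 0)"
    and jet_hessian_lipschitz: "\<theta> \<in> U \<Longrightarrow> \<theta>' \<in> U \<Longrightarrow>
      \<bar>H \<theta> $ i $ j - H \<theta>' $ i $ j\<bar> \<le> L * l1norm (\<theta> - \<theta>')"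
  using assms unfolding jet_def by blast+

text \<open>Third order partial derivatives bounded by \<open>L\<close> make the second order ones Lipschitz, by the mean value
theorem.\<close>

lemma jet_of_bounded_partials:
  fixes f :: "real^'m \<Rightarrow> real"
  assumes ex: "partials_exist_on 3 (box a b) f"
    and bound: "\<And>\<theta> ks. \<theta> \<in> box a b \<Longrightarrow> length ks = 3 \<Longrightarrow> \<bar>partials ks f \<theta>\<bar> \<le> L"
    and L: "0 \<le> L"
  shows "jet (box a b) L f (grad f) (hessian f)"
proof -
  have D: "((\<lambda>t. partials ks f (\<theta> + t *\<^sub>R axis i 1)) has_real_derivative partials (i # ks) f \<theta>) (at 0)"
    if "\<theta> \<in> box a b" "length ks < 3" for ks i \<theta>
  proof -
    have "(\<lambda>t. partials ks f (\<theta> + t *\<^sub>R axis i 1)) field_differentiable at 0"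
      by (rule ex[unfolded partials_exist_on_def, rule_format, OF that(2,1)])
    then show ?thesis
      by (simp only: partials.simps partial_deriv_def DERIV_deriv_iff_field_differentiable)
  qed
  have A: "\<bar>partials [i, j] f \<theta> - partials [i, j] f \<theta>'\<bar> \<le> L * l1norm (\<theta> - \<theta>')"
    if "\<theta> \<in> box a b" "\<theta>' \<in> box a b" for \<theta> \<theta>' i j
  proof (rule mean_value_along_axes[where D = "\<lambda>z k. partials [k, i, j] f z"])
    fix z :: "real^'m" and k assume seg: "\<And>j. z $ j \<in> closed_segment (\<theta>' $ j) (\<theta> $ j)"
    have z: "z \<in> box a b" by (rule closed_segment_box_cart[OF that(2) that(1) seg])
    show "((\<lambda>t. partials [i, j] f (z + t *\<^sub>R axis k 1)) has_real_derivative partials [k, i, j] f z) (at 0)"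
      by (rule D) (use z in auto)
    show "\<bar>partials [k, i, j] f z\<bar> \<le> L" by (rule bound) (use z in auto)
  qed
  have A': "\<bar>hessian f \<theta> $ i $ j - hessian f \<theta>' $ i $ j\<bar> \<le> L * l1norm (\<theta> - \<theta>')"
    if "\<theta> \<in> box a b" "\<theta>' \<in> box a b" for \<theta> \<theta>' i j
    using A[OF that] by (simp only: hessian_def vec_lambda_beta)
  have B: "((\<lambda>t. f (\<theta> + t *\<^sub>R axis j 1)) has_real_derivative grad f \<theta> $ j) (at 0)"
    if "\<theta> \<in> box a b" for \<theta> j
  proof -
    have "((\<lambda>t. partials [] f (\<theta> + t *\<^sub>R axis j 1)) has_real_derivative partials [j] f \<theta>) (at 0)"
      by (rule D[OF that]) simp
    then show ?thesis unfolding grad_def vec_lambda_beta partials.simps(1) .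
  qed
  have C: "((\<lambda>t. grad f (\<theta> + t *\<^sub>R axis i 1) $ j) has_real_derivative hessian f \<theta> $ i $ j) (at 0)"
    if "\<theta> \<in> box a b" for \<theta> i j
  proof -
    have "((\<lambda>t. partials [j] f (\<theta> + t *\<^sub>R axis i 1)) has_real_derivative partials [i, j] f \<theta>) (at 0)"
      by (rule D[OF that]) simp
    then show ?thesis unfolding grad_def hessian_def vec_lambda_beta .
  qed
  show ?thesis
    unfolding jet_def by (intro conjI ballI allI L A' B C)
qed

lemma jet_scaled_sum:
  assumes "\<And>k. k \<in> A \<Longrightarrow> jet U (L k) (f k) (g k) (H k)" "finite A" "0 \<le> c"
  shows "jet U (c * (\<Sum>k\<in>A. L k)) (\<lambda>\<theta>. c * (\<Sum>k\<in>A. f k \<theta>)) (\<lambda>\<theta>. c *\<^sub>R (\<Sum>k\<in>A. g k \<theta>))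
    (\<lambda>\<theta>. c *\<^sub>R (\<Sum>k\<in>A. H k \<theta>))"
  unfolding jet_def
proof (intro conjI ballI allI)
  show "0 \<le> c * (\<Sum>k\<in>A. L k)" using assms(3) by (intro mult_nonneg_nonneg sum_nonneg jet_nonneg[OF assms(1)])
next
  fix \<theta> j assume "\<theta> \<in> U"
  then show "((\<lambda>t. c * (\<Sum>k\<in>A. f k (\<theta> + t *\<^sub>R axis j 1))) has_real_derivative
      (c *\<^sub>R (\<Sum>k\<in>A. g k \<theta>)) $ j) (at 0)"
    unfolding vector_scaleR_component sum_component real_scaleR_def
    by (intro DERIV_cmult DERIV_sum jet_has_partial[OF assms(1)])
next
  fix \<theta> i j assume "\<theta> \<in> U"
  then show "((\<lambda>t. (c *\<^sub>R (\<Sum>k\<in>A. g k (\<theta> + t *\<^sub>R axis i 1))) $ j) has_real_derivative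
      (c *\<^sub>R (\<Sum>k\<in>A. H k \<theta>)) $ i $ j) (at 0)"
    unfolding vector_scaleR_component sum_component real_scaleR_def
    by (intro DERIV_cmult DERIV_sum jet_has_second_partial[OF assms(1)])
next
  fix \<theta> \<theta>' i j assume "\<theta> \<in> U" "\<theta>' \<in> U"
  then have *: "\<bar>H k \<theta> $ i $ j - H k \<theta>' $ i $ j\<bar> \<le> L k * l1norm (\<theta> - \<theta>')" if "k \<in> A" for k
    using jet_hessian_lipschitz[OF assms(1)[OF that]] by blast
  have "\<bar>(\<Sum>k\<in>A. H k \<theta> $ i $ j) - (\<Sum>k\<in>A. H k \<theta>' $ i $ j)\<bar>
      \<le> (\<Sum>k\<in>A. \<bar>H k \<theta> $ i $ j - H k \<theta>' $ i $ j\<bar>)"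
    by (simp add: sum_subtractf[symmetric])
  also have "\<dots> \<le> (\<Sum>k\<in>A. L k) * l1norm (\<theta> - \<theta>')"
    unfolding sum_distrib_right by (intro sum_mono *)
  finally show "\<bar>(c *\<^sub>R (\<Sum>k\<in>A. H k \<theta>)) $ i $ j - (c *\<^sub>R (\<Sum>k\<in>A. H k \<theta>')) $ i $ j\<bar>
      \<le> c * (\<Sum>k\<in>A. L k) * l1norm (\<theta> - \<theta>')"
    using \<open>0 \<le> c\<close> by (simp add: right_diff_distrib[symmetric] abs_mult mult.assoc mult_left_mono)
qed

lemma linear_axis_derivative:
  "((\<lambda>t. \<Sum>i\<in>UNIV. w $ i * ((z + t *\<^sub>R axis k 1 - x) $ i)) has_real_derivative w $ k) (at 0)"
proof -
  have "((\<lambda>t. w \<bullet> (z - x) + t * w $ k) has_real_derivative w $ k) (at 0)"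
    by (auto intro!: derivative_eq_intros)
  also have "(\<lambda>t. w \<bullet> (z - x) + t * w $ k) =
      (\<lambda>t. \<Sum>i\<in>UNIV. w $ i * ((z + t *\<^sub>R axis k 1 - x) $ i))"
  proof
    fix t
    have "w \<bullet> (z - x) + t * w $ k = w \<bullet> (z + t *\<^sub>R axis k 1 - x)"
      by (simp add: inner_diff_right inner_add_right inner_axis)
    then show "w \<bullet> (z - x) + t * w $ k = (\<Sum>i\<in>UNIV. w $ i * ((z + t *\<^sub>R axis k 1 - x) $ i))"
      by (simp add: inner_vec_def)
  qed
  finally show ?thesis .
qed

text \<open>Subtracting the linear part leaves a function whose partial derivatives are differences of Hessian
entries, hence of size at most \<open>L\<close> times the distance.\<close>

lemma jet_gradient_expansion:
  assumes jet: "jet (box a b) L f g H" and x: "x \<in> box a b" and y: "y \<in> box a b"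
  shows "\<bar>g y $ j - g x $ j - (\<Sum>i\<in>UNIV. H x $ i $ j * (y - x) $ i)\<bar> \<le> L * (l1norm (y - x))\<^sup>2"
proof -
  define F where "F z = g z $ j - (\<Sum>i\<in>UNIV. (\<chi> i. H x $ i $ j) $ i * (z - x) $ i)" for z
  have "\<bar>F y - F x\<bar> \<le> (L * l1norm (y - x)) * l1norm (y - x)"
  proof (rule mean_value_along_axes[where D = "\<lambda>z i. H z $ i $ j - (\<chi> i. H x $ i $ j) $ i"])
    fix z k assume seg: "\<And>j. z $ j \<in> closed_segment (x $ j) (y $ j)"
    have z: "z \<in> box a b" by (rule closed_segment_box_cart[OF x y seg])
    show "((\<lambda>t. F (z + t *\<^sub>R axis k 1)) has_real_derivative H z $ k $ j - (\<chi> i. H x $ i $ j) $ k) (at 0)"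
      unfolding F_def by (intro DERIV_diff linear_axis_derivative jet_has_second_partial[OF jet z])
    have "\<bar>H z $ k $ j - H x $ k $ j\<bar> \<le> L * l1norm (z - x)" by (rule jet_hessian_lipschitz[OF jet z x])
    also have "\<dots> \<le> L * l1norm (y - x)"
      by (intro mult_left_mono l1norm_segment_le[OF seg] jet_nonneg[OF jet])
    finally show "\<bar>H z $ k $ j - (\<chi> i. H x $ i $ j) $ k\<bar> \<le> L * l1norm (y - x)" by simp
  qed
  then have "\<bar>F y - F x\<bar> \<le> L * (l1norm (y - x))\<^sup>2"
    by (simp only: power2_eq_square mult.assoc)
  then show ?thesis by (simp add: F_def)
qed

text \<open>The mixed second difference is an increment in direction \<open>i\<close> of a first difference in direction \<open>j\<close>;
its derivative is a difference of two gradients at distance \<open>s\<close>. The value of the difference is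
symmetric in \<open>i\<close> and \<open>j\<close>, its approximation is not, which forces the Hessian to be symmetric.\<close>

lemma jet_second_difference:
  assumes jet: "jet (box a b) L f g H" and x: "x \<in> box a b" and s: "0 < s"
    and ball: "ball x (3 * s) \<subseteq> box a b"
  shows "\<bar>f (x + s *\<^sub>R axis i 1 + s *\<^sub>R axis j 1) - f (x + s *\<^sub>R axis i 1)
      - f (x + s *\<^sub>R axis j 1) + f x - s\<^sup>2 * H x $ j $ i\<bar> \<le> 5 * L * s ^ 3"
proof -
  have L: "0 \<le> L" using jet by (rule jet_nonneg)
  define F where "F t = f ((x + s *\<^sub>R axis j 1) + t *\<^sub>R axis i 1) - f (x + t *\<^sub>R axis i 1) - t * (s * H x $ j $ i)" for t
  define DF where "DF t = g ((x + s *\<^sub>R axis j 1) + t *\<^sub>R axis i 1) $ i - g (x + t *\<^sub>R axis i 1) $ i - s * H x $ j $ i" for t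
  have inb: "x + c *\<^sub>R axis j 1 + t *\<^sub>R axis i 1 \<in> box a b" if "\<bar>t\<bar> \<le> s" "\<bar>c\<bar> \<le> s" for t c
  proof -
    have "norm (c *\<^sub>R axis j 1 + t *\<^sub>R axis i (1::real)) \<le> \<bar>c\<bar> + \<bar>t\<bar>"
      by (rule order_trans[OF norm_triangle_ineq]) simp
    also have "\<dots> < 3 * s" using that s by linarith
    finally have "dist (x + (c *\<^sub>R axis j 1 + t *\<^sub>R axis i 1)) x < 3 * s"
      by (simp add: dist_norm)
    then have "x + c *\<^sub>R axis j 1 + t *\<^sub>R axis i 1 \<in> ball x (3 * s)"
      by (simp add: dist_commute add.assoc)
    then show ?thesis using ball by auto
  qed
  have exp: "\<bar>g (x + c *\<^sub>R axis j 1 + t *\<^sub>R axis i 1) $ i - g x $ i - c * H x $ j $ i - t * H x $ i $ i\<bar>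
      \<le> L * (\<bar>c\<bar> + \<bar>t\<bar>)\<^sup>2" if "\<bar>t\<bar> \<le> s" "\<bar>c\<bar> \<le> s" for t c
  proof -
    have "(\<Sum>k\<in>UNIV. H x $ k $ i * (x + c *\<^sub>R axis j 1 + t *\<^sub>R axis i 1 - x) $ k)
        = (\<chi> k. H x $ k $ i) \<bullet> (c *\<^sub>R axis j 1 + t *\<^sub>R axis i 1)"
      by (simp add: inner_vec_def)
    also have "\<dots> = c * H x $ j $ i + t * H x $ i $ i"
      by (simp add: inner_add_right inner_axis)
    finally have "\<bar>g (x + c *\<^sub>R axis j 1 + t *\<^sub>R axis i 1) $ i - g x $ i - c * H x $ j $ i - t * H x $ i $ i\<bar>
      \<le> L * (l1norm (c *\<^sub>R axis j 1 + t *\<^sub>R axis i (1::real)))\<^sup>2"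
      using jet_gradient_expansion[OF jet x inb[OF that], of i] by (simp add: algebra_simps)
    also have "\<dots> \<le> L * (\<bar>c\<bar> + \<bar>t\<bar>)\<^sup>2"
      using l1norm_triangle[of "c *\<^sub>R axis j 1" "t *\<^sub>R axis i 1"] L
      by (intro mult_left_mono power_mono) auto
    finally show ?thesis .
  qed
  have "norm (F s - F 0) \<le> (5 * L * s\<^sup>2) * norm (s - 0)"
  proof (rule field_differentiable_bound[of "{0..s}" F DF])
    fix t assume t: "t \<in> {0..s}"
    have 1: "x + s *\<^sub>R axis j 1 + t *\<^sub>R axis i 1 \<in> box a b" using t s by (intro inb) auto
    have 2: "x + t *\<^sub>R axis i 1 \<in> box a b" using inb[of t 0] t s by auto
    have lin: "((\<lambda>t. t * (s * H x $ j $ i)) has_real_derivative s * H x $ j $ i) (at t)"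
      by (auto intro!: derivative_eq_intros)
    show "(F has_field_derivative DF t) (at t within {0..s})"
      unfolding F_def DF_def
      by (rule has_field_derivative_at_within) (intro DERIV_diff lin
          has_axis_derivative_shift[OF jet_has_partial[OF jet 1]]
          has_axis_derivative_shift[OF jet_has_partial[OF jet 2]])
    have "\<bar>DF t\<bar> \<le> L * (s + t)\<^sup>2 + L * t\<^sup>2"
    proof -
      have "\<bar>t\<bar> = t" "\<bar>s\<bar> = s" "\<bar>t\<bar> \<le> s" using t s by auto
      then show ?thesis using exp[of t s] exp[of t 0] s unfolding DF_def by simp
    qed
    also have "\<dots> \<le> L * (s + s)\<^sup>2 + L * s\<^sup>2"
      using L t by (intro add_mono mult_left_mono power_mono) auto
    finally show "norm (DF t) \<le> 5 * L * s\<^sup>2" by (simp add: power2_eq_square algebra_simps)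
  qed (use s in auto)
  then have "\<bar>F s - F 0\<bar> \<le> 5 * L * s ^ 3"
    using s by (simp add: power2_eq_square power3_eq_cube mult.assoc)
  moreover have "x + s *\<^sub>R axis j 1 + s *\<^sub>R axis i 1 = x + s *\<^sub>R axis i 1 + s *\<^sub>R axis j 1"
    by (simp add: add_ac)
  then have "F s - F 0 = f (x + s *\<^sub>R axis i 1 + s *\<^sub>R axis j 1) - f (x + s *\<^sub>R axis i 1)
      - f (x + s *\<^sub>R axis j 1) + f x - s\<^sup>2 * H x $ j $ i"
    unfolding F_def by (simp only: scaleR_zero_left add_0_right) (simp add: power2_eq_square mult.assoc)
  ultimately show ?thesis by simp
qed

lemma jet_hessian_symmetric:
  assumes jet: "jet (box a b) L f g H" and x: "x \<in> box a b"
  shows "H x $ i $ j = H x $ j $ i"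
proof -
  obtain e where e: "0 < e" "ball x e \<subseteq> box a b"
    using x open_box open_contains_ball by blast
  have "\<bar>H x $ i $ j - H x $ j $ i\<bar> \<le> 10 * L * s" if s: "0 < s" "3 * s \<le> e" for s
  proof -
    have ball: "ball x (3 * s) \<subseteq> box a b" using e s subset_ball[of "3 * s" e x] by blast
    have comm: "x + s *\<^sub>R axis j 1 + s *\<^sub>R axis i 1 = x + s *\<^sub>R axis i 1 + s *\<^sub>R axis j 1"
      by (simp add: add_ac)
    have "\<bar>s\<^sup>2 * H x $ i $ j - s\<^sup>2 * H x $ j $ i\<bar> \<le> 10 * L * s ^ 3"
      using jet_second_difference[OF jet x s(1) ball, of i j]
        jet_second_difference[OF jet x s(1) ball, of j i]
      unfolding comm by linarith
    moreover have "\<bar>s\<^sup>2 * H x $ i $ j - s\<^sup>2 * H x $ j $ i\<bar> = s\<^sup>2 * \<bar>H x $ i $ j - H x $ j $ i\<bar>"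
      by (simp only: abs_mult right_diff_distrib[symmetric]) simp
    moreover have "10 * L * s ^ 3 = s\<^sup>2 * (10 * L * s)"
      by (simp add: power2_eq_square power3_eq_cube)
    ultimately show ?thesis using s by (simp add: mult_le_cancel_left_pos)
  qed
  then have *: "\<forall>\<^sub>F s in at_right 0. \<bar>H x $ i $ j - H x $ j $ i\<bar> \<le> 10 * L * s"
    using e by (auto simp: eventually_at_right_field intro!: exI[of _ "e / 3"])
  have "((\<lambda>s. 10 * L * s) \<longlongrightarrow> 10 * L * 0) (at_right 0)"
    by (intro tendsto_intros)
  from tendsto_lowerbound[OF this *] show ?thesis by simp
qed

text \<open>The mean value theorem applied to \<open>f\<close> minus its quadratic Taylor polynomial. The gradient of that
polynomial is the expression in \<open>jet_gradient_expansion\<close> because the Hessian is symmetric.\<close>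

lemma jet_taylor:
  assumes jet: "jet (box a b) L f g H" and x: "x \<in> box a b" and y: "y \<in> box a b"
  shows "\<bar>f y - f x - g x \<bullet> (y - x) - (y - x) \<bullet> (H x *v (y - x)) / 2\<bar> \<le> L * l1norm (y - x) ^ 3"
proof -
  define F where "F z = f z - g x \<bullet> (z - x) - (z - x) \<bullet> (H x *v (z - x)) / 2" for z
  define DF where "DF z j = g z $ j - g x $ j - (\<Sum>i\<in>UNIV. H x $ i $ j * (z - x) $ i)" for z j
  have sym: "transpose (H x) = H x"
    using jet_hessian_symmetric[OF jet x] by (simp add: transpose_def vec_eq_iff)
  have quad: "((\<lambda>t. (w + t *\<^sub>R axis k 1) \<bullet> (H x *v (w + t *\<^sub>R axis k 1)) / 2) has_real_derivative
      (\<Sum>i\<in>UNIV. H x $ i $ k * w $ i)) (at 0)" for w k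
  proof -
    have s: "w \<bullet> (H x *v axis k 1) = (H x *v w) $ k"
    proof -
      have "w \<bullet> (H x *v axis k 1) = (transpose (H x) *v w) \<bullet> axis k 1"
        by (simp only: dot_lmul_matrix transpose_matrix_vector)
      then show ?thesis by (simp add: sym inner_axis)
    qed
    have "(w + t *\<^sub>R axis k 1) \<bullet> (H x *v (w + t *\<^sub>R axis k 1)) / 2
        = w \<bullet> (H x *v w) / 2 + t * (H x *v w) $ k + t * t * (axis k 1 \<bullet> (H x *v axis k 1)) / 2" for t
      by (simp add: matrix_vector_right_distrib matrix_vector_mult_scaleR inner_add_left inner_add_right s
          inner_axis' algebra_simps)
    moreover have "(\<Sum>i\<in>UNIV. H x $ i $ k * w $ i) = (H x *v w) $ k"
      using jet_hessian_symmetric[OF jet x] by (simp add: matrix_vector_mult_def)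
    ultimately show ?thesis by (auto intro!: derivative_eq_intros)
  qed
  have "\<bar>F y - F x\<bar> \<le> (L * (l1norm (y - x))\<^sup>2) * l1norm (y - x)"
  proof (rule mean_value_along_axes[where D = DF])
    fix z k assume seg: "\<And>j. z $ j \<in> closed_segment (x $ j) (y $ j)"
    have z: "z \<in> box a b" by (rule closed_segment_box_cart[OF x y seg])
    have lin: "((\<lambda>t. g x \<bullet> (z + t *\<^sub>R axis k 1 - x)) has_real_derivative g x $ k) (at 0)"
      using linear_axis_derivative[of "g x" z k x] by (simp add: inner_vec_def)
    have q: "((\<lambda>t. (z + t *\<^sub>R axis k 1 - x) \<bullet> (H x *v (z + t *\<^sub>R axis k 1 - x)) / 2) has_real_derivative
      (\<Sum>i\<in>UNIV. H x $ i $ k * (z - x) $ i)) (at 0)"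
      using quad[of "z - x" k] by (simp add: algebra_simps)
    show "((\<lambda>t. F (z + t *\<^sub>R axis k 1)) has_real_derivative DF z k) (at 0)"
      unfolding F_def DF_def by (intro DERIV_diff lin q jet_has_partial[OF jet z])
    have "\<bar>DF z k\<bar> \<le> L * (l1norm (z - x))\<^sup>2"
      unfolding DF_def by (rule jet_gradient_expansion[OF jet x z])
    also have "\<dots> \<le> L * (l1norm (y - x))\<^sup>2"
      by (intro mult_left_mono power_mono l1norm_segment_le[OF seg] jet_nonneg[OF jet] l1norm_nonneg)
    finally show "\<bar>DF z k\<bar> \<le> L * (l1norm (y - x))\<^sup>2" .
  qed
  then show ?thesis by (simp add: F_def power2_eq_square power3_eq_cube mult.assoc)
qed

lemma continuous_on_jet:
  assumes jet: "jet (box a b) L f g H"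
  shows "continuous_on (box a b) f"
proof (rule continuous_at_imp_continuous_on, rule ballI)
  fix x assume x: "x \<in> box a b"
  define R where "R y = \<bar>g x \<bullet> (y - x) + (y - x) \<bullet> (H x *v (y - x)) / 2\<bar> + L * l1norm (y - x) ^ 3" for y
  have "(R \<longlongrightarrow> \<bar>g x \<bullet> (x - x) + (x - x) \<bullet> (H x *v (x - x)) / 2\<bar> + L * l1norm (x - x) ^ 3) (at x)"
    unfolding R_def l1norm_def matrix_vector_mult_def by (intro tendsto_intros vec_tendstoI) auto
  then have R: "(R \<longlongrightarrow> 0) (at x)" by (simp add: l1norm_def)
  have "((\<lambda>y. f y - f x) \<longlongrightarrow> 0) (at x)"
  proof (rule Lim_null_comparison[OF _ R])
    have "\<forall>\<^sub>F y in at x. y \<in> box a b" using x by (intro eventually_at_in_open' open_box)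
    then show "\<forall>\<^sub>F y in at x. norm (f y - f x) \<le> R y"
    proof eventually_elim
      case (elim y)
      then show ?case using jet_taylor[OF jet x elim] unfolding R_def by simp
    qed
  qed
  then show "isCont f x" by (simp add: isCont_def LIM_zero_iff)
qed

section \<open>Quadratic forms\<close>

lemma symmetric_matrix_inner:
  fixes V :: "real^'m^'m"
  assumes "transpose V = V"
  shows "x \<bullet> (V *v y) = y \<bullet> (V *v x)"
  by (metis assms dot_lmul_matrix inner_commute transpose_matrix_vector)

lemma quadratic_form_add_scaled:
  fixes V :: "real^'m^'m"
  assumes "transpose V = V"
  shows "(x + c *\<^sub>R y) \<bullet> (V *v (x + c *\<^sub>R y)) = x \<bullet> (V *v x) + 2 * c * (y \<bullet> (V *v x)) + c\<^sup>2 * (y \<bullet> (V *v y))"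
  using symmetric_matrix_inner[OF assms, of x y]
  by (simp add: matrix_vector_right_distrib matrix_vector_mult_scaleR inner_add_left inner_add_right
      power2_eq_square algebra_simps)

text \<open>A zero \<open>u \<noteq> 0\<close> of a positive semidefinite form is in the kernel, as otherwise the form would be negative
at \<open>u - t S u\<close> for small \<open>t > 0\<close>. An invertible form is therefore positive on the unit sphere, and by
compactness bounded away from zero there.\<close>

lemma psd_invertible_coercive:
  fixes S :: "real^'m^'m"
  assumes sym: "transpose S = S" and psd: "\<And>u. 0 \<le> u \<bullet> (S *v u)" and inv: "invertible S"
  obtains \<kappa> where "0 < \<kappa>" "\<And>u. \<kappa> * (norm u)\<^sup>2 \<le> u \<bullet> (S *v u)"
proof -
  have pos: "0 < u \<bullet> (S *v u)" if u: "u \<noteq> 0" for u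
  proof (rule ccontr)
    assume "\<not> 0 < u \<bullet> (S *v u)"
    then have u0: "u \<bullet> (S *v u) = 0" using psd[of u] by simp
    define w where "w = S *v u"
    define c where "c = w \<bullet> (S *v w)"
    have q: "0 \<le> 2 * t * (w \<bullet> w) + t * t * c" for t
      using psd[of "u + t *\<^sub>R w"] u0 unfolding quadratic_form_add_scaled[OF sym] c_def
      by (simp add: w_def[symmetric] power2_eq_square)
    have c0: "0 \<le> c" unfolding c_def by (rule psd)
    \<comment> \<open>this step length makes the linear term dominate; \<open>c + 1\<close> avoids dividing by zero\<close>
    define s where "s = (w \<bullet> w) / (c + 1)"
    have "0 \<le> 2 * (- s) * (w \<bullet> w) + (- s) * (- s) * c" by (rule q)
    moreover have "s * c \<le> w \<bullet> w" unfolding s_def using c0 by (simp add: field_simps)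
    then have "s * (s * c) \<le> s * (w \<bullet> w)" using c0 by (intro mult_left_mono) (auto simp: s_def)
    ultimately have "s * (w \<bullet> w) \<le> 0" by simp
    have "w \<bullet> w = 0"
    proof (rule ccontr)
      assume "w \<bullet> w \<noteq> 0"
      then have "0 < w \<bullet> w" by simp
      moreover from this have "0 < s" unfolding s_def using c0 by simp
      ultimately have "0 < s * (w \<bullet> w)" by (rule mult_pos_pos[rotated])
      then show False using \<open>s * (w \<bullet> w) \<le> 0\<close> by simp
    qed
    then have "S *v u = 0" unfolding w_def by simp
    obtain S' where S': "S' ** S = mat 1" using inv unfolding invertible_def by blast
    have "u = (S' ** S) *v u" unfolding S' by simp
    also have "\<dots> = S' *v (S *v u)" by (rule matrix_vector_mul_assoc[symmetric])
    finally have "u = 0" unfolding \<open>S *v u = 0\<close> by simp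
    then show False using u by simp
  qed
  show ?thesis
  proof -
    have ne: "sphere (0 :: real^'m) 1 \<noteq> {}"
    proof -
      have "axis undefined 1 \<in> sphere (0 :: real^'m) 1" by simp
      then show ?thesis by blast
    qed
    have "continuous_on (sphere 0 1) (\<lambda>u. u \<bullet> (S *v u))"
      unfolding matrix_vector_mult_def by (intro continuous_intros continuous_on_vec_lambda)
    then obtain v where v: "v \<in> sphere 0 1" "\<And>u. u \<in> sphere 0 1 \<Longrightarrow> v \<bullet> (S *v v) \<le> u \<bullet> (S *v u)"
      using continuous_attains_inf[OF compact_sphere ne] by blast
    have "v \<noteq> 0" using v(1) by auto
    then have "0 < v \<bullet> (S *v v)" by (rule pos)
    moreover have "(v \<bullet> (S *v v)) * (norm u)\<^sup>2 \<le> u \<bullet> (S *v u)" for u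
    proof (cases "u = 0")
      case False
      define w where "w = (1 / norm u) *\<^sub>R u"
      have "w \<in> sphere 0 1" using False by (simp add: w_def)
      then have "v \<bullet> (S *v v) \<le> w \<bullet> (S *v w)" by (rule v(2))
      also have "\<dots> = (u \<bullet> (S *v u)) / (norm u)\<^sup>2"
        unfolding w_def by (simp add: matrix_vector_mult_scaleR power2_eq_square)
      finally show ?thesis using False by (simp add: field_simps)
    qed simp
    ultimately show ?thesis by (rule that)
  qed
qed

section \<open>Comparison with a concave quadratic function\<close>

text \<open>Near \<open>\<theta>0\<close> the gradient behaves like the linear map \<open>- S\<close> if the Hessian at \<open>\<theta>0\<close> is close to \<open>- S\<close>. The
estimate for two arbitrary points gives both uniqueness of critical points and the linearization at
\<open>\<theta>0\<close>.\<close>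

lemma jet_gradient_two_point:
  fixes S :: "real^'m^'m" and L r d :: real
  assumes jet: "jet (box a b) L f g H" and box: "x \<in> box a b" "y \<in> box a b" "\<theta>0 \<in> box a b"
    and near: "norm (x - \<theta>0) \<le> r" "norm (y - \<theta>0) \<le> r"
    and HS: "\<And>i j. \<bar>H \<theta>0 $ i $ j + S $ i $ j\<bar> \<le> d" and sym: "transpose S = S"
  shows "norm (g y - g x + S *v (y - x)) \<le> (real CARD('m))\<^sup>2 * (d + 3 * real CARD('m) * r * L) * norm (y - x)"
proof -
  define m where "m = real CARD('m)"
  define u where "u = y - x"
  have L: "0 \<le> L" by (rule jet_nonneg[OF jet])
  have r: "0 \<le> r" using near(1) norm_ge_zero order_trans by blast
  have m: "0 \<le> m" unfolding m_def by simp
  have l1u: "l1norm u \<le> 2 * m * r"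
  proof -
    have "norm u \<le> norm (y - \<theta>0) + norm (x - \<theta>0)"
      unfolding u_def using norm_triangle_ineq4[of "y - \<theta>0" "x - \<theta>0"] by simp
    then have "m * norm u \<le> m * (2 * r)" using near m by (intro mult_left_mono) auto
    then show ?thesis using l1norm_le_norm[of u, folded m_def] by linarith
  qed
  have Hx: "\<bar>H x $ i $ j + S $ i $ j\<bar> \<le> d + m * r * L" for i j
  proof -
    have "\<bar>H x $ i $ j - H \<theta>0 $ i $ j\<bar> \<le> L * l1norm (x - \<theta>0)"
      by (rule jet_hessian_lipschitz[OF jet box(1,3)])
    also have "\<dots> \<le> L * (m * r)"
      using l1norm_le_norm[of "x - \<theta>0"] near(1) m L unfolding m_def
      by (intro mult_left_mono) (auto intro: order_trans mult_left_mono)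
    finally have "\<bar>H x $ i $ j - H \<theta>0 $ i $ j\<bar> \<le> m * r * L" by (simp add: mult_ac)
    then show ?thesis using HS[of i j] by linarith
  qed
  have comp: "\<bar>(g y - g x + S *v u) $ j\<bar> \<le> (d + 3 * m * r * L) * l1norm u" for j
  proof -
    have Su: "(S *v u) $ j = (\<Sum>i\<in>UNIV. S $ i $ j * u $ i)"
    proof -
      have "S $ j $ i = S $ i $ j" for i using sym unfolding transpose_def by (metis vec_lambda_beta)
      then show ?thesis by (simp add: matrix_vector_mult_def)
    qed
    have "(g y - g x + S *v u) $ j
        = (g y $ j - g x $ j - (\<Sum>i\<in>UNIV. H x $ i $ j * u $ i)) + (\<Sum>i\<in>UNIV. (H x $ i $ j + S $ i $ j) * u $ i)"
      by (simp add: Su distrib_right sum.distrib)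
    then have "\<bar>(g y - g x + S *v u) $ j\<bar>
        \<le> \<bar>g y $ j - g x $ j - (\<Sum>i\<in>UNIV. H x $ i $ j * u $ i)\<bar> + \<bar>\<Sum>i\<in>UNIV. (H x $ i $ j + S $ i $ j) * u $ i\<bar>"
      by linarith
    moreover have "\<bar>g y $ j - g x $ j - (\<Sum>i\<in>UNIV. H x $ i $ j * u $ i)\<bar> \<le> L * (l1norm u)\<^sup>2"
      using jet_gradient_expansion[OF jet box(1,2), of j] unfolding u_def .
    moreover have "L * (l1norm u)\<^sup>2 \<le> L * ((2 * m * r) * l1norm u)"
      unfolding power2_eq_square by (intro mult_left_mono mult_right_mono l1u L) simp
    moreover have "\<bar>\<Sum>i\<in>UNIV. (H x $ i $ j + S $ i $ j) * u $ i\<bar> \<le> (d + m * r * L) * l1norm u"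
      unfolding l1norm_def sum_distrib_left
      by (rule order_trans[OF sum_abs]) (auto simp: abs_mult intro!: sum_mono mult_right_mono Hx)
    moreover have "(d + 3 * m * r * L) * l1norm u = (d + m * r * L) * l1norm u + L * ((2 * m * r) * l1norm u)"
      by (simp add: algebra_simps)
    ultimately show ?thesis by linarith
  qed
  have "norm (g y - g x + S *v u) \<le> (\<Sum>j\<in>(UNIV :: 'm set). (d + 3 * m * r * L) * l1norm u)"
    by (rule order_trans[OF norm_le_l1_cart]) (intro sum_mono comp)
  also have "\<dots> = m * (d + 3 * m * r * L) * l1norm u" unfolding m_def by simp
  also have "\<dots> \<le> m * (d + 3 * m * r * L) * (m * norm u)"
  proof (intro mult_left_mono mult_nonneg_nonneg)
    show "l1norm u \<le> m * norm u" unfolding m_def by (rule l1norm_le_norm)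
    have "0 \<le> d" using HS[of undefined undefined] by linarith
    then show "0 \<le> d + 3 * m * r * L" using m r L by simp
  qed (rule m)
  finally show ?thesis unfolding u_def m_def by (simp add: power2_eq_square mult_ac)
qed

lemma jet_value_bound:
  fixes S :: "real^'m^'m" and L r d :: real
  assumes jet: "jet (box a b) L f g H" and box: "\<theta> \<in> box a b" "\<theta>0 \<in> box a b"
    and near: "norm (\<theta> - \<theta>0) \<le> r" and HS: "\<And>i j. \<bar>H \<theta>0 $ i $ j + S $ i $ j\<bar> \<le> d"
  shows "f \<theta> - f \<theta>0 \<le> g \<theta>0 \<bullet> (\<theta> - \<theta>0) - (\<theta> - \<theta>0) \<bullet> (S *v (\<theta> - \<theta>0)) / 2
    + (real CARD('m))\<^sup>2 * (d + 3 * real CARD('m) * r * L) * (norm (\<theta> - \<theta>0))\<^sup>2"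
proof -
  define m where "m = real CARD('m)"
  define u where "u = \<theta> - \<theta>0"
  have L: "0 \<le> L" by (rule jet_nonneg[OF jet])
  have m: "0 \<le> m" unfolding m_def by simp
  have d: "0 \<le> d" using HS[of undefined undefined] by linarith
  have r: "0 \<le> r" using near norm_ge_zero order_trans by blast
  have l1u: "l1norm u \<le> m * norm u" unfolding m_def by (rule l1norm_le_norm)
  have "u \<bullet> (H \<theta>0 *v u) + u \<bullet> (S *v u) = (\<Sum>i\<in>UNIV. u $ i * (\<Sum>j\<in>UNIV. (H \<theta>0 $ i $ j + S $ i $ j) * u $ j))"
    by (simp add: inner_vec_def matrix_vector_mult_def sum.distrib[symmetric] distrib_left[symmetric] distrib_right)
  also have "\<dots> \<le> (\<Sum>i\<in>UNIV. \<bar>u $ i\<bar> * (d * l1norm u))"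
  proof (intro sum_mono)
    fix i
    have "\<bar>\<Sum>j\<in>UNIV. (H \<theta>0 $ i $ j + S $ i $ j) * u $ j\<bar> \<le> (\<Sum>j\<in>UNIV. d * \<bar>u $ j\<bar>)"
      by (rule order_trans[OF sum_abs]) (auto simp: abs_mult intro!: sum_mono mult_right_mono HS)
    then have "\<bar>\<Sum>j\<in>UNIV. (H \<theta>0 $ i $ j + S $ i $ j) * u $ j\<bar> \<le> d * l1norm u"
      by (simp add: l1norm_def sum_distrib_left)
    then have "\<bar>u $ i * (\<Sum>j\<in>UNIV. (H \<theta>0 $ i $ j + S $ i $ j) * u $ j)\<bar> \<le> \<bar>u $ i\<bar> * (d * l1norm u)"
      unfolding abs_mult by (intro mult_left_mono) auto
    then show "u $ i * (\<Sum>j\<in>UNIV. (H \<theta>0 $ i $ j + S $ i $ j) * u $ j) \<le> \<bar>u $ i\<bar> * (d * l1norm u)"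
      by linarith
  qed
  also have "\<dots> = d * (l1norm u)\<^sup>2"
    by (simp add: l1norm_def sum_distrib_right[symmetric] power2_eq_square)
  finally have quad: "u \<bullet> (H \<theta>0 *v u) + u \<bullet> (S *v u) \<le> d * (l1norm u)\<^sup>2" .
  have l2: "(l1norm u)\<^sup>2 \<le> m\<^sup>2 * (norm u)\<^sup>2"
    using power_mono[OF l1u, of 2] by (simp add: power_mult_distrib)
  have l3: "L * l1norm u ^ 3 \<le> L * ((m * r) * (m\<^sup>2 * (norm u)\<^sup>2))"
  proof (intro mult_left_mono L)
    have "l1norm u * (l1norm u)\<^sup>2 \<le> (m * r) * (m\<^sup>2 * (norm u)\<^sup>2)"
    proof (intro mult_mono l2)
      show "l1norm u \<le> m * r" using l1u near m unfolding u_def by (meson mult_left_mono order_trans)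
    qed (use m r in auto)
    then show "l1norm u ^ 3 \<le> (m * r) * (m\<^sup>2 * (norm u)\<^sup>2)" by (simp add: power3_eq_cube power2_eq_square mult_ac)
  qed
  have "f \<theta> - f \<theta>0 \<le> g \<theta>0 \<bullet> u + u \<bullet> (H \<theta>0 *v u) / 2 + L * l1norm u ^ 3"
    using jet_taylor[OF jet box(2,1)] unfolding u_def by linarith
  moreover have "d * (l1norm u)\<^sup>2 \<le> d * (m\<^sup>2 * (norm u)\<^sup>2)" by (intro mult_left_mono l2 d)
  moreover have "0 \<le> d * (m\<^sup>2 * (norm u)\<^sup>2)" using d by simp
  moreover have "0 \<le> L * ((m * r) * (m\<^sup>2 * (norm u)\<^sup>2))" using L m r by simp
  ultimately have "f \<theta> - f \<theta>0 \<le> g \<theta>0 \<bullet> u - u \<bullet> (S *v u) / 2 + (d * (m\<^sup>2 * (norm u)\<^sup>2) + 3 * (L * ((m * r) * (m\<^sup>2 * (norm u)\<^sup>2))))"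
    using quad l3 by linarith
  also have "d * (m\<^sup>2 * (norm u)\<^sup>2) + 3 * (L * ((m * r) * (m\<^sup>2 * (norm u)\<^sup>2))) = m\<^sup>2 * (d + 3 * m * r * L) * (norm u)\<^sup>2"
    by (simp add: algebra_simps)
  finally show ?thesis unfolding u_def m_def .
qed

text \<open>The function \<open>f\<close> with gradient \<open>g\<close> is, in the ball of radius \<open>r\<close>, a quadratic function with Hessian
\<open>- S\<close> up to the relative error \<open>e\<close>. The second condition is one-sided since values only have to be bounded
from above.\<close>

definition quadratic_regime ::
  "real^'m^'m \<Rightarrow> real^'m \<Rightarrow> real \<Rightarrow> real \<Rightarrow> (real^'m \<Rightarrow> real) \<Rightarrow> (real^'m \<Rightarrow> real^'m) \<Rightarrow> bool" where
  "quadratic_regime S \<theta>0 r e f g \<longleftrightarrow>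
     (\<forall>x\<in>cball \<theta>0 r. \<forall>y\<in>cball \<theta>0 r. norm (g y - g x + S *v (y - x)) \<le> e * norm (y - x)) \<and>
     (\<forall>\<theta>\<in>cball \<theta>0 r. f \<theta> - f \<theta>0 \<le> g \<theta>0 \<bullet> (\<theta> - \<theta>0) - (\<theta> - \<theta>0) \<bullet> (S *v (\<theta> - \<theta>0)) / 2
        + e * (norm (\<theta> - \<theta>0))\<^sup>2)"

lemma eventually_quadratic_regime:
  fixes S :: "real^'m^'m" and L r :: "nat \<Rightarrow> real" 
  assumes jet: "\<And>n. jet (box a b) (L n) (F n) (g n) (H n)" and \<theta>0: "\<theta>0 \<in> box a b"
    and L: "L \<longlonglongrightarrow> l" and H: "\<And>i j. (\<lambda>n. H n \<theta>0 $ i $ j) \<longlonglongrightarrow> - S $ i $ j"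
    and r: "r \<longlonglongrightarrow> 0" and sym: "transpose S = S" and e: "0 < e"
  shows "\<forall>\<^sub>F n in sequentially. cball \<theta>0 (r n) \<subseteq> box a b \<and> quadratic_regime S \<theta>0 (r n) e (F n) (g n)"
proof -
  define d where "d n = (\<Sum>i\<in>UNIV. \<Sum>j\<in>UNIV. \<bar>H n \<theta>0 $ i $ j + S $ i $ j\<bar>)" for n
  have dn: "\<bar>H n \<theta>0 $ i $ j + S $ i $ j\<bar> \<le> d n" for n i j
  proof -
    have "\<bar>H n \<theta>0 $ i $ j + S $ i $ j\<bar> \<le> (\<Sum>j\<in>UNIV. \<bar>H n \<theta>0 $ i $ j + S $ i $ j\<bar>)"
      by (intro member_le_sum) auto
    also have "\<dots> \<le> d n" unfolding d_def
      by (intro member_le_sum[of i UNIV "\<lambda>i. \<Sum>j\<in>UNIV. \<bar>H n \<theta>0 $ i $ j + S $ i $ j\<bar>"]) (auto intro: sum_nonneg)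
    finally show ?thesis .
  qed
  have "d \<longlonglongrightarrow> (\<Sum>i\<in>(UNIV::'m set). \<Sum>j\<in>(UNIV::'m set). \<bar>- S $ i $ j + S $ i $ j\<bar>)"
    unfolding d_def by (intro tendsto_sum tendsto_rabs tendsto_add H tendsto_const)
  then have d0: "d \<longlonglongrightarrow> 0" by simp
  have "(\<lambda>n. (real CARD('m))\<^sup>2 * (d n + 3 * real CARD('m) * r n * L n)) \<longlonglongrightarrow> (real CARD('m))\<^sup>2 * (0 + 3 * real CARD('m) * 0 * l)"
    by (intro tendsto_intros d0 r L)
  then have "\<forall>\<^sub>F n in sequentially. (real CARD('m))\<^sup>2 * (d n + 3 * real CARD('m) * r n * L n) < e"
    using e by (intro order_tendstoD(2)) auto
  moreover obtain \<rho> where \<rho>: "0 < \<rho>" "cball \<theta>0 \<rho> \<subseteq> box a b"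
    using \<theta>0 open_box open_contains_cball by blast
  then have "\<forall>\<^sub>F n in sequentially. r n < \<rho>" using r by (intro order_tendstoD(2))
  ultimately show ?thesis
  proof eventually_elim
    case (elim n)
    have sub: "cball \<theta>0 (r n) \<subseteq> box a b" using elim(2) \<rho>(2) subset_cball[of "r n" \<rho> \<theta>0] by auto
    moreover have "quadratic_regime S \<theta>0 (r n) e (F n) (g n)"
      unfolding quadratic_regime_def
    proof (intro conjI ballI)
      fix x y assume xy: "x \<in> cball \<theta>0 (r n)" "y \<in> cball \<theta>0 (r n)"
      have "norm (g n y - g n x + S *v (y - x)) \<le> (real CARD('m))\<^sup>2 * (d n + 3 * real CARD('m) * r n * L n) * norm (y - x)"
        using xy sub by (intro jet_gradient_two_point[OF jet _ _ \<theta>0 _ _ dn sym])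
          (auto simp: dist_norm norm_minus_commute)
      also have "\<dots> \<le> e * norm (y - x)" using elim(1) by (intro mult_right_mono) auto
      finally show "norm (g n y - g n x + S *v (y - x)) \<le> e * norm (y - x)" .
    next
      fix \<theta> assume \<theta>: "\<theta> \<in> cball \<theta>0 (r n)"
      have "F n \<theta> - F n \<theta>0 \<le> g n \<theta>0 \<bullet> (\<theta> - \<theta>0) - (\<theta> - \<theta>0) \<bullet> (S *v (\<theta> - \<theta>0)) / 2
          + (real CARD('m))\<^sup>2 * (d n + 3 * real CARD('m) * r n * L n) * (norm (\<theta> - \<theta>0))\<^sup>2"
        using \<theta> sub by (intro jet_value_bound[OF jet _ \<theta>0 _ dn]) (auto simp: dist_norm norm_minus_commute)
      also have "\<dots> \<le> g n \<theta>0 \<bullet> (\<theta> - \<theta>0) - (\<theta> - \<theta>0) \<bullet> (S *v (\<theta> - \<theta>0)) / 2 + e * (norm (\<theta> - \<theta>0))\<^sup>2"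
        using elim(1) by (intro add_left_mono mult_right_mono) auto
      finally show "F n \<theta> - F n \<theta>0 \<le> g n \<theta>0 \<bullet> (\<theta> - \<theta>0) - (\<theta> - \<theta>0) \<bullet> (S *v (\<theta> - \<theta>0)) / 2
          + e * (norm (\<theta> - \<theta>0))\<^sup>2" .
    qed
    ultimately show ?case by blast
  qed
qed

lemma jet_gradient_zero_at_local_max:
  assumes jet: "jet U L f g H" and \<theta>: "\<theta> \<in> U" and max: "\<forall>\<^sub>F \<theta>' in nhds \<theta>. f \<theta>' \<le> f \<theta>"
  shows "g \<theta> = 0"
proof -
  obtain d where d: "0 < d" "\<And>y. dist y \<theta> < d \<Longrightarrow> f y \<le> f \<theta>"
    using max unfolding eventually_nhds_metric by blast
  have "g \<theta> $ j = 0" for j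
  proof (rule DERIV_local_max[OF jet_has_partial[OF jet \<theta>] d(1)])
    show "\<forall>y. \<bar>0 - y\<bar> < d \<longrightarrow> f (\<theta> + y *\<^sub>R axis j 1) \<le> f (\<theta> + 0 *\<^sub>R axis j 1)"
      using d(2) by (simp add: dist_norm)
  qed
  then show ?thesis by (simp add: vec_eq_iff)
qed

lemma quadratic_regime_value_bound:
  assumes q: "quadratic_regime S \<theta>0 r (\<kappa> / 4) f g" and coer: "\<And>u. \<kappa> * (norm u)\<^sup>2 \<le> u \<bullet> (S *v u)"
    and \<theta>: "\<theta> \<in> cball \<theta>0 r"
  shows "f \<theta> - f \<theta>0 \<le> norm (g \<theta>0) * norm (\<theta> - \<theta>0) - \<kappa> / 4 * (norm (\<theta> - \<theta>0))\<^sup>2"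
proof -
  have "g \<theta>0 \<bullet> (\<theta> - \<theta>0) \<le> norm (g \<theta>0) * norm (\<theta> - \<theta>0)" by (rule norm_cauchy_schwarz)
  then show ?thesis using q \<theta> coer[of "\<theta> - \<theta>0"] unfolding quadratic_regime_def by fastforce
qed

lemma quadratic_regime_unique_critical_point:
  assumes q: "quadratic_regime S \<theta>0 r e f g" and coer: "\<And>u. \<kappa> * (norm u)\<^sup>2 \<le> u \<bullet> (S *v u)"
    and e: "e < \<kappa>" and xy: "x \<in> cball \<theta>0 r" "y \<in> cball \<theta>0 r" "g x = 0" "g y = 0"
  shows "x = y"
proof (rule ccontr)
  assume ne: "x \<noteq> y"
  have "\<kappa> * (norm (y - x))\<^sup>2 \<le> norm (y - x) * norm (S *v (y - x))"
    using coer[of "y - x"] norm_cauchy_schwarz[of "y - x" "S *v (y - x)"] by linarith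
  also have "norm (S *v (y - x)) \<le> e * norm (y - x)"
    using q xy unfolding quadratic_regime_def by (metis add_0 diff_zero)
  then have "norm (y - x) * norm (S *v (y - x)) \<le> norm (y - x) * (e * norm (y - x))"
    by (intro mult_left_mono) auto
  finally have "(\<kappa> - e) * (norm (y - x))\<^sup>2 \<le> 0" by (simp add: power2_eq_square algebra_simps)
  then show False using e ne by (simp add: mult_le_0_iff)
qed

text \<open>Coercivity bounds the distance of a critical point from \<open>\<theta>0\<close> by \<open>2 / \<kappa>\<close> times the norm of the
gradient at \<open>\<theta>0\<close>, so an error relative to this distance is an error relative to the gradient.\<close>

lemma quadratic_regime_critical_point_linearisation:
  assumes q: "quadratic_regime S \<theta>0 r e f g" and coer: "\<And>u. \<kappa> * (norm u)\<^sup>2 \<le> u \<bullet> (S *v u)"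
    and e: "0 \<le> e" "e \<le> \<kappa> / 2" and \<kappa>: "0 < \<kappa>" and \<theta>: "\<theta> \<in> cball \<theta>0 r" "g \<theta> = 0" and r: "0 \<le> r"
  shows "norm (S *v (\<theta> - \<theta>0) - g \<theta>0) \<le> 2 * e / \<kappa> * norm (g \<theta>0)"
proof -
  define u where "u = \<theta> - \<theta>0"
  have lin: "norm (S *v u - g \<theta>0) \<le> e * norm u"
  proof -
    have "\<theta>0 \<in> cball \<theta>0 r" using r by simp
    then have "norm (g \<theta> - g \<theta>0 + S *v u) \<le> e * norm u"
      using q \<theta>(1) unfolding quadratic_regime_def u_def by blast
    then show ?thesis using \<theta>(2) by (simp add: algebra_simps)
  qed
  have "\<kappa> * (norm u)\<^sup>2 \<le> norm u * norm (S *v u)"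
    using coer[of u] norm_cauchy_schwarz[of u "S *v u"] by linarith
  also have "\<dots> \<le> norm u * (norm (g \<theta>0) + e * norm u)"
    using lin norm_triangle_sub[of "S *v u" "g \<theta>0"] by (intro mult_left_mono) auto
  also have "\<dots> \<le> norm u * (norm (g \<theta>0) + \<kappa> / 2 * norm u)"
    using e by (intro mult_left_mono add_left_mono mult_right_mono) auto
  finally have "norm u * (\<kappa> / 2 * norm u) \<le> norm u * norm (g \<theta>0)"
    by (simp add: power2_eq_square algebra_simps)
  then have "\<kappa> / 2 * norm u \<le> norm (g \<theta>0)" by (cases "u = 0") auto
  then have "norm u \<le> 2 / \<kappa> * norm (g \<theta>0)" using \<kappa> by (simp add: field_simps)
  then have "e * norm u \<le> e * (2 / \<kappa> * norm (g \<theta>0))" using e by (intro mult_left_mono) auto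
  then show ?thesis using lin unfolding u_def by (simp add: mult_ac)
qed

text \<open>On the sphere of radius \<open>r\<close> the linear term is at most \<open>r |g(\<theta>0)|\<close>, and the quadratic term takes off
\<open>\<kappa> r\<^sup>2 / 4\<close>. The maximizers over the closed ball thus lie inside, where they are critical points, and
there is only one critical point.\<close>

lemma quadratic_regime_interior_max:
  fixes S :: "real^'m^'m"
  assumes jet: "jet (box a b) L f g H" and sub: "cball \<theta>0 r \<subseteq> box a b"
    and q: "quadratic_regime S \<theta>0 r (\<kappa> / 4) f g" and coer: "\<And>u. \<kappa> * (norm u)\<^sup>2 \<le> u \<bullet> (S *v u)"
    and \<kappa>: "0 < \<kappa>" and r: "0 < r" and small: "norm (g \<theta>0) < \<kappa> / 4 * r"
  obtains \<theta> where "\<theta> \<in> ball \<theta>0 r" "\<And>y. y \<in> cball \<theta>0 r \<Longrightarrow> f y \<le> f \<theta>"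
    "\<And>y. y \<in> cball \<theta>0 r \<Longrightarrow> f y = f \<theta> \<Longrightarrow> y = \<theta>"
proof -
  have cont: "continuous_on (cball \<theta>0 r) f" by (rule continuous_on_subset[OF continuous_on_jet[OF jet] sub])
  have ne: "cball \<theta>0 r \<noteq> {}" using r by simp
  obtain \<theta> where \<theta>: "\<theta> \<in> cball \<theta>0 r" "\<And>y. y \<in> cball \<theta>0 r \<Longrightarrow> f y \<le> f \<theta>"
    using continuous_attains_sup[OF compact_cball ne cont] by auto
  have crit: "y \<in> ball \<theta>0 r \<and> g y = 0" if y: "y \<in> cball \<theta>0 r" "f y = f \<theta>" for y
  proof -
    have "\<theta>0 \<in> cball \<theta>0 r" using r by simp
    then have "f \<theta>0 \<le> f y" using \<theta>(2) y(2) by simp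
    moreover have "f y - f \<theta>0 \<le> norm (g \<theta>0) * norm (y - \<theta>0) - \<kappa> / 4 * (norm (y - \<theta>0))\<^sup>2"
      by (rule quadratic_regime_value_bound[OF q coer y(1)])
    moreover have "norm (g \<theta>0) * r - \<kappa> / 4 * r\<^sup>2 < 0"
    proof -
      have "norm (g \<theta>0) * r < (\<kappa> / 4 * r) * r" using small r by (intro mult_strict_right_mono)
      then show ?thesis by (simp add: power2_eq_square)
    qed
    ultimately have "norm (y - \<theta>0) \<noteq> r" by auto
    then have yb: "y \<in> ball \<theta>0 r" using y(1) by (auto simp: dist_norm norm_minus_commute)
    have "\<forall>\<^sub>F z in nhds y. z \<in> ball \<theta>0 r" using yb by (intro eventually_nhds_in_open) auto
    then have "\<forall>\<^sub>F z in nhds y. f z \<le> f y" by eventually_elim (use \<theta>(2) y(2) in auto)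
    then have "g y = 0" using y(1) sub by (intro jet_gradient_zero_at_local_max[OF jet]) auto
    with yb show ?thesis ..
  qed
  show ?thesis
  proof (rule that[OF _ \<theta>(2)])
    show "\<theta> \<in> ball \<theta>0 r" using crit[OF \<theta>(1)] by simp
    show "y = \<theta>" if "y \<in> cball \<theta>0 r" "f y = f \<theta>" for y
      using quadratic_regime_unique_critical_point[OF q coer, of y \<theta>] crit[OF that] crit[OF \<theta>(1)] that(1) \<theta>(1) \<kappa>
      by simp
  qed
qed

section \<open>Measurable selection of a maximizer\<close>

text \<open>The best among the first points of a sequence, the earliest one in case of a tie. It takes finitely
many values for each index, so its measurability in a parameter is elementary, and no supremum over an
uncountable set has to be measurable.\<close>

primrec running_argmax :: "('b \<Rightarrow> real) \<Rightarrow> (nat \<Rightarrow> 'b) \<Rightarrow> nat \<Rightarrow> 'b" where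
  "running_argmax f q 0 = q 0"
| "running_argmax f q (Suc k) =
    (if f (running_argmax f q k) < f (q (Suc k)) then q (Suc k) else running_argmax f q k)"

lemma running_argmax_range: "running_argmax f q k \<in> range q"
  by (induction k) auto

lemma running_argmax_ge: "i \<le> k \<Longrightarrow> f (q i) \<le> f (running_argmax f q k)"
proof (induction k)
  case (Suc k)
  then show ?case by (cases "i = Suc k") (auto dest: order_trans)
qed simp

lemma measurable_running_argmax:
  fixes q :: "nat \<Rightarrow> 'b::euclidean_space"
  assumes [measurable]: "\<And>k. (\<lambda>\<omega>. f \<omega> (q k)) \<in> borel_measurable W"
  shows "(\<lambda>\<omega>. running_argmax (f \<omega>) q k) \<in> borel_measurable W"
proof -
  have "(\<lambda>\<omega>. running_argmax (f \<omega>) q k) \<in> borel_measurable W \<and>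
      (\<lambda>\<omega>. f \<omega> (running_argmax (f \<omega>) q k)) \<in> borel_measurable W"
  proof (induction k)
    case (Suc k)
    then have [measurable]: "(\<lambda>\<omega>. running_argmax (f \<omega>) q k) \<in> borel_measurable W"
      "(\<lambda>\<omega>. f \<omega> (running_argmax (f \<omega>) q k)) \<in> borel_measurable W" by auto
    have eq: "f \<omega> (running_argmax (f \<omega>) q (Suc k)) =
        (if f \<omega> (running_argmax (f \<omega>) q k) < f \<omega> (q (Suc k)) then f \<omega> (q (Suc k))
         else f \<omega> (running_argmax (f \<omega>) q k))" for \<omega> by simp
    show ?case unfolding eq unfolding running_argmax.simps by measurable
  qed simp
  then show ?thesis ..
qed

text \<open>Outside a neighbourhood of the unique maximizer \<open>f\<close> stays below its maximum by compactness, while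
the dense sequence eventually produces larger values.\<close>

lemma running_argmax_tendsto:
  fixes q :: "nat \<Rightarrow> 'b::euclidean_space"
  assumes K: "compact K" "continuous_on K f" and q: "range q \<subseteq> K" "K \<subseteq> closure (range q)"
    and x: "x \<in> K" "\<And>y. y \<in> K \<Longrightarrow> f y \<le> f x" "\<And>y. y \<in> K \<Longrightarrow> f y = f x \<Longrightarrow> y = x"
  shows "running_argmax f q \<longlonglongrightarrow> x"
proof (rule tendstoI)
  fix e :: real assume e: "0 < e"
  define K' where "K' = K - ball x e"
  have inK: "running_argmax f q k \<in> K" for k using running_argmax_range[of f q k] q(1) by blast
  show "\<forall>\<^sub>F k in sequentially. dist (running_argmax f q k) x < e"
  proof (cases "K' = {}")
    case True
    have "running_argmax f q k \<in> ball x e" for k using inK[of k] True unfolding K'_def by blast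
    then show ?thesis by (simp add: dist_commute)
  next
    case False
    have "compact K'" unfolding K'_def using K(1) by (intro compact_diff) auto
    moreover have "continuous_on K' f" by (rule continuous_on_subset[OF K(2)]) (auto simp: K'_def)
    ultimately obtain z where z: "z \<in> K'" "\<And>y. y \<in> K' \<Longrightarrow> f y \<le> f z"
      using continuous_attains_sup[OF _ False] by blast
    have "z \<in> K" "z \<noteq> x" using z(1) e unfolding K'_def by auto
    then have "f z < f x" using x(2,3) by (metis less_le)
    then obtain d where d: "0 < d" "\<And>y. y \<in> K \<Longrightarrow> dist y x < d \<Longrightarrow> dist (f y) (f x) < f x - f z"
      using K(2) x(1) unfolding continuous_on_iff by (metis diff_gt_0_iff_gt)
    have "x \<in> closure (range q)" using x(1) q(2) by blast
    then obtain i where i: "dist (q i) x < d" using d(1) unfolding closure_approachable by blast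
    have "q i \<in> K" using q(1) by blast
    then have fi: "f z < f (q i)" using d(2)[OF _ i] by (simp add: dist_real_def abs_less_iff)
    have "dist (running_argmax f q k) x < e" if "i \<le> k" for k
    proof -
      have "f z < f (running_argmax f q k)" using running_argmax_ge[OF that, of f q] fi by linarith
      then have "running_argmax f q k \<notin> K'" using z(2) by fastforce
      then show ?thesis using inK[of k] unfolding K'_def by (simp add: dist_commute)
    qed
    then show ?thesis unfolding eventually_sequentially by blast
  qed
qed

lemma dense_sequence:
  fixes K :: "'b::euclidean_space set"
  assumes "K \<noteq> {}"
  obtains q :: "nat \<Rightarrow> 'b" where "range q \<subseteq> K" "K \<subseteq> closure (range q)"
proof -
  obtain T where T: "countable T" "T \<subseteq> K" "K \<subseteq> closure T" using separable[of K] by blast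
  then have "T \<noteq> {}" using assms by auto
  then have "range (from_nat_into T) = T" using T(1) by (rule range_from_nat_into)
  then show ?thesis using T that[of "from_nat_into T"] by simp
qed

section \<open>The strong law of large numbers\<close>

text \<open>The maximum of the first partial sums and 0, written as a recursion in which the first term is
split off: this is the form in which the sequence without its first term appears.\<close>

primrec max_partial_sum :: "nat \<Rightarrow> (nat \<Rightarrow> real) \<Rightarrow> real" where
  "max_partial_sum 0 y = 0"
| "max_partial_sum (Suc n) y = max 0 (y 0 + max_partial_sum n (\<lambda>i. y (Suc i)))"

lemma max_partial_sum_nonneg: "0 \<le> max_partial_sum n y"
  by (cases n) auto

lemma max_partial_sum_mono: "max_partial_sum n y \<le> max_partial_sum (Suc n) y"
proof (induction n arbitrary: y)
  case (Suc n)
  have "max_partial_sum n (\<lambda>i. y (Suc i)) \<le> max_partial_sum (Suc n) (\<lambda>i. y (Suc i))"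
    by (rule Suc.IH)
  then show ?case
    unfolding max_partial_sum.simps(2)[of "Suc n" y] max_partial_sum.simps(2)[of n y] by linarith
qed simp

lemma sum_le_max_partial_sum: "k \<le> n \<Longrightarrow> (\<Sum>i<k. y i) \<le> max_partial_sum n y"
proof (induction n arbitrary: y k)
  case (Suc n)
  show ?case
  proof (cases k)
    case (Suc k')
    then have "(\<Sum>i<k'. y (Suc i)) \<le> max_partial_sum n (\<lambda>i. y (Suc i))"
      using Suc.prems by (intro Suc.IH) simp
    then show ?thesis unfolding Suc sum.lessThan_Suc_shift by simp
  qed simp
qed simp

lemma max_partial_sum_measurable [measurable]:
  "(\<And>i. Z i \<in> borel_measurable N) \<Longrightarrow> (\<lambda>x. max_partial_sum n (\<lambda>i. Z i x)) \<in> borel_measurable N"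
proof (induction n arbitrary: Z)
  case (Suc n)
  note [measurable] = Suc.prems Suc.IH[of "\<lambda>i. Z (Suc i)", OF Suc.prems]
  show ?case by simp
qed simp

lemma max_partial_sum_integrable:
  fixes Z :: "nat \<Rightarrow> 'a \<Rightarrow> real"
  shows "(\<And>i. integrable N (Z i)) \<Longrightarrow> integrable N (\<lambda>x. max_partial_sum n (\<lambda>i. Z i x))"
proof (induction n arbitrary: Z)
  case (Suc n)
  show ?case using Suc.prems Suc.IH[of "\<lambda>i. Z (Suc i)"] by simp
qed simp

text \<open>Natural bounds keep the quantifier countable, hence the event measurable.\<close>

definition partial_sums_unbounded :: "(nat \<Rightarrow> real) \<Rightarrow> bool" where
  "partial_sums_unbounded y \<longleftrightarrow> (\<forall>K::nat. \<exists>n. real K < (\<Sum>i<n. y i))"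

lemma partial_sums_unbounded_shift:
  "partial_sums_unbounded (\<lambda>i. y (i + m)) \<longleftrightarrow> partial_sums_unbounded y"
proof (induction m)
  case (Suc m)
  have shift1: "partial_sums_unbounded (\<lambda>i. z (Suc i)) \<longleftrightarrow> partial_sums_unbounded z" for z
  proof
    assume A: "partial_sums_unbounded (\<lambda>i. z (Suc i))"
    show "partial_sums_unbounded z"
      unfolding partial_sums_unbounded_def
    proof
      fix K :: nat
      obtain K' :: nat where "real K - z 0 < K'" using reals_Archimedean2 by blast
      moreover obtain n where "real K' < (\<Sum>i<n. z (Suc i))"
        using A unfolding partial_sums_unbounded_def by blast
      ultimately have "real K < (\<Sum>i<Suc n. z i)" unfolding sum.lessThan_Suc_shift by simp
      then show "\<exists>n. real K < (\<Sum>i<n. z i)" by blast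
    qed
  next
    assume A: "partial_sums_unbounded z"
    show "partial_sums_unbounded (\<lambda>i. z (Suc i))"
      unfolding partial_sums_unbounded_def
    proof
      fix K :: nat
      obtain K' :: nat where K': "real K + \<bar>z 0\<bar> < K'" using reals_Archimedean2 by blast
      obtain n where n: "real K' < (\<Sum>i<n. z i)"
        using A unfolding partial_sums_unbounded_def by blast
      then obtain n' where "n = Suc n'" using K' by (cases n) auto
      then have "real K < (\<Sum>i<n'. z (Suc i))" using n K' unfolding \<open>n = Suc n'\<close> sum.lessThan_Suc_shift by linarith
      then show "\<exists>n. real K < (\<Sum>i<n. z (Suc i))" by blast
    qed
  qed
  show ?case using shift1[of "\<lambda>i. y (i + m)"] Suc by simp
qed simp

lemma filterlim_max_partial_sum:
  assumes "partial_sums_unbounded y"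
  shows "filterlim (\<lambda>n. max_partial_sum n y) at_top sequentially"
  unfolding filterlim_at_top
proof
  fix Z :: real
  obtain K :: nat where "Z < K" using reals_Archimedean2 by blast
  moreover obtain n where "real K < (\<Sum>i<n. y i)"
    using assms unfolding partial_sums_unbounded_def by blast
  moreover have "(\<Sum>i<n. y i) \<le> max_partial_sum m y" if "n \<le> m" for m
    using that by (rule sum_le_max_partial_sum)
  ultimately show "\<forall>\<^sub>F n in sequentially. Z \<le> max_partial_sum n y"
    unfolding eventually_sequentially by (intro exI[of _ n]) force
qed

context prob_space
begin

text \<open>Both sequences have the law of the infinite product, which is invariant under the shift.\<close>

lemma expectation_shift_iid:
  fixes Y :: "nat \<Rightarrow> 'a \<Rightarrow> real" and F :: "(nat \<Rightarrow> real) \<Rightarrow> real"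
  assumes indep: "indep_vars (\<lambda>_. borel) Y UNIV"
    and same: "\<And>i. distr M borel (Y i) = distr M borel (Y 0)"
    and F: "F \<in> borel_measurable (PiM UNIV (\<lambda>_. borel))"
  shows "expectation (\<lambda>\<omega>. F (\<lambda>i. Y (Suc i) \<omega>)) = expectation (\<lambda>\<omega>. F (\<lambda>i. Y i \<omega>))"
proof -
  have Y [measurable]: "Y i \<in> borel_measurable M" for i
    using indep unfolding indep_vars_def by auto
  note F [measurable]
  have YM [measurable]: "(\<lambda>\<omega> i. Y i \<omega>) \<in> measurable M (PiM UNIV (\<lambda>_. borel))"
    by (rule measurable_abs_UNIV) simp
  have SM [measurable]: "(\<lambda>y n. y (Suc n)) \<in> measurable (PiM UNIV (\<lambda>_. borel)) (PiM UNIV (\<lambda>_. borel :: real measure))"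
    by (rule measurable_abs_UNIV) simp
  define D where "D = distr M borel (Y 0)"
  have same': "distr M borel (Y i) = D" for i unfolding D_def by (rule same)
  have law: "distr M (PiM UNIV (\<lambda>_. borel)) (\<lambda>\<omega> i. Y i \<omega>) = PiM UNIV (\<lambda>_. D)"
    using indep_vars_iff_distr_eq_PiM[where I = UNIV and M' = "\<lambda>_. borel" and X = Y] indep
    by (simp add: same' restrict_UNIV)
  have D: "prob_space D" unfolding D_def by (rule prob_space_distr) simp
  have sets_D: "sets (PiM UNIV (\<lambda>_::nat. D)) = sets (PiM UNIV (\<lambda>_. borel))"
    by (intro sets_PiM_cong) (auto simp: D_def)
  have "distr (PiM UNIV (\<lambda>_. D)) (PiM UNIV (\<lambda>_. D)) (\<lambda>y. \<lambda>n\<in>UNIV. y (Suc n)) = PiM UNIV (\<lambda>_. D)"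
    using D by (intro distr_PiM_reindex) auto
  then have shift: "distr (PiM UNIV (\<lambda>_. D)) (PiM UNIV (\<lambda>_. D)) (\<lambda>y n. y (Suc n)) = PiM UNIV (\<lambda>_. D)"
    by (simp only: restrict_UNIV)
  have "expectation (\<lambda>\<omega>. F (\<lambda>i. Y i \<omega>))
      = (\<integral>y. F y \<partial>distr M (PiM UNIV (\<lambda>_. borel)) (\<lambda>\<omega> i. Y i \<omega>))"
    by (subst integral_distr) auto
  also have "\<dots> = (\<integral>y. F y \<partial>distr (PiM UNIV (\<lambda>_. D)) (PiM UNIV (\<lambda>_. D)) (\<lambda>y n. y (Suc n)))"
    by (simp only: law shift)
  also have "\<dots> = (\<integral>y. F (\<lambda>n. y (Suc n)) \<partial>PiM UNIV (\<lambda>_. D))"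
  proof (rule integral_distr)
    show "(\<lambda>y n. y (Suc n)) \<in> measurable (PiM UNIV (\<lambda>_. D)) (PiM UNIV (\<lambda>_. D))"
      unfolding measurable_cong_sets[OF sets_D sets_D] by (rule SM)
    show "F \<in> borel_measurable (PiM UNIV (\<lambda>_. D))"
      unfolding measurable_cong_sets[OF sets_D refl] by (rule F)
  qed
  also have "\<dots> = expectation (\<lambda>\<omega>. F (\<lambda>i. Y (Suc i) \<omega>))"
    unfolding law[symmetric] by (subst integral_distr) auto
  finally show ?thesis ..
qed

text \<open>Changing finitely many terms does not affect whether the partial sums are bounded above, so this is a
tail event and Kolmogorov's zero-one law applies.\<close>

lemma iid_unbounded_0_1:
  fixes Y :: "nat \<Rightarrow> 'a \<Rightarrow> real"
  assumes indep: "indep_vars (\<lambda>_. borel) Y UNIV"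
  defines "A \<equiv> {\<omega> \<in> space M. partial_sums_unbounded (\<lambda>i. Y i \<omega>)}"
  shows "A \<in> events" and "prob A = 0 \<or> prob A = 1"
proof -
  have Y [measurable]: "Y i \<in> borel_measurable M" for i
    using indep unfolding indep_vars_def by auto
  show "A \<in> events" unfolding A_def partial_sums_unbounded_def by measurable
  define F where "F i = sigma_sets (space M) {Y i -` B \<inter> space M | B. B \<in> sets borel}" for i
  have F_sub: "F i \<subseteq> Pow (space M)" for i
    unfolding F_def by (auto dest!: sigma_sets_into_sp[rotated])
  show "prob A = 0 \<or> prob A = 1"
  proof (rule kolmogorov_0_1_law[of F])
    show "sigma_algebra (space M) (F i)" for i
      unfolding F_def by (rule sigma_algebra_sigma_sets) auto
    show "indep_sets F UNIV" using indep unfolding indep_vars_def F_def by simp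
    have "A \<in> sigma_sets (space M) (\<Union> (F ` {m..}))" for m
    proof -
      define N where "N = sigma (space M) (\<Union> (F ` {m..}))"
      have space_N: "space N = space M" using F_sub unfolding N_def by (intro space_measure_of) auto
      have sets_N: "sets N = sigma_sets (space M) (\<Union> (F ` {m..}))"
        using F_sub unfolding N_def by (intro sets_measure_of) auto
      have [measurable]: "Y (i + m) \<in> borel_measurable N" for i
      proof (rule measurableI)
        fix B :: "real set" assume "B \<in> sets borel"
        then have "Y (i + m) -` B \<inter> space M \<in> F (i + m)" unfolding F_def by blast
        then show "Y (i + m) -` B \<inter> space N \<in> sets N"
          unfolding sets_N space_N by (intro sigma_sets.Basic) auto
      qed simp
      have "{\<omega> \<in> space N. partial_sums_unbounded (\<lambda>i. Y (i + m) \<omega>)} \<in> sets N"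
        unfolding partial_sums_unbounded_def by measurable
      then show ?thesis unfolding space_N sets_N A_def
        using partial_sums_unbounded_shift[of "\<lambda>i. Y i _" m] by simp
    qed
    then show "A \<in> tail_events F" unfolding tail_events_def by blast
  qed
qed

text \<open>Write \<open>M\<^sub>n\<close> for the maximal partial sum and \<open>M\<^sub>n'\<close> for that of the shifted sequence. Then
\<open>M\<^bsub>n+1\<^esub> - M\<^sub>n' = max (- M\<^sub>n') Y\<^sub>0\<close>, and the expectation of the left side is that of
\<open>M\<^bsub>n+1\<^esub> - M\<^sub>n\<close>, hence not negative. If the partial sums were unbounded almost surely, the right side
would tend to \<open>Y\<^sub>0\<close> and the mean of \<open>Y\<^sub>0\<close> could not be negative.\<close>

lemma iid_negative_mean_partial_sums_bounded:
  fixes Y :: "nat \<Rightarrow> 'a \<Rightarrow> real"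
  assumes indep: "indep_vars (\<lambda>_. borel) Y UNIV"
    and same: "\<And>i. distr M borel (Y i) = distr M borel (Y 0)"
    and int: "integrable M (Y 0)" and neg: "expectation (Y 0) < 0"
  shows "AE \<omega> in M. \<not> partial_sums_unbounded (\<lambda>i. Y i \<omega>)"
proof -
  have Y [measurable]: "Y i \<in> borel_measurable M" for i
    using indep unfolding indep_vars_def by auto
  have intY: "integrable M (Y i)" for i
  proof -
    have "integrable (distr M borel (Y 0)) (\<lambda>x. x)" using int by (simp add: integrable_distr_eq)
    then have "integrable (distr M borel (Y i)) (\<lambda>x. x)" by (simp only: same[of i])
    then show ?thesis by (simp add: integrable_distr_eq)
  qed
  define A where "A = {\<omega> \<in> space M. partial_sums_unbounded (\<lambda>i. Y i \<omega>)}"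
  have "prob A \<noteq> 1"
  proof
    assume "prob A = 1"
    then have AE: "AE \<omega> in M. partial_sums_unbounded (\<lambda>i. Y i \<omega>)"
      using iid_unbounded_0_1(1)[OF indep] AE_prob_1[of A] unfolding A_def by (auto elim!: eventually_mono)
    define D where "D n \<omega> = max (- max_partial_sum n (\<lambda>i. Y (Suc i) \<omega>)) (Y 0 \<omega>)" for n \<omega>
    have D_eq: "D n \<omega> = max_partial_sum (Suc n) (\<lambda>i. Y i \<omega>) - max_partial_sum n (\<lambda>i. Y (Suc i) \<omega>)" for n \<omega>
      by (simp add: D_def)
    have "(\<lambda>n. expectation (D n)) \<longlonglongrightarrow> expectation (Y 0)"
    proof (rule integral_dominated_convergence[where w = "\<lambda>\<omega>. \<bar>Y 0 \<omega>\<bar>"])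
      show "AE \<omega> in M. (\<lambda>n. D n \<omega>) \<longlonglongrightarrow> Y 0 \<omega>"
        using AE
      proof eventually_elim
        case (elim \<omega>)
        then have "partial_sums_unbounded (\<lambda>i. Y (Suc i) \<omega>)"
          using partial_sums_unbounded_shift[of "\<lambda>i. Y i \<omega>" 1] by simp
        then have "\<forall>\<^sub>F n in sequentially. - Y 0 \<omega> \<le> max_partial_sum n (\<lambda>i. Y (Suc i) \<omega>)"
          using filterlim_max_partial_sum unfolding filterlim_at_top by blast
        then have "\<forall>\<^sub>F n in sequentially. D n \<omega> = Y 0 \<omega>"
          by eventually_elim (simp add: D_def)
        then show ?case by (rule tendsto_eventually)
      qed
      show "AE \<omega> in M. norm (D n \<omega>) \<le> \<bar>Y 0 \<omega>\<bar>" for n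
      proof (rule AE_I2)
        fix \<omega>
        show "norm (D n \<omega>) \<le> \<bar>Y 0 \<omega>\<bar>"
          using max_partial_sum_nonneg[of n "\<lambda>i. Y (Suc i) \<omega>"] unfolding D_def real_norm_def by linarith
      qed
      show "D n \<in> borel_measurable M" for n unfolding D_def by measurable
    qed (use intY in auto)
    moreover have "0 \<le> expectation (D n)" for n
    proof -
      have m: "(\<lambda>y. max_partial_sum n y) \<in> borel_measurable (PiM UNIV (\<lambda>_. borel))"
        by (rule max_partial_sum_measurable) simp
      have "expectation (D n) = expectation (\<lambda>\<omega>. max_partial_sum (Suc n) (\<lambda>i. Y i \<omega>))
          - expectation (\<lambda>\<omega>. max_partial_sum n (\<lambda>i. Y (Suc i) \<omega>))"
        unfolding D_eq using intY by (intro Bochner_Integration.integral_diff max_partial_sum_integrable)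
      moreover have "expectation (\<lambda>\<omega>. max_partial_sum n (\<lambda>i. Y (Suc i) \<omega>))
          = expectation (\<lambda>\<omega>. max_partial_sum n (\<lambda>i. Y i \<omega>))"
        by (rule expectation_shift_iid[OF indep same m])
      moreover have "expectation (\<lambda>\<omega>. max_partial_sum n (\<lambda>i. Y i \<omega>))
          \<le> expectation (\<lambda>\<omega>. max_partial_sum (Suc n) (\<lambda>i. Y i \<omega>))"
        using intY by (intro integral_mono max_partial_sum_integrable max_partial_sum_mono)
      ultimately show ?thesis by linarith
    qed
    ultimately have "0 \<le> expectation (Y 0)" by (intro LIMSEQ_le_const) auto
    then show False using neg by simp
  qed
  then have "prob A = 0" using iid_unbounded_0_1(2)[OF indep] unfolding A_def by blast
  then have "AE \<omega> in M. \<omega> \<notin> A"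
    using iid_unbounded_0_1(1)[OF indep] prob_eq_0[of A] unfolding A_def by simp
  then show ?thesis using AE_space by eventually_elim (simp add: A_def)
qed

text \<open>If \<open>d\<close> lies strictly between the mean and \<open>c\<close>, then the partial sums of \<open>Y\<^sub>i - d\<close> are bounded above by some
\<open>K\<close>, so the mean of the first \<open>n\<close> terms is at most \<open>d + K / n\<close>.\<close>

lemma iid_mean_eventually_less:
  fixes Y :: "nat \<Rightarrow> 'a \<Rightarrow> real"
  assumes indep: "indep_vars (\<lambda>_. borel) Y UNIV"
    and same: "\<And>i. distr M borel (Y i) = distr M borel (Y 0)"
    and int: "integrable M (Y 0)" and less: "expectation (Y 0) < c"
  shows "AE \<omega> in M. \<forall>\<^sub>F n in sequentially. (\<Sum>i<n. Y i \<omega>) / n < c"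
proof -
  have Y [measurable]: "Y i \<in> borel_measurable M" for i
    using indep unfolding indep_vars_def by auto
  obtain d where d: "expectation (Y 0) < d" "d < c" using less dense by blast
  have "AE \<omega> in M. \<not> partial_sums_unbounded (\<lambda>i. Y i \<omega> - d)"
  proof (rule iid_negative_mean_partial_sums_bounded)
    show "indep_vars (\<lambda>_. borel) (\<lambda>i \<omega>. Y i \<omega> - d) UNIV"
      by (rule indep_vars_compose2[OF indep]) simp
    show "distr M borel (\<lambda>\<omega>. Y i \<omega> - d) = distr M borel (\<lambda>\<omega>. Y 0 \<omega> - d)" for i
    proof -
      have "distr (distr M borel (Y i)) borel (\<lambda>x. x - d) = distr (distr M borel (Y 0)) borel (\<lambda>x. x - d)"
        by (simp only: same[of i])
      then show ?thesis by (simp add: distr_distr comp_def)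
    qed
  qed (use int d in \<open>simp_all add: prob_space\<close>)
  then show ?thesis
  proof eventually_elim
    case (elim \<omega>)
    then obtain K :: nat where K: "(\<Sum>i<n. Y i \<omega> - d) \<le> K" for n
      unfolding partial_sums_unbounded_def by (meson not_le)
    obtain m :: nat where m: "K / (c - d) < m" using reals_Archimedean2 by blast
    have "(\<Sum>i<n. Y i \<omega>) / n < c" if "Suc m \<le> n" for n
    proof -
      have "K < m * (c - d)" using m d by (simp add: field_simps)
      also have "\<dots> \<le> n * (c - d)" using that d by (intro mult_right_mono) auto
      finally have "(\<Sum>i<n. Y i \<omega>) < n * c"
        using K[of n] by (simp add: sum_subtractf algebra_simps)
      then show ?thesis using that by (simp add: field_simps)
    qed
    then show ?case unfolding eventually_sequentially by blast
  qed
qed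

theorem strong_law_of_large_numbers:
  fixes Y :: "nat \<Rightarrow> 'a \<Rightarrow> real"
  assumes indep: "indep_vars (\<lambda>_. borel) Y UNIV"
    and same: "\<And>i. distr M borel (Y i) = distr M borel (Y 0)"
    and int: "integrable M (Y 0)"
  shows "AE \<omega> in M. (\<lambda>n. (\<Sum>i<n. Y i \<omega>) / n) \<longlonglongrightarrow> expectation (Y 0)"
proof -
  have Y [measurable]: "Y i \<in> borel_measurable M" for i
    using indep unfolding indep_vars_def by auto
  define \<mu> where "\<mu> = expectation (Y 0)"
  have "AE \<omega> in M. \<forall>k::nat. \<forall>\<^sub>F n in sequentially. (\<Sum>i<n. Y i \<omega>) / n < \<mu> + 1 / Suc k"
    unfolding AE_all_countable
    by (intro allI iid_mean_eventually_less[OF indep same int]) (simp add: \<mu>_def)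
  moreover have "AE \<omega> in M. \<forall>k::nat. \<forall>\<^sub>F n in sequentially. (\<Sum>i<n. - Y i \<omega>) / n < - \<mu> + 1 / Suc k"
    unfolding AE_all_countable
  proof (intro allI iid_mean_eventually_less)
    show "indep_vars (\<lambda>_. borel) (\<lambda>i \<omega>. - Y i \<omega>) UNIV"
      by (rule indep_vars_compose2[OF indep]) simp
    show "distr M borel (\<lambda>\<omega>. - Y i \<omega>) = distr M borel (\<lambda>\<omega>. - Y 0 \<omega>)" for i
    proof -
      have "distr (distr M borel (Y i)) borel uminus = distr (distr M borel (Y 0)) borel uminus"
        by (simp only: same[of i])
      then show ?thesis by (simp add: distr_distr comp_def)
    qed
  qed (use int in \<open>simp_all add: \<mu>_def\<close>)
  ultimately show ?thesis
  proof eventually_elim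
    case (elim \<omega>)
    show ?case
      unfolding \<mu>_def[symmetric] tendsto_iff
    proof (intro allI impI)
      fix e :: real assume "0 < e"
      then obtain k :: nat where k: "1 / Suc k < e" using nat_approx_posE by blast
      have "\<forall>\<^sub>F n in sequentially. (\<Sum>i<n. Y i \<omega>) / n < \<mu> + 1 / Suc k" using elim(1) by blast
      moreover have "\<forall>\<^sub>F n in sequentially. (\<Sum>i<n. - Y i \<omega>) / n < - \<mu> + 1 / Suc k" using elim(2) by blast
      ultimately show "\<forall>\<^sub>F n in sequentially. dist ((\<Sum>i<n. Y i \<omega>) / n) \<mu> < e"
        by eventually_elim (use k in \<open>auto simp: dist_real_def sum_negf\<close>)
    qed
  qed
qed

lemma expectation_iid:
  fixes Y :: "nat \<Rightarrow> 'a \<Rightarrow> real"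
  assumes Y: "\<And>i. Y i \<in> borel_measurable M"
    and same: "\<And>i. distr M borel (Y i) = distr M borel (Y 0)"
    and f: "f \<in> borel_measurable borel"
  shows "integrable M (\<lambda>\<omega>. f (Y i \<omega>) :: real) \<longleftrightarrow> integrable M (\<lambda>\<omega>. f (Y 0 \<omega>))"
    and "expectation (\<lambda>\<omega>. f (Y i \<omega>)) = expectation (\<lambda>\<omega>. f (Y 0 \<omega>))"
proof -
  note [measurable] = Y f
  have "integrable (distr M borel (Y i)) f \<longleftrightarrow> integrable (distr M borel (Y 0)) f"
    by (simp only: same[of i])
  then show "integrable M (\<lambda>\<omega>. f (Y i \<omega>)) \<longleftrightarrow> integrable M (\<lambda>\<omega>. f (Y 0 \<omega>))"
    by (simp add: integrable_distr_eq)
  have "integral\<^sup>L (distr M borel (Y i)) f = integral\<^sup>L (distr M borel (Y 0)) f"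
    by (simp only: same[of i])
  then show "expectation (\<lambda>\<omega>. f (Y i \<omega>)) = expectation (\<lambda>\<omega>. f (Y 0 \<omega>))"
    by (simp add: integral_distr)
qed

text \<open>The mixed products have expectation zero by independence.\<close>

lemma iid_block_second_moment:
  fixes Y :: "nat \<Rightarrow> 'a \<Rightarrow> real"
  assumes indep: "indep_vars (\<lambda>_. borel) Y UNIV"
    and same: "\<And>i. distr M borel (Y i) = distr M borel (Y 0)"
    and mean: "expectation (Y 0) = 0" and sq: "integrable M (\<lambda>\<omega>. (Y 0 \<omega>)\<^sup>2)"
    and fin: "finite A"
  shows "integrable M (\<lambda>\<omega>. (\<Sum>i\<in>A. Y i \<omega>)\<^sup>2)"
    and "expectation (\<lambda>\<omega>. (\<Sum>i\<in>A. Y i \<omega>)\<^sup>2) = card A * expectation (\<lambda>\<omega>. (Y 0 \<omega>)\<^sup>2)"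
proof -
  have Y [measurable]: "Y i \<in> borel_measurable M" for i
    using indep unfolding indep_vars_def by auto
  have sqi: "integrable M (\<lambda>\<omega>. (Y i \<omega>)\<^sup>2)" for i
    using expectation_iid(1)[where Y = Y and f = "\<lambda>x. x\<^sup>2", OF Y same] sq by simp
  have inti: "integrable M (Y i)" for i
    by (rule square_integrable_imp_integrable[OF Y sqi])
  have meani: "expectation (Y i) = 0" for i
    using expectation_iid(2)[where Y = Y and f = "\<lambda>x. x", OF Y same] mean by simp
  have off: "integrable M (\<lambda>\<omega>. Y i \<omega> * Y j \<omega>) \<and> expectation (\<lambda>\<omega>. Y i \<omega> * Y j \<omega>) = 0" if "i \<noteq> j" for i j
  proof -
    have "indep_vars (\<lambda>_. borel) Y {i, j}" using indep by (rule indep_vars_subset) simp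
    from indep_vars_lebesgue_integral[OF _ this] indep_vars_integrable[OF _ this]
    show ?thesis using that inti by (simp add: meani)
  qed
  have prod: "integrable M (\<lambda>\<omega>. Y i \<omega> * Y j \<omega>)" for i j
    using off[of i j] sqi[of i] by (cases "i = j") (auto simp: power2_eq_square)
  have eq: "(\<Sum>i\<in>A. Y i \<omega>)\<^sup>2 = (\<Sum>i\<in>A. \<Sum>j\<in>A. Y i \<omega> * Y j \<omega>)" for \<omega>
    by (simp add: power2_eq_square sum_product)
  show "integrable M (\<lambda>\<omega>. (\<Sum>i\<in>A. Y i \<omega>)\<^sup>2)"
    unfolding eq by (intro Bochner_Integration.integrable_sum prod)
  have "expectation (\<lambda>\<omega>. (\<Sum>i\<in>A. Y i \<omega>)\<^sup>2) = (\<Sum>i\<in>A. \<Sum>j\<in>A. expectation (\<lambda>\<omega>. Y i \<omega> * Y j \<omega>))"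
    unfolding eq using prod by (simp add: Bochner_Integration.integral_sum)
  also have "\<dots> = (\<Sum>i\<in>A. \<Sum>j\<in>A. if i = j then expectation (\<lambda>\<omega>. (Y 0 \<omega>)\<^sup>2) else 0)"
  proof (intro sum.cong refl)
    fix i j
    show "expectation (\<lambda>\<omega>. Y i \<omega> * Y j \<omega>) = (if i = j then expectation (\<lambda>\<omega>. (Y 0 \<omega>)\<^sup>2) else 0)"
      using off[of i j] expectation_iid(2)[where Y = Y and f = "\<lambda>x. x\<^sup>2" and i = i, OF Y same]
      by (cases "i = j") (auto simp: power2_eq_square)
  qed
  also have "\<dots> = card A * expectation (\<lambda>\<omega>. (Y 0 \<omega>)\<^sup>2)" using fin by simp
  finally show "expectation (\<lambda>\<omega>. (\<Sum>i\<in>A. Y i \<omega>)\<^sup>2) = card A * expectation (\<lambda>\<omega>. (Y 0 \<omega>)\<^sup>2)" .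
qed

end

section \<open>Growth of square integrable sums\<close>

text \<open>A quadratic expression that dominates the squares of all sums over initial segments of the block of
length \<open>2\<^sup>k\<close> starting at \<open>a\<close>. A segment which reaches into the second half is the whole first half \<open>B\<close>
plus a segment \<open>C\<close> of the second half, and \<open>(B + C)\<^sup>2 \<le> 9 / 8 C\<^sup>2 + 9 B\<^sup>2\<close>.\<close>

primrec dyadic_majorant :: "(nat \<Rightarrow> real) \<Rightarrow> nat \<Rightarrow> nat \<Rightarrow> real" where
  "dyadic_majorant y 0 a = (y a)\<^sup>2"
| "dyadic_majorant y (Suc k) a = dyadic_majorant y k a + 9 / 8 * dyadic_majorant y k (a + 2 ^ k)
     + 9 * (\<Sum>i\<in>{a..<a + 2 ^ k}. y i)\<^sup>2"

lemma dyadic_majorant_nonneg: "0 \<le> dyadic_majorant y k a"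
  by (induction k arbitrary: a) auto

lemma block_sum_le_dyadic_majorant:
  "n \<le> 2 ^ k \<Longrightarrow> (\<Sum>i\<in>{a..<a + n}. y i)\<^sup>2 \<le> dyadic_majorant y k a"
proof (induction k arbitrary: a n)
  case 0
  then have "n = 0 \<or> n = 1" by auto
  then show ?case by auto
next
  case (Suc k)
  let ?B = "\<Sum>i\<in>{a..<a + 2 ^ k}. y i"
  note nn = dyadic_majorant_nonneg[of y k a] dyadic_majorant_nonneg[of y k "a + 2 ^ k"] zero_le_power2[of ?B]
  show ?case
  proof (cases "n \<le> 2 ^ k")
    case True
    then show ?thesis using Suc.IH[OF True, of a] nn unfolding dyadic_majorant.simps by linarith
  next
    case False
    define C where "C = (\<Sum>i\<in>{a + 2 ^ k..<(a + 2 ^ k) + (n - 2 ^ k)}. y i)"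
    have C: "C\<^sup>2 \<le> dyadic_majorant y k (a + 2 ^ k)"
      unfolding C_def by (rule Suc.IH) (use Suc.prems in simp)
    have "(\<Sum>i\<in>{a..<a + n}. y i) = ?B + C"
      unfolding C_def using False by (subst sum.atLeastLessThan_concat) auto
    moreover have "(?B + C)\<^sup>2 \<le> 9 / 8 * C\<^sup>2 + 9 * ?B\<^sup>2"
      using zero_le_power2[of "C - 8 * ?B"] by (simp add: power2_eq_square algebra_simps)
    ultimately show ?thesis using C nn unfolding dyadic_majorant.simps by simp
  qed
qed

context prob_space
begin

text \<open>One doubling multiplies the bound by \<open>1 + 9 / 8\<close> and adds a term of order \<open>2\<^sup>k\<close>. The factor \<open>9 / 4\<close>
leaves room to absorb that term, and 72 is the constant for which this works. What matters
later is that \<open>9 / 4\<close> is less than \<open>2 powr (4 / 3)\<close>.\<close>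

lemma expectation_dyadic_majorant:
  fixes Y :: "nat \<Rightarrow> 'a \<Rightarrow> real"
  assumes indep: "indep_vars (\<lambda>_. borel) Y UNIV"
    and same: "\<And>i. distr M borel (Y i) = distr M borel (Y 0)"
    and mean: "expectation (Y 0) = 0" and sq: "integrable M (\<lambda>\<omega>. (Y 0 \<omega>)\<^sup>2)"
  shows "integrable M (\<lambda>\<omega>. dyadic_majorant (\<lambda>i. Y i \<omega>) k a) \<and>
    expectation (\<lambda>\<omega>. dyadic_majorant (\<lambda>i. Y i \<omega>) k a) \<le> 72 * expectation (\<lambda>\<omega>. (Y 0 \<omega>)\<^sup>2) * (9 / 4) ^ k"
proof (induction k arbitrary: a)
  case 0
  have Y: "Y i \<in> borel_measurable M" for i
    using indep unfolding indep_vars_def by auto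
  have "0 \<le> expectation (\<lambda>\<omega>. (Y 0 \<omega>)\<^sup>2)" by (intro integral_nonneg_AE) simp
  then show ?case
    using expectation_iid[where Y = Y and f = "\<lambda>x. x\<^sup>2" and i = a, OF Y same] sq by simp
next
  case (Suc k)
  let ?s = "expectation (\<lambda>\<omega>. (Y 0 \<omega>)\<^sup>2)"
  note block = iid_block_second_moment[OF indep same mean sq, of "{a..<a + 2 ^ k}"]
  have int: "integrable M (\<lambda>\<omega>. dyadic_majorant (\<lambda>i. Y i \<omega>) (Suc k) a)"
    using Suc.IH block by simp
  have "expectation (\<lambda>\<omega>. dyadic_majorant (\<lambda>i. Y i \<omega>) (Suc k) a)
      = expectation (\<lambda>\<omega>. dyadic_majorant (\<lambda>i. Y i \<omega>) k a)
        + 9 / 8 * expectation (\<lambda>\<omega>. dyadic_majorant (\<lambda>i. Y i \<omega>) k (a + 2 ^ k)) + 9 * (2 ^ k * ?s)"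
    using Suc.IH block by simp
  also have "\<dots> \<le> 72 * ?s * (9 / 4) ^ k + 9 / 8 * (72 * ?s * (9 / 4) ^ k) + 9 * ((9 / 4) ^ k * ?s)"
  proof (intro add_mono mult_left_mono mult_right_mono power_mono)
    show "0 \<le> ?s" by (intro integral_nonneg_AE) simp
  qed (use Suc.IH in auto)
  also have "\<dots> = 72 * ?s * (9 / 4) ^ Suc k" by simp
  finally show ?case using int by blast
qed

text \<open>Along powers of two the maximal squared sums, divided by \<open>(2\<^sup>k) powr (4 / 3)\<close>, have summable expectations,
hence tend to zero almost surely; the majorant covers the indices in between.\<close>

theorem iid_partial_sum_rate:
  fixes Y :: "nat \<Rightarrow> 'a \<Rightarrow> real"
  assumes indep: "indep_vars (\<lambda>_. borel) Y UNIV"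
    and same: "\<And>i. distr M borel (Y i) = distr M borel (Y 0)"
    and mean: "expectation (Y 0) = 0" and sq: "integrable M (\<lambda>\<omega>. (Y 0 \<omega>)\<^sup>2)"
  shows "AE \<omega> in M. (\<lambda>n. (\<Sum>i<n. Y i \<omega>) / real n powr (2 / 3)) \<longlonglongrightarrow> 0"
proof -
  have Y [measurable]: "Y i \<in> borel_measurable M" for i
    using indep unfolding indep_vars_def by auto
  define c :: real where "c = 2 powr (4 / 3)"
  \<comment> \<open>compare the cubes: \<open>729 / 64 < 16\<close>\<close>
  have c: "9 / 4 < c"
  proof -
    have "c powr 3 = 2 powr 4" unfolding c_def powr_powr by simp
    then have "c ^ 3 = 16" by (simp add: c_def)
    then have "(9 / 4) ^ 3 < c ^ 3" by (simp add: power3_eq_cube)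
    then show ?thesis by (rule power_less_imp_less_base) (simp add: c_def)
  qed
  define Q where "Q k \<omega> = dyadic_majorant (\<lambda>i. Y i \<omega>) k 0 / c ^ k" for k \<omega>
  define s where "s = 72 * expectation (\<lambda>\<omega>. (Y 0 \<omega>)\<^sup>2)"
  note EQ = expectation_dyadic_majorant[OF indep same mean sq]
  have Q_int: "integrable M (Q k)" for k using EQ unfolding Q_def by simp
  have Q_nonneg: "0 \<le> Q k \<omega>" for k \<omega> unfolding Q_def using c by (simp add: dyadic_majorant_nonneg)
  have EQ_le: "expectation (Q k) \<le> s * ((9 / 4) / c) ^ k" for k
  proof -
    have "expectation (Q k) = expectation (\<lambda>\<omega>. dyadic_majorant (\<lambda>i. Y i \<omega>) k 0) / c ^ k"
      unfolding Q_def by simp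
    also have "\<dots> \<le> s * (9 / 4) ^ k / c ^ k"
      using EQ c unfolding s_def by (intro divide_right_mono) auto
    finally show ?thesis by (simp add: power_divide)
  qed
  have "AE \<omega> in M. summable (\<lambda>k. Q k \<omega>)"
  proof -
    have sum: "summable (\<lambda>k. s * ((9 / 4) / c) ^ k)" using c by (intro summable_mult summable_geometric) auto
    have "(\<integral>\<^sup>+\<omega>. (\<Sum>k. ennreal (Q k \<omega>)) \<partial>M) = (\<Sum>k. \<integral>\<^sup>+\<omega>. ennreal (Q k \<omega>) \<partial>M)"
      using Q_int by (intro nn_integral_suminf) auto
    also have "\<dots> = (\<Sum>k. ennreal (expectation (Q k)))"
      using Q_int Q_nonneg by (intro suminf_cong nn_integral_eq_integral) auto
    also have "\<dots> \<le> (\<Sum>k. ennreal (s * ((9 / 4) / c) ^ k))"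
      using EQ_le by (intro suminf_le ennreal_leI) auto
    also have "\<dots> < \<infinity>"
    proof -
      have "0 \<le> s" unfolding s_def by (intro mult_nonneg_nonneg integral_nonneg_AE) auto
      then have "(\<Sum>k. ennreal (s * ((9 / 4) / c) ^ k)) = ennreal (\<Sum>k. s * ((9 / 4) / c) ^ k)"
        using c by (intro suminf_ennreal2 sum) auto
      then show ?thesis by simp
    qed
    finally have "AE \<omega> in M. (\<Sum>k. ennreal (Q k \<omega>)) \<noteq> \<infinity>"
      using Q_int by (intro nn_integral_noteq_infinite) auto
    then show ?thesis
      by eventually_elim (auto intro!: summable_suminf_not_top Q_nonneg)
  qed
  then show ?thesis
  proof eventually_elim
    case (elim \<omega>)
    then have Q0: "(\<lambda>k. Q k \<omega>) \<longlonglongrightarrow> 0" by (rule summable_LIMSEQ_zero)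
    show ?case
    proof (rule LIMSEQ_I)
      fix e :: real assume e: "0 < e"
      then have "0 < e\<^sup>2 / c" using c by simp
      with Q0 have "\<forall>\<^sub>F k in sequentially. Q k \<omega> < e\<^sup>2 / c" by (rule order_tendstoD(2))
      then obtain k0 where k0: "\<And>k. k0 \<le> k \<Longrightarrow> Q k \<omega> < e\<^sup>2 / c"
        unfolding eventually_sequentially by blast
      have "\<bar>(\<Sum>i<n. Y i \<omega>) / real n powr (2 / 3)\<bar> < e" if n: "2 ^ k0 \<le> n" for n
      proof -
        have n1: "1 \<le> n" using n by (meson le_trans one_le_numeral one_le_power)
        then obtain k where k: "2 ^ k \<le> n" "n < 2 ^ (k + 1)"
          using ex_power_ivl1[of 2 n] by auto
        have "2 ^ k0 < (2::nat) ^ (k + 1)" using n k by linarith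
        then have "k0 \<le> k + 1" by (meson less_imp_le_nat nat_power_less_imp_less zero_less_numeral)
        have "(\<Sum>i<n. Y i \<omega>)\<^sup>2 \<le> dyadic_majorant (\<lambda>i. Y i \<omega>) (k + 1) 0"
          using block_sum_le_dyadic_majorant[of n "k + 1" "\<lambda>i. Y i \<omega>" 0] k
          by (simp add: atLeast0LessThan)
        also have "\<dots> = c ^ (k + 1) * Q (k + 1) \<omega>" unfolding Q_def using c by simp
        also have "\<dots> < c ^ (k + 1) * (e\<^sup>2 / c)"
          using k0[OF \<open>k0 \<le> k + 1\<close>] c by (intro mult_strict_left_mono) auto
        also have "\<dots> = c ^ k * e\<^sup>2" using c by simp
        also have "c ^ k = (2 ^ k) powr (4 / 3)"
        proof -
          have "c powr real k = (2 powr real k) powr (4 / 3)"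
            unfolding c_def powr_powr by (simp add: mult.commute)
          then show ?thesis using powr_realpow[of c k] powr_realpow[of 2 k] c by simp
        qed
        also have "\<dots> \<le> real n powr (4 / 3)"
        proof (rule powr_mono2)
          have "real (2 ^ k) \<le> real n" using k(1) by (simp only: of_nat_le_iff)
          then show "2 ^ k \<le> real n" by simp
        qed auto
        also have "real n powr (4 / 3) = (real n powr (2 / 3))\<^sup>2"
          by (simp add: power2_eq_square flip: powr_add)
        finally have "(\<Sum>i<n. Y i \<omega>)\<^sup>2 < (real n powr (2 / 3) * e)\<^sup>2"
          by (simp add: power_mult_distrib mult_right_mono)
        then have "\<bar>\<Sum>i<n. Y i \<omega>\<bar> < real n powr (2 / 3) * e"
          using e power_less_imp_less_base[of "\<bar>\<Sum>i<n. Y i \<omega>\<bar>" 2] by simp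
        then show ?thesis using n1 by (simp add: abs_divide divide_less_eq mult.commute)
      qed
      then show "\<exists>no. \<forall>n\<ge>no. norm ((\<Sum>i<n. Y i \<omega>) / real n powr (2 / 3) - 0) < e" by auto
    qed
  qed
qed

end

section \<open>Normal laws and the central limit theorem\<close>

lemma real_distribution_normal_law: "real_distribution (normal_law m v)" if "0 \<le> v"
proof (cases "v = 0")
  case True
  then show ?thesis unfolding normal_law_def real_distribution_def real_distribution_axioms_def
    by (auto intro!: prob_space_return)
next
  case False
  then show ?thesis unfolding normal_law_def real_distribution_def real_distribution_axioms_def
    using that by (auto intro!: prob_space_normal_density)
qed

lemma char_normal_law:
  assumes "0 \<le> v"
  shows "char (normal_law 0 v) t = complex_of_real (exp (- (v * t\<^sup>2) / 2))"
proof (cases "v = 0")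
  case True
  then show ?thesis by (simp add: normal_law_def char_def integral_return)
next
  case False
  define s where "s = sqrt v"
  have s: "0 < s" "s\<^sup>2 = v" using False assms by (auto simp: s_def)
  have "char (normal_law 0 v) t = (\<integral>x. normal_density 0 s x *\<^sub>R iexp (t * x) \<partial>lborel)"
    using False unfolding char_def normal_law_def s_def[symmetric] by (simp add: integral_density)
  also have "\<dots> = \<bar>s\<bar> *\<^sub>R (\<integral>x. normal_density 0 s (0 + s * x) *\<^sub>R iexp (t * (0 + s * x)) \<partial>lborel)"
    using s by (intro lborel_integral_real_affine) simp
  also have "\<dots> = (\<integral>x. std_normal_density x *\<^sub>R iexp ((t * s) * x) \<partial>lborel)"
  proof -
    have "\<bar>s\<bar> * normal_density 0 s (0 + s * x) = std_normal_density x" for x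
    proof -
      have "sqrt (2 * pi * s\<^sup>2) = sqrt (2 * pi) * s" using s(1) by (simp add: real_sqrt_mult)
      moreover have "(0 + s * x - 0)\<^sup>2 / (2 * s\<^sup>2) = x\<^sup>2 / 2"
        using s(1) by (simp add: power_mult_distrib)
      ultimately show ?thesis
        unfolding std_normal_density_def normal_density_def minus_divide_left[symmetric] using s(1) by simp
    qed
    then have "(\<lambda>x. \<bar>s\<bar> *\<^sub>R (normal_density 0 s (0 + s * x) *\<^sub>R iexp (t * (0 + s * x))))
        = (\<lambda>x. std_normal_density x *\<^sub>R iexp ((t * s) * x))"
      by (simp only: scaleR_scaleR) (simp add: mult.assoc)
    then show ?thesis by (simp only: integral_scaleR_right[symmetric])
  qed
  also have "\<dots> = char std_normal_distribution (t * s)"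
    unfolding char_def by (simp add: integral_density)
  also have "\<dots> = complex_of_real (exp (- (v * t\<^sup>2) / 2))"
    unfolding char_std_normal_distribution s(2)[symmetric] by (simp add: power_mult_distrib mult.commute)
  finally show ?thesis .
qed

lemma outer_prod_vector_mult: "outer_prod u v *v x = (v \<bullet> x) *\<^sub>R u"
  by (simp add: vec_eq_iff outer_prod_def matrix_vector_mult_def inner_vec_def sum_distrib_left mult_ac)

text \<open>A Cholesky decomposition. Completing the square with respect to a coordinate \<open>k\<close> with
\<open>V $ k $ k \<noteq> 0\<close> splits off one square; the remaining form is positive semidefinite and has fewer
nonzero diagonal entries. A positive semidefinite form with zero diagonal vanishes.\<close>

lemma psd_sum_of_squares:
  fixes V :: "real^'m^'m"
  assumes "transpose V = V" "\<And>a. 0 \<le> a \<bullet> (V *v a)"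
  shows "\<exists>n::nat. \<exists>A::nat \<Rightarrow> real^'m. \<forall>a. a \<bullet> (V *v a) = (\<Sum>k<n. (a \<bullet> A k)\<^sup>2)"
  using assms
proof (induction "card {k. V $ k $ k \<noteq> 0}" arbitrary: V rule: less_induct)
  case less
  note sym = less.prems(1) and psd = less.prems(2)
  have entry: "axis i 1 \<bullet> (V *v axis j 1) = V $ i $ j" for i j
    by (simp add: inner_axis' matrix_vector_mult_basis column_def)
  show ?case
  proof (cases "\<exists>k. V $ k $ k \<noteq> 0")
    case False
    have "V $ i $ j = 0" for i j
    proof -
      have "V $ j $ i = V $ i $ j"
        using sym unfolding transpose_def by (metis vec_lambda_beta)
      then have *: "0 \<le> 2 * c * V $ i $ j" for c
        using psd[of "axis i 1 + c *\<^sub>R axis j 1"] False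
        unfolding quadratic_form_add_scaled[OF sym] entry by simp
      show ?thesis using *[of 1] *[of "-1"] by simp
    qed
    then have "V = 0" by (simp add: vec_eq_iff)
    then show ?thesis by (intro exI[of _ "0::nat"]) simp
  next
    case True
    then obtain k where k: "V $ k $ k \<noteq> 0" by blast
    define d where "d = V $ k $ k"
    have d: "0 < d" using psd[of "axis k 1"] k unfolding entry d_def by simp
    define w where "w = V *v axis k 1"
    have wk: "w $ k = d" unfolding w_def d_def by (simp add: matrix_vector_mult_basis column_def)
    \<comment> \<open>the form that remains after completing the square in coordinate \<open>k\<close>\<close>
    define V' where "V' = V - (1 / d) *\<^sub>R outer_prod w w"
    have V'v: "V' *v a = V *v a - ((w \<bullet> a) / d) *\<^sub>R w" for a
      unfolding V'_def by (simp add: matrix_vector_mult_diff_rdistrib scaleR_matrix_vector_assoc[symmetric] outer_prod_vector_mult)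
    have quad: "a \<bullet> (V' *v a) = a \<bullet> (V *v a) - (a \<bullet> w)\<^sup>2 / d" for a
      unfolding V'v by (simp add: inner_diff_right power2_eq_square inner_commute)
    have psd': "0 \<le> a \<bullet> (V' *v a)" for a
    proof -
      have "axis k 1 \<bullet> (V *v a) = a \<bullet> w"
        unfolding w_def by (rule symmetric_matrix_inner[OF sym])
      \<comment> \<open>minimize the form along the line through \<open>a\<close> in direction \<open>k\<close>\<close>
      then have "0 \<le> a \<bullet> (V *v a) + 2 * (- ((a \<bullet> w) / d)) * (a \<bullet> w) + (- ((a \<bullet> w) / d))\<^sup>2 * d"
        using psd[of "a + (- ((a \<bullet> w) / d)) *\<^sub>R axis k 1"]
        unfolding quadratic_form_add_scaled[OF sym] entry d_def by simp
      then show ?thesis unfolding quad using d by (simp add: power2_eq_square field_simps)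
    qed
    have sym': "transpose V' = V'"
      using sym unfolding V'_def by (simp add: transpose_def vec_eq_iff outer_prod_def mult.commute)
    have V'e: "V' $ i $ i = V $ i $ i - (w $ i)\<^sup>2 / d" for i
      unfolding V'_def by (simp add: outer_prod_def power2_eq_square)
    have V'n: "0 \<le> V' $ i $ i" for i
      using psd'[of "axis i 1"] by (simp add: inner_axis' matrix_vector_mult_basis column_def)
    have "{i. V' $ i $ i \<noteq> 0} \<subset> {i. V $ i $ i \<noteq> 0}"
    proof
      show "{i. V' $ i $ i \<noteq> 0} \<subseteq> {i. V $ i $ i \<noteq> 0}"
      proof clarify
        fix i assume "V' $ i $ i \<noteq> 0" "V $ i $ i = 0"
        moreover have "0 \<le> (w $ i)\<^sup>2 / d" using d by simp
        ultimately show False using V'n[of i] V'e[of i] by linarith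
      qed
      have "V' $ k $ k = 0" unfolding V'e wk using d by (simp add: power2_eq_square d_def[symmetric])
      then show "{i. V' $ i $ i \<noteq> 0} \<noteq> {i. V $ i $ i \<noteq> 0}" using k by blast
    qed
    then have "card {i. V' $ i $ i \<noteq> 0} < card {i. V $ i $ i \<noteq> 0}"
      by (intro psubset_card_mono) auto
    then obtain n and A :: "nat \<Rightarrow> real^'m" where A: "\<And>a. a \<bullet> (V' *v a) = (\<Sum>k<n. (a \<bullet> A k)\<^sup>2)"
      using less.hyps[OF _ sym' psd'] by blast
    define A' where "A' = A(n := (1 / sqrt d) *\<^sub>R w)"
    have "a \<bullet> (V *v a) = (\<Sum>k<Suc n. (a \<bullet> A' k)\<^sup>2)" for a
    proof -
      have "(\<Sum>k<n. (a \<bullet> A' k)\<^sup>2) = (\<Sum>k<n. (a \<bullet> A k)\<^sup>2)"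
        by (intro sum.cong) (auto simp: A'_def)
      moreover have "(a \<bullet> A' n)\<^sup>2 = (a \<bullet> w)\<^sup>2 / d"
        using d by (simp add: A'_def power_divide)
      ultimately show ?thesis using quad[of a] A[of a] by simp
    qed
    then show ?thesis by blast
  qed
qed

text \<open>If \<open>a \<bullet> V a\<close> is the sum of the squares \<open>(a \<bullet> A\<^sub>k)\<^sup>2\<close>, then \<open>\<Sum> z\<^sub>k A\<^sub>k\<close> with independent
standard normal \<open>z\<^sub>k\<close> has the required law; the laws of its linear functionals are identified by their
characteristic functions.\<close>

theorem centered_normal_exists:
  fixes V :: "real^'m^'m"
  assumes sym: "transpose V = V" and psd: "\<And>a. 0 \<le> a \<bullet> (V *v a)"
  shows "\<exists>\<mu>. centered_normal V \<mu>"
proof -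
  obtain n and A :: "nat \<Rightarrow> real^'m" where A: "\<And>a. a \<bullet> (V *v a) = (\<Sum>k<n. (a \<bullet> A k)\<^sup>2)"
    using psd_sum_of_squares[OF sym psd] by blast
  interpret N: product_prob_space "\<lambda>_::nat. std_normal_distribution" "{..<n}"
    unfolding product_prob_space_def product_prob_space_axioms_def product_sigma_finite_def
    using prob_space_normal_density[of 1 0] by (auto intro: prob_space_imp_sigma_finite)
  let ?P = "PiM {..<n} (\<lambda>_. std_normal_distribution)"
  define T where "T z = (\<Sum>k<n. z k *\<^sub>R A k)" for z :: "nat \<Rightarrow> real"
  have Tm [measurable]: "T \<in> measurable ?P borel" unfolding T_def by measurable
  define \<mu> where "\<mu> = distr ?P borel T"
  have "prob_space \<mu>" unfolding \<mu>_def by (rule N.prob_space_distr) simp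
  moreover have "distr \<mu> borel (\<lambda>x. a \<bullet> x) = normal_law 0 (a \<bullet> (V *v a))" for a
  proof (rule Levy_uniqueness)
    have d: "distr \<mu> borel (\<lambda>x. a \<bullet> x) = distr ?P borel (\<lambda>z. a \<bullet> T z)"
      unfolding \<mu>_def by (subst distr_distr) (auto simp: comp_def)
    show "real_distribution (distr \<mu> borel (\<lambda>x. a \<bullet> x))"
      unfolding d by (intro N.real_distribution_distr) simp
    show "real_distribution (normal_law 0 (a \<bullet> (V *v a)))"
      by (rule real_distribution_normal_law[OF psd])
    show "char (distr \<mu> borel (\<lambda>x. a \<bullet> x)) = char (normal_law 0 (a \<bullet> (V *v a)))"
    proof
      fix t
      have "char (distr \<mu> borel (\<lambda>x. a \<bullet> x)) t = (CLINT z|?P. iexp (t * (a \<bullet> T z)))"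
        unfolding d char_def by (subst integral_distr) auto
      also have "\<dots> = (CLINT z|?P. \<Prod>k<n. iexp ((t * (a \<bullet> A k)) * z k))"
      proof (intro Bochner_Integration.integral_cong refl)
        fix z :: "nat \<Rightarrow> real"
        have "iexp (t * (a \<bullet> T z)) = exp (\<Sum>k<n. \<i> * complex_of_real ((t * (a \<bullet> A k)) * z k))"
          unfolding T_def by (simp add: inner_sum_right sum_distrib_left mult_ac)
        then show "iexp (t * (a \<bullet> T z)) = (\<Prod>k<n. iexp ((t * (a \<bullet> A k)) * z k))"
          by (simp only: exp_sum finite_lessThan)
      qed
      also have "\<dots> = (\<Prod>k<n. CLINT s|std_normal_distribution. iexp ((t * (a \<bullet> A k)) * s))"
      proof (rule N.product_integral_prod)
        have fm: "finite_measure std_normal_distribution"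
          using prob_space_normal_density[of 1 0] by (simp add: prob_space_def)
        show "integrable std_normal_distribution (\<lambda>s. iexp ((t * (a \<bullet> A k)) * s))" for k
          by (rule finite_measure.integrable_const_bound[OF fm, where B = 1]) auto
      qed simp
      also have "\<dots> = (\<Prod>k<n. complex_of_real (exp (- ((t * (a \<bullet> A k))\<^sup>2) / 2)))"
        using char_std_normal_distribution unfolding char_def by metis
      also have "\<dots> = complex_of_real (exp (\<Sum>k<n. - ((t * (a \<bullet> A k))\<^sup>2) / 2))"
        by (simp add: exp_sum)
      also have "(\<Sum>k<n. - ((t * (a \<bullet> A k))\<^sup>2) / 2) = - ((a \<bullet> (V *v a)) * t\<^sup>2) / 2"
        unfolding A by (simp add: sum_negf sum_divide_distrib[symmetric] sum_distrib_left power_mult_distrib mult_ac)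
      finally show "char (distr \<mu> borel (\<lambda>x. a \<bullet> x)) t = char (normal_law 0 (a \<bullet> (V *v a))) t"
        by (simp add: char_normal_law[OF psd])
    qed
  qed
  ultimately have "centered_normal V \<mu>" unfolding centered_normal_def using sym by (simp add: \<mu>_def)
  then show ?thesis ..
qed

context prob_space
begin

text \<open>The central limit theorem in terms of characteristic functions, which also covers variance zero.\<close>

theorem iid_characteristic_function_limit:
  fixes Y :: "nat \<Rightarrow> 'a \<Rightarrow> real"
  assumes indep: "indep_vars (\<lambda>_. borel) Y UNIV"
    and same: "\<And>i. distr M borel (Y i) = distr M borel (Y 0)"
    and mean: "expectation (Y 0) = 0" and sq: "integrable M (\<lambda>\<omega>. (Y 0 \<omega>)\<^sup>2)"
  shows "(\<lambda>n. CLINT \<omega>|M. iexp (t * ((\<Sum>i<n. Y i \<omega>) / sqrt n)))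
    \<longlonglongrightarrow> complex_of_real (exp (- (expectation (\<lambda>\<omega>. (Y 0 \<omega>)\<^sup>2) * t\<^sup>2) / 2))"
proof -
  have Y [measurable]: "Y i \<in> borel_measurable M" for i
    using indep unfolding indep_vars_def by auto
  have sqi: "integrable M (\<lambda>\<omega>. (Y i \<omega>)\<^sup>2)" for i
    using expectation_iid(1)[where Y = Y and f = "\<lambda>x. x\<^sup>2", OF Y same] sq by simp
  have sqe: "expectation (\<lambda>\<omega>. (Y i \<omega>)\<^sup>2) = expectation (\<lambda>\<omega>. (Y 0 \<omega>)\<^sup>2)" for i
    using expectation_iid(2)[where Y = Y and f = "\<lambda>x. x\<^sup>2", OF Y same] by simp
  have meani: "expectation (Y i) = 0" for i
    using expectation_iid(2)[where Y = Y and f = "\<lambda>x. x", OF Y same] mean by simp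
  define v where "v = expectation (\<lambda>\<omega>. (Y 0 \<omega>)\<^sup>2)"
  have v0: "0 \<le> v" unfolding v_def by (intro integral_nonneg_AE) simp
  show ?thesis
  proof (cases "v = 0")
    case True
    have "AE \<omega> in M. (Y i \<omega>)\<^sup>2 = 0" for i
      using True sqi[of i] sqe[of i]
      by (subst integral_nonneg_eq_0_iff_AE[symmetric]) (auto simp: v_def)
    then have "AE \<omega> in M. \<forall>i. Y i \<omega> = 0" unfolding AE_all_countable by simp
    then have "(CLINT \<omega>|M. iexp (t * ((\<Sum>i<n. Y i \<omega>) / sqrt n))) = (CLINT \<omega>|M. 1)" for n
      by (intro integral_cong_AE) auto
    then show ?thesis using True by (simp add: prob_space v_def)
  next
    case False
    define \<sigma> where "\<sigma> = sqrt v"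
    have \<sigma>: "0 < \<sigma>" "\<sigma>\<^sup>2 = v" using False v0 by (auto simp: \<sigma>_def)
    have w: "weak_conv_m (\<lambda>n. distr M borel (\<lambda>\<omega>. (\<Sum>i<n. Y i \<omega>) / sqrt (n * \<sigma>\<^sup>2))) std_normal_distribution"
    proof (rule central_limit_theorem_zero_mean[OF indep meani \<sigma>(1) sqi])
      show "variance (Y n) = \<sigma>\<^sup>2" for n
        using sqe[of n] by (simp add: meani \<sigma> v_def)
    qed (rule same)
    have "(\<lambda>n. char (distr M borel (\<lambda>\<omega>. (\<Sum>i<n. Y i \<omega>) / sqrt (n * \<sigma>\<^sup>2))) (t * \<sigma>))
        \<longlonglongrightarrow> char std_normal_distribution (t * \<sigma>)"
      by (rule levy_continuity1[OF _ real_dist_normal_dist w]) (intro real_distribution_distr, measurable)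
    also have "char std_normal_distribution (t * \<sigma>) = complex_of_real (exp (- (v * t\<^sup>2) / 2))"
      unfolding char_std_normal_distribution \<sigma>(2)[symmetric] by (simp add: power_mult_distrib mult.commute)
    also have "(\<lambda>n. char (distr M borel (\<lambda>\<omega>. (\<Sum>i<n. Y i \<omega>) / sqrt (n * \<sigma>\<^sup>2))) (t * \<sigma>))
        = (\<lambda>n. CLINT \<omega>|M. iexp (t * ((\<Sum>i<n. Y i \<omega>) / sqrt n)))"
    proof
      fix n :: nat
      have "t * \<sigma> * (s / sqrt (n * \<sigma>\<^sup>2)) = t * (s / sqrt n)" for s
        using \<sigma>(1) by (simp add: real_sqrt_mult)
      then show "char (distr M borel (\<lambda>\<omega>. (\<Sum>i<n. Y i \<omega>) / sqrt (n * \<sigma>\<^sup>2))) (t * \<sigma>)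
        = (CLINT \<omega>|M. iexp (t * ((\<Sum>i<n. Y i \<omega>) / sqrt n)))"
        unfolding char_def by (subst integral_distr) (auto simp del: of_real_mult of_real_divide)
    qed
    finally show ?thesis unfolding v_def .
  qed
qed

lemma iexp_diff_le: "cmod (iexp a - iexp b) \<le> \<bar>a - b\<bar>"
proof -
  have "iexp a - iexp b = iexp b * (iexp (a - b) - 1)"
    by (simp add: exp_add[symmetric] algebra_simps)
  then have "cmod (iexp a - iexp b) = cmod (iexp (a - b) - 1)" by (simp add: norm_mult)
  also have "\<dots> \<le> \<bar>a - b\<bar>" using iexp_approx1[of "a - b" 0] by simp
  finally show ?thesis .
qed

text \<open>If two sequences differ by a null factor times a sequence with bounded means, then they have the same
limit law. The bound \<open>R\<close> has to hold eventually along almost every path, not in probability, which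
is the form in which the comparison with the score is available.\<close>

lemma characteristic_functions_merge:
  fixes U T R :: "nat \<Rightarrow> 'a \<Rightarrow> real"
  assumes U [measurable]: "\<And>n. U n \<in> borel_measurable M"
    and T [measurable]: "\<And>n. T n \<in> borel_measurable M"
    and R: "\<And>n. integrable M (R n)" "\<And>n \<omega>. 0 \<le> R n \<omega>" "\<And>n. expectation (R n) \<le> C"
    and close: "AE \<omega> in M. \<forall>e>0. \<forall>\<^sub>F n in sequentially. \<bar>U n \<omega> - T n \<omega>\<bar> \<le> e * R n \<omega>"
  shows "(\<lambda>n. (CLINT \<omega>|M. iexp (U n \<omega>)) - (CLINT \<omega>|M. iexp (T n \<omega>))) \<longlonglongrightarrow> 0"
proof (rule LIMSEQ_I)
  fix e :: real assume e: "0 < e"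
  have [measurable]: "R n \<in> borel_measurable M" for n using R(1) by simp
  have "0 \<le> expectation (R 0)" by (intro integral_nonneg_AE) (simp add: R(2))
  then have C: "0 \<le> C" using R(3)[of 0] by linarith
  define d where "d = e / (2 * (C + 1))"
  have d: "0 < d" "d * C \<le> e / 2" using e C by (simp_all add: d_def field_simps)
  define bad where "bad n = {\<omega> \<in> space M. d * R n \<omega> < \<bar>U n \<omega> - T n \<omega>\<bar>}" for n
  have [measurable]: "bad n \<in> events" for n unfolding bad_def by measurable
  have "(\<lambda>n. \<integral>\<omega>. indicator (bad n) \<omega> \<partial>M) \<longlonglongrightarrow> (\<integral>\<omega>. (0::real) \<partial>M)"
  proof (rule integral_dominated_convergence[where w = "\<lambda>_. 1"])
    show "AE \<omega> in M. (\<lambda>n. indicator (bad n) \<omega> :: real) \<longlonglongrightarrow> 0"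
      using close
    proof eventually_elim
      case (elim \<omega>)
      then have "\<forall>\<^sub>F n in sequentially. \<bar>U n \<omega> - T n \<omega>\<bar> \<le> d * R n \<omega>" using d by blast
      then have "\<forall>\<^sub>F n in sequentially. indicator (bad n) \<omega> = (0::real)"
        by eventually_elim (simp add: bad_def)
      then show ?case by (rule tendsto_eventually)
    qed
  qed (auto simp: indicator_def)
  then have "\<forall>\<^sub>F n in sequentially. (\<integral>\<omega>. indicator (bad n) \<omega> \<partial>M) < e / 4"
    using e by (intro order_tendstoD(2)[of _ 0]) auto
  then have "\<forall>\<^sub>F n in sequentially. norm ((CLINT \<omega>|M. iexp (U n \<omega>)) - (CLINT \<omega>|M. iexp (T n \<omega>)) - 0) < e"
  proof eventually_elim
    case (elim n)
    have iU: "integrable M (\<lambda>\<omega>. iexp (U n \<omega>))" by (rule integrable_const_bound[where B = 1]) auto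
    have iT: "integrable M (\<lambda>\<omega>. iexp (T n \<omega>))" by (rule integrable_const_bound[where B = 1]) auto
    have iB: "integrable M (indicator (bad n) :: _ \<Rightarrow> real)"
      by (rule integrable_const_bound[where B = 1]) (auto simp: indicator_def)
    have "norm ((CLINT \<omega>|M. iexp (U n \<omega>)) - (CLINT \<omega>|M. iexp (T n \<omega>)))
        = norm (CLINT \<omega>|M. iexp (U n \<omega>) - iexp (T n \<omega>))"
      using iU iT by simp
    also have "\<dots> \<le> (\<integral>\<omega>. norm (iexp (U n \<omega>) - iexp (T n \<omega>)) \<partial>M)" by (rule integral_norm_bound)
    also have "\<dots> \<le> (\<integral>\<omega>. d * R n \<omega> + 2 * indicator (bad n) \<omega> \<partial>M)"
    proof (rule integral_mono)
      fix \<omega> assume \<omega>: "\<omega> \<in> space M"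
      show "norm (iexp (U n \<omega>) - iexp (T n \<omega>)) \<le> d * R n \<omega> + 2 * indicator (bad n) \<omega>"
      proof (cases "\<omega> \<in> bad n")
        case True
        have "norm (iexp (U n \<omega>) - iexp (T n \<omega>)) \<le> norm (iexp (U n \<omega>)) + norm (iexp (T n \<omega>))"
          by (rule norm_triangle_ineq4)
        then show ?thesis using True d(1) R(2)[of n \<omega>] by (simp add: add_increasing)
      next
        case False
        then show ?thesis using \<omega> iexp_diff_le[of "U n \<omega>" "T n \<omega>"] by (simp add: bad_def)
      qed
    qed (use iU iT iB R(1) in auto)
    also have "\<dots> = d * expectation (R n) + 2 * (\<integral>\<omega>. indicator (bad n) \<omega> \<partial>M)"
      using iB R(1) by simp
    also have "\<dots> < e" using elim mult_left_mono[OF R(3), of d n] d by linarith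
    finally show ?case by simp
  qed
  then show "\<exists>no. \<forall>n\<ge>no. norm ((CLINT \<omega>|M. iexp (U n \<omega>)) - (CLINT \<omega>|M. iexp (T n \<omega>)) - 0) < e"
    by (simp add: eventually_sequentially)
qed

end

section \<open>Weak convergence of random vectors\<close>

text \<open>The standard normal density. It is its own Fourier transform up to a constant, which lets Gaussian
smoothing of a measure be expressed through its characteristic function.\<close>

definition gauss_kernel :: "'a::euclidean_space \<Rightarrow> real" where
  "gauss_kernel x = (\<Prod>b\<in>Basis. std_normal_density (x \<bullet> b))"

definition gauss_measure :: "'a::euclidean_space measure" where
  "gauss_measure = density lborel (\<lambda>x. ennreal (gauss_kernel x))"

lemma lborel_prod_integral:
  fixes h :: "'a::euclidean_space \<Rightarrow> real \<Rightarrow> 'b::{real_normed_field, banach, second_countable_topology}"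
  assumes int: "\<And>b. b \<in> Basis \<Longrightarrow> integrable lborel (h b)"
  shows "integrable lborel (\<lambda>x::'a. \<Prod>b\<in>Basis. h b (x \<bullet> b))"
    and "(\<integral>x. (\<Prod>b\<in>Basis. h b (x \<bullet> b)) \<partial>(lborel :: 'a measure)) = (\<Prod>b\<in>Basis. \<integral>s. h b s \<partial>lborel)"
proof -
  interpret product_sigma_finite "\<lambda>_::'a. lborel :: real measure" ..
  define T :: "('a \<Rightarrow> real) \<Rightarrow> 'a" where "T f = (\<Sum>b\<in>Basis. f b *\<^sub>R b)" for f
  have lb: "lborel = distr (\<Pi>\<^sub>M b\<in>Basis. lborel :: real measure) borel T"
    using lborel_eq[where 'a = 'a] by (simp add: T_def[abs_def])
  have hm: "h b \<in> borel_measurable borel" if "b \<in> Basis" for b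
    using borel_measurable_integrable[OF int[OF that]] by simp
  have T [measurable]: "T \<in> measurable (\<Pi>\<^sub>M b\<in>Basis. lborel :: real measure) borel"
    unfolding T_def by measurable
  have m: "(\<lambda>x::'a. \<Prod>b\<in>Basis. h b (x \<bullet> b)) \<in> borel_measurable borel"
    by (intro borel_measurable_prod measurable_compose[OF _ hm]) simp_all
  have eq: "(\<Prod>b\<in>Basis. h b (T f \<bullet> b)) = (\<Prod>b\<in>Basis. h b (f b))" for f
    unfolding T_def by (intro prod.cong refl) simp
  show "integrable lborel (\<lambda>x::'a. \<Prod>b\<in>Basis. h b (x \<bullet> b))"
    unfolding lb integrable_distr_eq[OF T m] eq using int by (intro product_integrable_prod) auto
  show "(\<integral>x. (\<Prod>b\<in>Basis. h b (x \<bullet> b)) \<partial>(lborel :: 'a measure)) = (\<Prod>b\<in>Basis. \<integral>s. h b s \<partial>lborel)"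
    unfolding lb integral_distr[OF T m] eq using int by (intro product_integral_prod) auto
qed

lemma gauss_kernel_pos: "0 < gauss_kernel x"
  unfolding gauss_kernel_def by (auto intro!: prod_pos normal_density_pos)

lemma gauss_kernel_measurable [measurable]: "gauss_kernel \<in> borel_measurable borel"
  unfolding gauss_kernel_def by measurable

lemma gauss_kernel_integral:
  "integrable lborel (gauss_kernel :: 'a::euclidean_space \<Rightarrow> real)"
  "(\<integral>x. gauss_kernel x \<partial>(lborel :: 'a measure)) = 1"
proof -
  have 1: "integrable lborel std_normal_density" "(\<integral>s. std_normal_density s \<partial>lborel) = 1"
    by (simp_all add: integrable_normal_density integral_normal_density)
  show "integrable lborel (gauss_kernel :: 'a \<Rightarrow> real)" "(\<integral>x. gauss_kernel x \<partial>(lborel :: 'a measure)) = 1"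
    unfolding gauss_kernel_def using lborel_prod_integral[where h = "\<lambda>_::'a. std_normal_density"] 1 by simp_all
qed

lemma prob_space_gauss: "prob_space (gauss_measure :: 'a::euclidean_space measure)"
proof
  have "emeasure gauss_measure (space (gauss_measure :: 'a measure)) = (\<integral>\<^sup>+x. ennreal (gauss_kernel x) \<partial>(lborel :: 'a measure))"
    by (simp add: gauss_measure_def emeasure_density)
  also have "\<dots> = 1"
    using gauss_kernel_integral[where 'a = 'a]
    by (subst nn_integral_eq_integral) (auto simp: less_imp_le[OF gauss_kernel_pos])
  finally show "emeasure gauss_measure (space (gauss_measure :: 'a measure)) = 1" .
qed

lemma sets_gauss [simp, measurable_cong]: "sets gauss_measure = sets borel"
  by (simp add: gauss_measure_def)

lemma iexp_sum: "finite A \<Longrightarrow> iexp (\<Sum>b\<in>A. f b) = (\<Prod>b\<in>A. iexp (f b))"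
  by (simp add: sum_distrib_left exp_sum)

lemma gauss_char:
  "(CLINT x|gauss_measure. iexp (t \<bullet> x)) = complex_of_real (sqrt (2 * pi) ^ DIM('a) * gauss_kernel (t :: 'a::euclidean_space))"
proof -
  define h where "h b s = std_normal_density s *\<^sub>R iexp ((t \<bullet> b) * s)" for b :: 'a and s
  have int: "integrable lborel (h b)" for b
  proof -
    have "integrable lborel (\<lambda>s. std_normal_density s *\<^sub>R (1::complex))"
      by (intro integrable_scaleR_left integrable_normal_density) simp
    then show ?thesis
      unfolding h_def by (rule Bochner_Integration.integrable_bound) auto
  qed
  have h1: "(\<integral>s. h b s \<partial>lborel) = complex_of_real (sqrt (2 * pi) * std_normal_density (t \<bullet> b))" for b
  proof -
    have "(\<integral>s. h b s \<partial>lborel) = char std_normal_distribution (t \<bullet> b)"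
      unfolding h_def char_def by (subst integral_density) auto
    then show ?thesis unfolding char_std_normal_distribution by (simp add: std_normal_density_def)
  qed
  have "(CLINT x|gauss_measure. iexp (t \<bullet> x)) = (\<integral>x. gauss_kernel x *\<^sub>R iexp (t \<bullet> x) \<partial>lborel)"
    unfolding gauss_measure_def by (subst integral_density) (auto simp: less_imp_le[OF gauss_kernel_pos])
  also have "(\<lambda>x. gauss_kernel x *\<^sub>R iexp (t \<bullet> x)) = (\<lambda>x. \<Prod>b\<in>Basis. h b (x \<bullet> b))"
  proof
    fix x :: 'a
    have "t \<bullet> x = (\<Sum>b\<in>Basis. (t \<bullet> b) * (x \<bullet> b))" by (rule euclidean_inner)
    then have "iexp (t \<bullet> x) = (\<Prod>b\<in>Basis. iexp ((t \<bullet> b) * (x \<bullet> b)))"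
      by (simp only: iexp_sum finite_Basis)
    then show "gauss_kernel x *\<^sub>R iexp (t \<bullet> x) = (\<Prod>b\<in>Basis. h b (x \<bullet> b))"
      unfolding h_def gauss_kernel_def by (simp add: scaleR_conv_of_real prod.distrib)
  qed
  also have "(\<integral>x. (\<Prod>b\<in>Basis. h b (x \<bullet> b)) \<partial>lborel) = (\<Prod>b\<in>Basis. \<integral>s. h b s \<partial>lborel)"
    by (rule lborel_prod_integral(2)[OF int])
  also have "\<dots> = complex_of_real (sqrt (2 * pi) ^ DIM('a) * gauss_kernel t)"
    unfolding h1 gauss_kernel_def by (simp add: prod.distrib)
  finally show ?thesis .
qed

lemma gauss_kernel_le: "gauss_kernel (t :: 'a::euclidean_space) \<le> 1 / sqrt (2 * pi) ^ DIM('a)"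
proof -
  interpret prob_space "gauss_measure :: 'a measure" by (rule prob_space_gauss)
  have "cmod (CLINT x|gauss_measure. iexp (t \<bullet> x)) \<le> (\<integral>x. cmod (iexp (t \<bullet> x)) \<partial>gauss_measure)"
    by (rule integral_norm_bound)
  also have "\<dots> = 1" by (simp add: prob_space)
  finally have "cmod (complex_of_real (sqrt (2 * pi) ^ DIM('a) * gauss_kernel t)) \<le> 1"
    by (simp only: gauss_char)
  then have "\<bar>sqrt (2 * pi) ^ DIM('a) * gauss_kernel t\<bar> \<le> 1" by (simp only: norm_of_real)
  then have "gauss_kernel t * sqrt (2 * pi) ^ DIM('a) \<le> 1" by (simp add: mult.commute)
  then show ?thesis by (simp add: pos_le_divide_eq)
qed

text \<open>Convolution with the rescaled kernel is averaging over a small normal perturbation.\<close>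

lemma gauss_translate:
  fixes f :: "'a::euclidean_space \<Rightarrow> real"
  assumes [measurable]: "f \<in> borel_measurable borel" and \<sigma>: "0 < \<sigma>"
  shows "(\<integral>v. f v * gauss_kernel ((1 / \<sigma>) *\<^sub>R (v - y)) \<partial>lborel)
    = \<sigma> ^ DIM('a) * (\<integral>u. f (y + \<sigma> *\<^sub>R u) \<partial>gauss_measure)"
proof -
  have "(\<integral>v. f v * gauss_kernel ((1 / \<sigma>) *\<^sub>R (v - y)) \<partial>lborel)
      = (\<integral>v. f v * gauss_kernel ((1 / \<sigma>) *\<^sub>R (v - y))
          \<partial>density (distr lborel borel (\<lambda>x. y + \<sigma> *\<^sub>R x)) (\<lambda>_. ennreal (\<bar>\<sigma>\<bar> ^ DIM('a))))"
    using lborel_affine[of \<sigma> y] \<sigma> by (simp add: ennreal_power)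
  also have "\<dots> = \<sigma> ^ DIM('a) * (\<integral>u. f (y + \<sigma> *\<^sub>R u) * gauss_kernel u \<partial>lborel)"
    using \<sigma> by (subst integral_density) (auto simp: integral_distr)
  also have "(\<integral>u. f (y + \<sigma> *\<^sub>R u) * gauss_kernel u \<partial>lborel) = (\<integral>u. f (y + \<sigma> *\<^sub>R u) \<partial>gauss_measure)"
    unfolding gauss_measure_def
    by (subst integral_density) (auto simp: less_imp_le[OF gauss_kernel_pos] mult.commute)
  finally show ?thesis .
qed

text \<open>The kernel is a mixture of the functions \<open>y \<mapsto> iexp (- t \<bullet> y)\<close>, so its integral is a mixture of
values of the characteristic function, and dominated convergence applies.\<close>

lemma char_imp_kernel_convergence:
  fixes \<mu>s :: "nat \<Rightarrow> 'a::euclidean_space measure"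
  assumes ps: "\<And>n. prob_space (\<mu>s n)" "prob_space \<mu>"
    and sets: "\<And>n. sets (\<mu>s n) = sets borel" "sets \<mu> = sets borel"
    and conv: "\<And>t. (\<lambda>n. CLINT y|\<mu>s n. iexp (t \<bullet> y)) \<longlonglongrightarrow> (CLINT y|\<mu>. iexp (t \<bullet> y))"
  shows "(\<lambda>n. \<integral>y. gauss_kernel (s *\<^sub>R (v - y)) \<partial>\<mu>s n) \<longlonglongrightarrow> (\<integral>y. gauss_kernel (s *\<^sub>R (v - y)) \<partial>\<mu>)"
proof -
  interpret g: prob_space "gauss_measure :: 'a measure" by (rule prob_space_gauss)
  define c where "c = sqrt (2 * pi) ^ DIM('a)"
  have c: "0 < c" unfolding c_def by simp
  define A where "A \<nu> = (CLINT x|gauss_measure. iexp (s * (v \<bullet> x)) * (CLINT y|\<nu>. iexp ((- s *\<^sub>R x) \<bullet> y)))"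
    for \<nu> :: "'a measure"
  have A: "A \<nu> = complex_of_real (c * (\<integral>y. gauss_kernel (s *\<^sub>R (v - y)) \<partial>\<nu>))"
    if \<nu>: "prob_space \<nu>" "sets \<nu> = sets borel" for \<nu>
  proof -
    interpret n: prob_space \<nu> by fact
    interpret pair_prob_space \<nu> "gauss_measure :: 'a measure" ..
    note [measurable_cong] = \<nu>(2)
    have m: "(\<lambda>(y, x). iexp ((s *\<^sub>R (v - y)) \<bullet> x)) \<in> borel_measurable (\<nu> \<Otimes>\<^sub>M gauss_measure)"
      by measurable
    have "complex_of_real (c * (\<integral>y. gauss_kernel (s *\<^sub>R (v - y)) \<partial>\<nu>))
        = (CLINT y|\<nu>. complex_of_real (c * gauss_kernel (s *\<^sub>R (v - y))))"
      by simp
    also have "\<dots> = (CLINT y|\<nu>. CLINT x|gauss_measure. iexp ((s *\<^sub>R (v - y)) \<bullet> x))"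
      unfolding c_def gauss_char ..
    also have "\<dots> = (CLINT x|gauss_measure. CLINT y|\<nu>. iexp ((s *\<^sub>R (v - y)) \<bullet> x))"
      by (rule Fubini_integral[symmetric], rule P.integrable_const_bound[where B = 1, OF _ m]) auto
    also have "\<dots> = A \<nu>"
    proof -
      have "iexp ((s *\<^sub>R (v - y)) \<bullet> x) = iexp (s * (v \<bullet> x)) * iexp ((- s *\<^sub>R x) \<bullet> y)" for x y
        by (simp add: exp_add[symmetric] inner_diff_left inner_commute algebra_simps)
      then show ?thesis unfolding A_def by simp
    qed
    finally show ?thesis ..
  qed
  have "(\<lambda>n. A (\<mu>s n)) \<longlonglongrightarrow> A \<mu>"
    unfolding A_def
  proof (rule integral_dominated_convergence[where w = "\<lambda>_. 1"])
    have meas: "(\<lambda>x. iexp (s * (v \<bullet> x)) * (CLINT y|\<nu>. iexp ((- s *\<^sub>R x) \<bullet> y))) \<in> borel_measurable gauss_measure"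
      if \<nu>: "prob_space \<nu>" "sets \<nu> = sets borel" for \<nu> :: "'a measure"
    proof -
      interpret n: prob_space \<nu> by fact
      note [measurable_cong] = \<nu>(2)
      show ?thesis by measurable
    qed
    show "(\<lambda>x. iexp (s * (v \<bullet> x)) * (CLINT y|\<mu>. iexp ((- s *\<^sub>R x) \<bullet> y))) \<in> borel_measurable gauss_measure"
      using ps sets by (intro meas)
    show "(\<lambda>x. iexp (s * (v \<bullet> x)) * (CLINT y|\<mu>s n. iexp ((- s *\<^sub>R x) \<bullet> y))) \<in> borel_measurable gauss_measure" for n
      using ps sets by (intro meas)
    show "AE x in gauss_measure. (\<lambda>n. iexp (s * (v \<bullet> x)) * (CLINT y|\<mu>s n. iexp ((- s *\<^sub>R x) \<bullet> y)))
        \<longlonglongrightarrow> iexp (s * (v \<bullet> x)) * (CLINT y|\<mu>. iexp ((- s *\<^sub>R x) \<bullet> y))"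
      by (intro AE_I2 tendsto_mult tendsto_const conv)
    show "AE x in gauss_measure. cmod (iexp (s * (v \<bullet> x)) * (CLINT y|\<mu>s n. iexp ((- s *\<^sub>R x) \<bullet> y))) \<le> 1" for n
    proof (rule AE_I2)
      fix x :: 'a
      interpret n: prob_space "\<mu>s n" by (rule ps)
      have "cmod (CLINT y|\<mu>s n. iexp ((- s *\<^sub>R x) \<bullet> y)) \<le> (\<integral>y. cmod (iexp ((- s *\<^sub>R x) \<bullet> y)) \<partial>\<mu>s n)"
        by (rule integral_norm_bound)
      also have "\<dots> = 1" by (simp add: n.prob_space)
      finally show "cmod (iexp (s * (v \<bullet> x)) * (CLINT y|\<mu>s n. iexp ((- s *\<^sub>R x) \<bullet> y))) \<le> 1"
        by (simp add: norm_mult)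
    qed
  qed simp
  then have "(\<lambda>n. Re (A (\<mu>s n)) / c) \<longlonglongrightarrow> Re (A \<mu>) / c"
    using c by (intro tendsto_intros) auto
  then show ?thesis using c ps sets by (simp add: A)
qed

text \<open>By Fubini the integral of the smoothed function is the integral of \<open>f\<close> against the smoothed measure,
whose density converges at each point and is bounded.\<close>

lemma char_imp_smoothed_convergence:
  fixes \<mu>s :: "nat \<Rightarrow> 'a::euclidean_space measure" and f :: "'a \<Rightarrow> real"
  assumes ps: "\<And>n. prob_space (\<mu>s n)" "prob_space \<mu>"
    and sets: "\<And>n. sets (\<mu>s n) = sets borel" "sets \<mu> = sets borel"
    and conv: "\<And>t. (\<lambda>n. CLINT y|\<mu>s n. iexp (t \<bullet> y)) \<longlonglongrightarrow> (CLINT y|\<mu>. iexp (t \<bullet> y))"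
    and f: "integrable lborel f" and \<sigma>: "0 < \<sigma>"
  shows "(\<lambda>n. \<integral>y. (\<integral>u. f (y + \<sigma> *\<^sub>R u) \<partial>gauss_measure) \<partial>\<mu>s n)
    \<longlonglongrightarrow> (\<integral>y. (\<integral>u. f (y + \<sigma> *\<^sub>R u) \<partial>gauss_measure) \<partial>\<mu>)"
proof -
  define c where "c = sqrt (2 * pi) ^ DIM('a)"
  have c: "0 < c" unfolding c_def by simp
  have fm [measurable]: "f \<in> borel_measurable borel" using f by (auto dest: borel_measurable_integrable)
  have eq: "(\<integral>y. (\<integral>u. f (y + \<sigma> *\<^sub>R u) \<partial>gauss_measure) \<partial>\<nu>)
      = (\<integral>v. f v * (\<integral>y. gauss_kernel ((1 / \<sigma>) *\<^sub>R (v - y)) \<partial>\<nu>) \<partial>lborel) / \<sigma> ^ DIM('a)"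
    if \<nu>: "prob_space \<nu>" "sets \<nu> = sets borel" for \<nu>
  proof -
    interpret n: prob_space \<nu> by fact
    interpret pair_sigma_finite \<nu> "lborel :: 'a measure" ..
    note [measurable_cong] = \<nu>(2)
    have fk: "integrable lborel (\<lambda>v. f v * gauss_kernel ((1 / \<sigma>) *\<^sub>R (v - y)))" for y
    proof (rule Bochner_Integration.integrable_bound)
      show "integrable lborel (\<lambda>v. (1 / c) * f v)" using f by simp
      show "AE v in lborel. norm (f v * gauss_kernel ((1 / \<sigma>) *\<^sub>R (v - y))) \<le> norm ((1 / c) * f v)"
      proof (rule AE_I2)
        fix v
        show "norm (f v * gauss_kernel ((1 / \<sigma>) *\<^sub>R (v - y))) \<le> norm ((1 / c) * f v)"
          using mult_left_mono[OF gauss_kernel_le abs_ge_zero, of "f v" "(1 / \<sigma>) *\<^sub>R (v - y)"] c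
          by (simp add: c_def abs_mult less_imp_le[OF gauss_kernel_pos])
      qed
    qed simp
    have int: "integrable (\<nu> \<Otimes>\<^sub>M lborel) (\<lambda>(y, v). f v * gauss_kernel ((1 / \<sigma>) *\<^sub>R (v - y)))"
    proof (rule Fubini_integrable)
      show "integrable \<nu> (\<lambda>y. \<integral>v. norm (case (y, v) of (y, v) \<Rightarrow> f v * gauss_kernel ((1 / \<sigma>) *\<^sub>R (v - y))) \<partial>lborel)"
      proof (rule n.integrable_const_bound[where B = "(1 / c) * (\<integral>v. norm (f v) \<partial>lborel)"])
        show "AE y in \<nu>. norm (\<integral>v. norm (case (y, v) of (y, v) \<Rightarrow> f v * gauss_kernel ((1 / \<sigma>) *\<^sub>R (v - y))) \<partial>lborel)
            \<le> (1 / c) * (\<integral>v. norm (f v) \<partial>lborel)"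
        proof (rule AE_I2)
          fix y
          have "(\<integral>v. norm (f v * gauss_kernel ((1 / \<sigma>) *\<^sub>R (v - y))) \<partial>lborel) \<le> (\<integral>v. (1 / c) * norm (f v) \<partial>lborel)"
          proof (rule integral_mono)
            fix v
            show "norm (f v * gauss_kernel ((1 / \<sigma>) *\<^sub>R (v - y))) \<le> (1 / c) * norm (f v)"
              using mult_left_mono[OF gauss_kernel_le abs_ge_zero, of "f v" "(1 / \<sigma>) *\<^sub>R (v - y)"]
              by (simp add: c_def abs_mult less_imp_le[OF gauss_kernel_pos])
          qed (use f fk in auto)
          then show "norm (\<integral>v. norm (case (y, v) of (y, v) \<Rightarrow> f v * gauss_kernel ((1 / \<sigma>) *\<^sub>R (v - y))) \<partial>lborel)
            \<le> (1 / c) * (\<integral>v. norm (f v) \<partial>lborel)" by simp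
        qed
      qed measurable
      show "AE y in \<nu>. integrable lborel (\<lambda>v. case (y, v) of (y, v) \<Rightarrow> f v * gauss_kernel ((1 / \<sigma>) *\<^sub>R (v - y)))"
        using fk by simp
    qed measurable
    have "\<sigma> ^ DIM('a) * (\<integral>y. (\<integral>u. f (y + \<sigma> *\<^sub>R u) \<partial>gauss_measure) \<partial>\<nu>)
        = (\<integral>y. (\<integral>v. f v * gauss_kernel ((1 / \<sigma>) *\<^sub>R (v - y)) \<partial>lborel) \<partial>\<nu>)"
      by (simp add: gauss_translate[OF fm \<sigma>])
    also have "\<dots> = (\<integral>v. (\<integral>y. f v * gauss_kernel ((1 / \<sigma>) *\<^sub>R (v - y)) \<partial>\<nu>) \<partial>lborel)"
      by (rule Fubini_integral[symmetric, OF int])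
    also have "\<dots> = (\<integral>v. f v * (\<integral>y. gauss_kernel ((1 / \<sigma>) *\<^sub>R (v - y)) \<partial>\<nu>) \<partial>lborel)" by simp
    finally show ?thesis using \<sigma> by (simp add: field_simps)
  qed
  have meas: "(\<lambda>v. f v * (\<integral>y. gauss_kernel ((1 / \<sigma>) *\<^sub>R (v - y)) \<partial>\<nu>)) \<in> borel_measurable lborel"
    if \<nu>: "prob_space \<nu>" "sets \<nu> = sets borel" for \<nu>
  proof -
    interpret n: prob_space \<nu> by fact
    note [measurable_cong] = \<nu>(2)
    show ?thesis by measurable
  qed
  have "(\<lambda>n. \<integral>v. f v * (\<integral>y. gauss_kernel ((1 / \<sigma>) *\<^sub>R (v - y)) \<partial>\<mu>s n) \<partial>lborel)
      \<longlonglongrightarrow> (\<integral>v. f v * (\<integral>y. gauss_kernel ((1 / \<sigma>) *\<^sub>R (v - y)) \<partial>\<mu>) \<partial>lborel)"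
  proof (rule integral_dominated_convergence[where w = "\<lambda>v. norm (f v) * (1 / c)"])
    show "AE v in lborel. (\<lambda>n. f v * (\<integral>y. gauss_kernel ((1 / \<sigma>) *\<^sub>R (v - y)) \<partial>\<mu>s n))
        \<longlonglongrightarrow> f v * (\<integral>y. gauss_kernel ((1 / \<sigma>) *\<^sub>R (v - y)) \<partial>\<mu>)"
      by (intro AE_I2 tendsto_mult tendsto_const char_imp_kernel_convergence ps sets conv)
    show "AE v in lborel. norm (f v * (\<integral>y. gauss_kernel ((1 / \<sigma>) *\<^sub>R (v - y)) \<partial>\<mu>s n)) \<le> norm (f v) * (1 / c)" for n
    proof (rule AE_I2)
      fix v
      interpret n: prob_space "\<mu>s n" by (rule ps)
      note [measurable_cong] = sets(1)[of n]
      have int: "integrable (\<mu>s n) (\<lambda>y. gauss_kernel ((1 / \<sigma>) *\<^sub>R (v - y)))"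
        using gauss_kernel_le[where 'a = 'a]
        by (intro n.integrable_const_bound[where B = "1 / c"] AE_I2) (auto simp: c_def less_imp_le[OF gauss_kernel_pos])
      have "\<bar>\<integral>y. gauss_kernel ((1 / \<sigma>) *\<^sub>R (v - y)) \<partial>\<mu>s n\<bar> = (\<integral>y. gauss_kernel ((1 / \<sigma>) *\<^sub>R (v - y)) \<partial>\<mu>s n)"
        by (intro abs_of_nonneg integral_nonneg_AE AE_I2 less_imp_le[OF gauss_kernel_pos])
      also have "\<dots> \<le> 1 / c"
        using gauss_kernel_le[where 'a = 'a] by (intro n.integral_le_const[OF int] AE_I2) (simp add: c_def)
      finally show "norm (f v * (\<integral>y. gauss_kernel ((1 / \<sigma>) *\<^sub>R (v - y)) \<partial>\<mu>s n)) \<le> norm (f v) * (1 / c)"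
        unfolding norm_mult by (intro mult_left_mono) auto
    qed
  qed (use f in \<open>auto intro!: meas[simplified] ps sets\<close>)
  then show ?thesis
    using \<sigma> ps sets by (auto simp: eq intro!: tendsto_divide)
qed

lemma gauss_smoothing_uniform:
  fixes f :: "'a::euclidean_space \<Rightarrow> real"
  assumes uc: "uniformly_continuous_on UNIV f" and B: "\<And>x. \<bar>f x\<bar> \<le> B" and e: "0 < e"
  obtains \<sigma> where "0 < \<sigma>" "\<And>y. \<bar>(\<integral>u. f (y + \<sigma> *\<^sub>R u) \<partial>gauss_measure) - f y\<bar> \<le> e"
proof -
  interpret g: prob_space "gauss_measure :: 'a measure" by (rule prob_space_gauss)
  have cont: "continuous_on UNIV f" using uc by (rule uniformly_continuous_imp_continuous)
  then have fm [measurable]: "f \<in> borel_measurable borel" by (rule borel_measurable_continuous_onI)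
  obtain d where d: "0 < d" "\<And>x y. dist y x < d \<Longrightarrow> dist (f y) (f x) < e / 2"
    using uc e unfolding uniformly_continuous_on_def by (metis UNIV_I half_gt_zero)
  have B0: "0 \<le> B" using B[of 0] by simp
  have "(\<lambda>n::nat. g.prob {u. real n < norm u}) \<longlonglongrightarrow> g.prob (\<Inter>n::nat. {u. real n < norm u})"
    by (intro g.finite_Lim_measure_decseq) (auto simp: decseq_def)
  moreover have "(\<Inter>n::nat. {u::'a. real n < norm u}) = {}"
  proof -
    have "\<exists>n::nat. \<not> real n < norm u" for u :: 'a using real_arch_simple[of "norm u"] by (simp add: not_less)
    then show ?thesis by blast
  qed
  ultimately have "(\<lambda>n::nat. g.prob {u. real n < norm u}) \<longlonglongrightarrow> 0" by simp
  then have "\<forall>\<^sub>F n in sequentially. g.prob {u. real n < norm u} < e / (4 * B + 4)"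
    using e B0 by (intro order_tendstoD(2)[of _ 0]) auto
  then obtain n :: nat where n: "g.prob {u. real n < norm u} < e / (4 * B + 4)"
    by (auto simp: eventually_sequentially)
  define \<sigma> where "\<sigma> = d / (n + 1)"
  have \<sigma>: "0 < \<sigma>" using d unfolding \<sigma>_def by simp
  have "\<bar>(\<integral>u. f (y + \<sigma> *\<^sub>R u) \<partial>gauss_measure) - f y\<bar> \<le> e" for y
  proof -
    have int: "integrable gauss_measure (\<lambda>u. f (y + \<sigma> *\<^sub>R u))"
      using B by (intro g.integrable_const_bound[where B = B]) auto
    have "\<bar>f (y + \<sigma> *\<^sub>R u) - f y\<bar> \<le> e / 2 + 2 * B * indicator {u. real n < norm u} u" for u
    proof (cases "real n < norm u")
      case True then show ?thesis using B[of "y + \<sigma> *\<^sub>R u"] B[of y] e by (simp add: abs_le_iff)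
    next
      case False
      have "dist (y + \<sigma> *\<^sub>R u) y = \<sigma> * norm u" using \<sigma> by (simp add: dist_norm)
      also have "\<dots> \<le> \<sigma> * n" using False \<sigma> by (intro mult_left_mono) auto
      also have "\<dots> < d" unfolding \<sigma>_def using d by (simp add: field_simps)
      finally show ?thesis using d(2) False by (fastforce simp: dist_real_def)
    qed
    note bound = this
    have ind: "integrable gauss_measure (indicator {u. real n < norm u} :: 'a \<Rightarrow> real)"
      by (rule g.integrable_const_bound[where B = 1]) auto
    have "(\<integral>u. \<bar>f (y + \<sigma> *\<^sub>R u) - f y\<bar> \<partial>gauss_measure)
        \<le> (\<integral>u. e / 2 + 2 * B * indicator {u. real n < norm u} u \<partial>(gauss_measure :: 'a measure))"
    proof (rule integral_mono)
      show "\<bar>f (y + \<sigma> *\<^sub>R u) - f y\<bar> \<le> e / 2 + 2 * B * indicator {u. real n < norm u} u" for u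
        by (rule bound)
    qed (use int ind in auto)
    also have "\<dots> = e / 2 + 2 * B * g.prob {u. real n < norm u}"
      using ind by (simp add: g.prob_space)
    also have "\<dots> \<le> e / 2 + 2 * B * (e / (4 * B + 4))"
      using n B0 by (intro add_left_mono mult_left_mono) auto
    also have "\<dots> \<le> e" using B0 e by (simp add: field_simps)
    finally have "(\<integral>u. \<bar>f (y + \<sigma> *\<^sub>R u) - f y\<bar> \<partial>gauss_measure) \<le> e" .
    moreover have "\<bar>(\<integral>u. f (y + \<sigma> *\<^sub>R u) \<partial>gauss_measure) - f y\<bar> = \<bar>\<integral>u. f (y + \<sigma> *\<^sub>R u) - f y \<partial>gauss_measure\<bar>"
      using int by (subst Bochner_Integration.integral_diff) (auto simp: g.prob_space)
    ultimately show ?thesis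
      using integral_abs_bound[of gauss_measure "\<lambda>u. f (y + \<sigma> *\<^sub>R u) - f y"] by linarith
  qed
  with \<sigma> show ?thesis by (rule that)
qed

text \<open>Continuous cutoff functions turn a bounded continuous function into a uniformly continuous integrable
one.\<close>

definition ball_cutoff :: "real \<Rightarrow> 'a::euclidean_space \<Rightarrow> real" where
  "ball_cutoff R x = max 0 (min 1 (R + 1 - norm x))"

lemma ball_cutoff_bounds: "0 \<le> ball_cutoff R x" "ball_cutoff R x \<le> 1"
  by (auto simp: ball_cutoff_def)

lemma ball_cutoff_abs: "\<bar>ball_cutoff R x\<bar> \<le> 1"
  by (auto simp: ball_cutoff_def)

lemma continuous_ball_cutoff: "continuous_on UNIV (ball_cutoff R)"
  unfolding ball_cutoff_def by (intro continuous_intros)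

lemma cutoff_uniformly_continuous:
  fixes f :: "'a::euclidean_space \<Rightarrow> real"
  assumes cont: "continuous_on UNIV f" and R: "0 \<le> R"
  shows "uniformly_continuous_on UNIV (\<lambda>x. f x * ball_cutoff R x)"
proof -
  let ?g = "\<lambda>x. f x * ball_cutoff R x"
  have "continuous_on (cball 0 (R + 2)) ?g"
    by (intro continuous_on_mult continuous_on_subset[OF cont] continuous_on_subset[OF continuous_ball_cutoff]) auto
  then have uc: "uniformly_continuous_on (cball 0 (R + 2)) ?g"
    by (intro compact_uniformly_continuous) auto
  show ?thesis
    unfolding uniformly_continuous_on_def
  proof (intro allI impI)
    fix e :: real assume "0 < e"
    then obtain d where d: "0 < d"
      "\<And>x y. x \<in> cball 0 (R + 2) \<Longrightarrow> y \<in> cball 0 (R + 2) \<Longrightarrow> dist y x < d \<Longrightarrow> dist (?g y) (?g x) < e"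
      using uc unfolding uniformly_continuous_on_def by metis
    have "dist (?g y) (?g x) < e" if "dist y x < min d 1" for x y
    proof (cases "norm x \<le> R + 2 \<and> norm y \<le> R + 2")
      case True then show ?thesis using d(2)[of x y] that by simp
    next
      case False
      have "\<bar>norm y - norm x\<bar> < 1"
        using that norm_triangle_ineq3[of y x] by (simp add: dist_norm)
      then have "R + 1 \<le> norm x" "R + 1 \<le> norm y" using False by auto
      then show ?thesis using \<open>0 < e\<close> by (simp add: ball_cutoff_def)
    qed
    then show "\<exists>d>0. \<forall>x\<in>UNIV. \<forall>y\<in>UNIV. dist y x < d \<longrightarrow> dist (?g y) (?g x) < e"
      using d(1) by (intro exI[of _ "min d 1"]) auto
  qed
qed

lemma cutoff_integrable_lborel:
  fixes f :: "'a::euclidean_space \<Rightarrow> real"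
  assumes cont: "continuous_on UNIV f" and B: "\<And>x. \<bar>f x\<bar> \<le> B"
  shows "integrable lborel (\<lambda>x. f x * ball_cutoff R x)"
proof (rule Bochner_Integration.integrable_bound)
  show "integrable lborel (\<lambda>x::'a. B * indicator (cball 0 (R + 1)) x :: real)"
    by (intro Bochner_Integration.integrable_mult_right integrable_real_indicator)
      (use emeasure_lborel_cball_finite in auto)
  show "(\<lambda>x. f x * ball_cutoff R x) \<in> borel_measurable lborel"
    using borel_measurable_continuous_onI[OF continuous_on_mult[OF cont continuous_ball_cutoff]] by simp
  show "AE x in lborel. norm (f x * ball_cutoff R x) \<le> norm (B * indicator (cball 0 (R + 1)) x :: real)"
  proof (rule AE_I2)
    fix x :: 'a
    have "\<bar>f x\<bar> * \<bar>ball_cutoff R x\<bar> \<le> B * 1"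
      using B[of x] ball_cutoff_bounds[of R x] by (intro mult_mono) auto
    then show "norm (f x * ball_cutoff R x) \<le> norm (B * indicator (cball 0 (R + 1)) x :: real)"
      by (cases "norm x \<le> R + 1") (auto simp: abs_mult ball_cutoff_def)
  qed
qed

text \<open>For functions with compact support, smoothing changes the integrals uniformly little, so the smoothed
statement suffices. As the integrals of the cutoff functions converge too and the limit is a
probability measure, little mass lies outside a large ball; this settles bounded continuous functions.\<close>

theorem weak_convergence_from_characteristic_functions:
  fixes \<mu>s :: "nat \<Rightarrow> 'a::euclidean_space measure"
  assumes ps: "\<And>n. prob_space (\<mu>s n)" "prob_space \<mu>"
    and sets: "\<And>n. sets (\<mu>s n) = sets borel" "sets \<mu> = sets borel"
    and conv: "\<And>t. (\<lambda>n. CLINT y|\<mu>s n. iexp (t \<bullet> y)) \<longlonglongrightarrow> (CLINT y|\<mu>. iexp (t \<bullet> y))"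
  shows "weak_conv_vec \<mu>s \<mu>"
proof -
  have int: "integrable \<nu> f" if "prob_space \<nu>" "sets \<nu> = sets borel" "continuous_on UNIV f" "\<And>x. \<bar>f x\<bar> \<le> B"
    for \<nu> and f :: "'a \<Rightarrow> real" and B
  proof -
    interpret prob_space \<nu> by fact
    show ?thesis using that borel_measurable_continuous_onI[OF that(3)]
      by (intro integrable_const_bound[where B = B]) (auto cong: measurable_cong_sets)
  qed
  have cut: "(\<lambda>n. \<integral>x. f x * ball_cutoff R x \<partial>\<mu>s n) \<longlonglongrightarrow> (\<integral>x. f x * ball_cutoff R x \<partial>\<mu>)"
    if cont: "continuous_on UNIV f" and B: "\<And>x. \<bar>f x\<bar> \<le> B" and R: "0 \<le> R" for f :: "'a \<Rightarrow> real" and B R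
  proof (rule LIMSEQ_I)
    fix e :: real assume e: "0 < e"
    let ?g = "\<lambda>x. f x * ball_cutoff R x"
    have gB: "\<bar>?g x\<bar> \<le> B" for x
      using mult_mono[OF B[of x] ball_cutoff_bounds(2)[of R x]] ball_cutoff_bounds(1)[of R x] order_trans[OF abs_ge_zero B[of x]]
      by (simp add: abs_mult)
    have gc: "continuous_on UNIV ?g" by (intro continuous_on_mult cont continuous_ball_cutoff)
    obtain \<sigma> where \<sigma>: "0 < \<sigma>" "\<And>y. \<bar>(\<integral>u. ?g (y + \<sigma> *\<^sub>R u) \<partial>gauss_measure) - ?g y\<bar> \<le> e / 3"
      using gauss_smoothing_uniform[OF cutoff_uniformly_continuous[OF cont R] gB, of "e / 3"] e by auto
    define T where "T y = (\<integral>u. ?g (y + \<sigma> *\<^sub>R u) \<partial>gauss_measure)" for y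
    have Tg: "\<bar>(\<integral>y. T y \<partial>\<nu>) - (\<integral>y. ?g y \<partial>\<nu>)\<bar> \<le> e / 3"
      if \<nu>: "prob_space \<nu>" "sets \<nu> = sets borel" for \<nu>
    proof -
      interpret n: prob_space \<nu> by fact
      interpret g: prob_space "gauss_measure :: 'a measure" by (rule prob_space_gauss)
      note [measurable_cong] = \<nu>(2)
      have [measurable]: "?g \<in> borel_measurable borel" by (rule borel_measurable_continuous_onI[OF gc])
      have gi: "integrable \<nu> ?g" using \<nu> gc gB by (rule int)
      have [measurable]: "T \<in> borel_measurable borel" unfolding T_def
        by (rule g.borel_measurable_lebesgue_integral) measurable
      have Ti: "integrable \<nu> T"
      proof (rule n.integrable_const_bound[where B = "B + e / 3"])
        show "AE y in \<nu>. norm (T y) \<le> B + e / 3"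
        proof (rule AE_I2)
          fix y
          show "norm (T y) \<le> B + e / 3"
            using \<sigma>(2)[of y] gB[of y] unfolding T_def[symmetric] real_norm_def by linarith
        qed
      qed measurable
      have "\<bar>(\<integral>y. T y \<partial>\<nu>) - (\<integral>y. ?g y \<partial>\<nu>)\<bar> = \<bar>\<integral>y. T y - ?g y \<partial>\<nu>\<bar>" using Ti gi by simp
      also have "\<dots> \<le> (\<integral>y. \<bar>T y - ?g y\<bar> \<partial>\<nu>)" by (rule integral_abs_bound)
      also have "\<dots> \<le> e / 3" using \<sigma>(2) Ti gi unfolding T_def[symmetric]
        by (intro n.integral_le_const) auto
      finally show ?thesis .
    qed
    have "(\<lambda>n. \<integral>y. T y \<partial>\<mu>s n) \<longlonglongrightarrow> (\<integral>y. T y \<partial>\<mu>)"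
      unfolding T_def
      by (rule char_imp_smoothed_convergence[OF ps sets conv cutoff_integrable_lborel[OF cont B] \<sigma>(1)])
    from tendstoD[OF this, of "e / 3"] obtain N
      where N: "\<And>n. N \<le> n \<Longrightarrow> \<bar>(\<integral>y. T y \<partial>\<mu>s n) - (\<integral>y. T y \<partial>\<mu>)\<bar> < e / 3"
      using e by (auto simp: eventually_sequentially dist_real_def)
    have "norm ((\<integral>x. ?g x \<partial>\<mu>s n) - (\<integral>x. ?g x \<partial>\<mu>)) < e" if "N \<le> n" for n
      using Tg[OF ps(1) sets(1), of n] Tg[OF ps(2) sets(2)] N[OF that] unfolding real_norm_def by linarith
    then show "\<exists>N. \<forall>n\<ge>N. norm ((\<integral>x. ?g x \<partial>\<mu>s n) - (\<integral>x. ?g x \<partial>\<mu>)) < e" by blast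
  qed
  show ?thesis
    unfolding weak_conv_vec_def
  proof (intro allI impI)
    fix f :: "'a \<Rightarrow> real" assume f: "continuous_on UNIV f \<and> bounded (range f)"
    then obtain B where B: "\<And>x. \<bar>f x\<bar> \<le> B" unfolding bounded_iff by auto
    have B0: "0 \<le> B" using B[of 0] by simp
    have cont: "continuous_on UNIV f" using f by simp
    have one: "continuous_on UNIV (\<lambda>x::'a. 1 :: real)" by simp
    have tail: "\<bar>(\<integral>x. f x \<partial>\<nu>) - (\<integral>x. f x * ball_cutoff R x \<partial>\<nu>)\<bar> \<le> B * (1 - (\<integral>x. 1 * ball_cutoff R x \<partial>\<nu>))"
      if \<nu>: "prob_space \<nu>" "sets \<nu> = sets borel" for \<nu> R
    proof -
      interpret n: prob_space \<nu> by fact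
      have i1: "integrable \<nu> f" using \<nu> cont B by (rule int)
      have i2: "integrable \<nu> (ball_cutoff R)"
        using \<nu> continuous_ball_cutoff by (rule int[where B = 1]) (rule ball_cutoff_abs)
      have i3: "integrable \<nu> (\<lambda>x. f x * ball_cutoff R x)"
        using \<nu> continuous_on_mult[OF cont continuous_ball_cutoff]
      proof (rule int[where B = B])
        fix x show "\<bar>f x * ball_cutoff R x\<bar> \<le> B"
          using mult_mono[OF B[of x] ball_cutoff_bounds(2)[of R x]] ball_cutoff_bounds(1)[of R x] B0
          by (simp add: abs_mult)
      qed
      have "\<bar>(\<integral>x. f x \<partial>\<nu>) - (\<integral>x. f x * ball_cutoff R x \<partial>\<nu>)\<bar> = \<bar>\<integral>x. f x - f x * ball_cutoff R x \<partial>\<nu>\<bar>"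
        using i1 i3 by simp
      also have "\<dots> \<le> (\<integral>x. \<bar>f x - f x * ball_cutoff R x\<bar> \<partial>\<nu>)" by (rule integral_abs_bound)
      also have "\<dots> \<le> (\<integral>x. B * (1 - ball_cutoff R x) \<partial>\<nu>)"
      proof (intro integral_mono)
        fix x
        have "f x - f x * ball_cutoff R x = f x * (1 - ball_cutoff R x)" by (simp add: algebra_simps)
        then show "\<bar>f x - f x * ball_cutoff R x\<bar> \<le> B * (1 - ball_cutoff R x)"
          using mult_right_mono[OF B[of x], of "1 - ball_cutoff R x"] ball_cutoff_bounds(2)[of R x]
          by (simp add: abs_mult)
      qed (use i1 i2 i3 in auto)
      also have "\<dots> = B * (1 - (\<integral>x. 1 * ball_cutoff R x \<partial>\<nu>))" using i2 by (simp add: n.prob_space)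
      finally show ?thesis .
    qed
    show "(\<lambda>n. \<integral>x. f x \<partial>\<mu>s n) \<longlonglongrightarrow> (\<integral>x. f x \<partial>\<mu>)"
    proof (rule LIMSEQ_I)
      fix e :: real assume e: "0 < e"
      interpret m: prob_space \<mu> by (rule ps)
      define d where "d = e / (4 * (B + 1))"
      have d: "0 < d" "B * d \<le> e / 4" using e B0 by (simp_all add: d_def field_simps)
      have "(\<lambda>k::nat. \<integral>x. ball_cutoff (real k) x \<partial>\<mu>) \<longlonglongrightarrow> (\<integral>x. 1 \<partial>\<mu>)"
      proof (rule integral_dominated_convergence[where w = "\<lambda>_. 1"])
        show "AE x in \<mu>. (\<lambda>k. ball_cutoff (real k) x) \<longlonglongrightarrow> 1"
        proof (rule AE_I2)
          fix x :: 'a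
          obtain K :: nat where "norm x \<le> K" using real_arch_simple by blast
          then have "\<forall>\<^sub>F k in sequentially. ball_cutoff (real k) x = 1"
            unfolding eventually_sequentially by (intro exI[of _ K]) (auto simp: ball_cutoff_def)
          then show "(\<lambda>k. ball_cutoff (real k) x) \<longlonglongrightarrow> 1" by (rule tendsto_eventually)
        qed
        show "AE x in \<mu>. norm (ball_cutoff (real k) x) \<le> 1" for k
          by (intro AE_I2) (simp add: ball_cutoff_abs)
        show "ball_cutoff (real k) \<in> borel_measurable \<mu>" for k
          using borel_measurable_continuous_onI[OF continuous_ball_cutoff] sets(2) by (simp cong: measurable_cong_sets)
      qed auto
      then have "\<forall>\<^sub>F k in sequentially. 1 - d < (\<integral>x. ball_cutoff (real k) x \<partial>\<mu>)"
        using d by (intro order_tendstoD(1)) (auto simp: m.prob_space)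
      then obtain k :: nat where k: "1 - d < (\<integral>x. ball_cutoff (real k) x \<partial>\<mu>)"
        by (auto simp: eventually_sequentially)
      have "\<forall>\<^sub>F n in sequentially. 1 - d < (\<integral>x. 1 * ball_cutoff (real k) x \<partial>\<mu>s n)"
        using cut[OF one, of 1 "real k"] k by (intro order_tendstoD(1)) auto
      moreover have "\<forall>\<^sub>F n in sequentially. \<bar>(\<integral>x. f x * ball_cutoff (real k) x \<partial>\<mu>s n) - (\<integral>x. f x * ball_cutoff (real k) x \<partial>\<mu>)\<bar> < e / 4"
        using tendstoD[OF cut[OF cont B, of "real k"], of "e / 4"] e by (simp add: dist_real_def)
      ultimately have "\<forall>\<^sub>F n in sequentially. norm ((\<integral>x. f x \<partial>\<mu>s n) - (\<integral>x. f x \<partial>\<mu>)) < e"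
      proof eventually_elim
        case (elim n)
        have "B * (1 - (\<integral>x. 1 * ball_cutoff (real k) x \<partial>\<mu>s n)) \<le> B * d"
          using elim(1) B0 by (intro mult_left_mono) auto
        moreover have "B * (1 - (\<integral>x. 1 * ball_cutoff (real k) x \<partial>\<mu>)) \<le> B * d"
          using k B0 by (intro mult_left_mono) auto
        ultimately show ?case
          using tail[OF ps(1) sets(1), of n "real k"] tail[OF ps(2) sets(2), of "real k"] elim(2) d(2) e
          unfolding real_norm_def by linarith
      qed
      then show "\<exists>N. \<forall>n\<ge>N. norm ((\<integral>x. f x \<partial>\<mu>s n) - (\<integral>x. f x \<partial>\<mu>)) < e"
        by (simp add: eventually_sequentially)
    qed
  qed
qed

section \<open>The population criterion\<close>

lemma powr_le_one_add_powr:
  fixes t :: real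
  assumes "0 \<le> t" "0 < \<alpha>" "\<alpha> \<le> \<beta>"
  shows "t powr \<alpha> \<le> 1 + t powr \<beta>"
proof (cases "t \<le> 1")
  case True
  then have "t powr \<alpha> \<le> 1 powr \<alpha>" using assms by (intro powr_mono2) auto
  then show ?thesis by (simp add: add_increasing2)
next
  case False
  then have "t powr \<alpha> \<le> t powr \<beta>" using assms by (intro powr_mono) auto
  then show ?thesis by simp
qed

lemma integrable_powr_mono:
  assumes "finite_measure M" and [measurable]: "f \<in> borel_measurable M" and nn: "\<And>x. 0 \<le> f x"
    and \<alpha>: "0 < \<alpha>" "\<alpha> \<le> \<beta>" and int: "integrable M (\<lambda>x. f x powr \<beta> :: real)"
  shows "integrable M (\<lambda>x. f x powr \<alpha>)"
proof (rule Bochner_Integration.integrable_bound)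
  interpret finite_measure M by fact
  show "integrable M (\<lambda>x. 1 + f x powr \<beta>)" using int by simp
  show "AE x in M. norm (f x powr \<alpha>) \<le> norm (1 + f x powr \<beta>)"
    using powr_le_one_add_powr[OF nn \<alpha>] by (intro AE_I2) simp
qed measurable

lemma sets_law_of [simp, measurable_cong]: "sets (law_of f) = sets borel"
  by (simp add: law_of_def)

lemma space_law_of [simp]: "space (law_of f) = UNIV"
  by (simp add: law_of_def)

context
  fixes f :: "'a::euclidean_space \<Rightarrow> real"
  assumes f: "prob_density f"
begin

lemma prob_density_measurable [measurable]: "f \<in> borel_measurable borel"
  and prob_density_nonneg: "0 \<le> f x"
  and prob_space_law_of: "prob_space (law_of f)"
  using f by (auto simp: prob_density_def)

lemma integrable_law_of:
  "g \<in> borel_measurable borel \<Longrightarrow> integrable (law_of f) g \<longleftrightarrow> integrable lborel (\<lambda>x. f x * g x)"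
  unfolding law_of_def using prob_density_nonneg by (subst integrable_density) auto

lemma integral_law_of:
  "g \<in> borel_measurable borel \<Longrightarrow> (\<integral>x. g x \<partial>law_of f) = (\<integral>x. f x * g x \<partial>lborel)"
  unfolding law_of_def using prob_density_nonneg by (subst integral_density) auto

lemma prob_density_times_powr: "f x * f x powr \<alpha> = f x powr (1 + \<alpha>)"
  using prob_density_nonneg[of x] by (cases "f x = 0") (auto simp: powr_add)

lemma prob_density_power_integral_pos:
  assumes int: "integrable lborel (\<lambda>x. f x powr (1 + \<alpha>))"
  shows "0 < (\<integral>x. f x powr (1 + \<alpha>) \<partial>lborel)"
proof -
  have "(\<integral>x. f x powr (1 + \<alpha>) \<partial>lborel) \<noteq> 0"
  proof
    assume "(\<integral>x. f x powr (1 + \<alpha>) \<partial>lborel) = 0"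
    then have "AE x in lborel. f x powr (1 + \<alpha>) = 0"
      using int by (subst integral_nonneg_eq_0_iff_AE[symmetric]) auto
    then have "AE x in lborel. ennreal (f x) = 0" by eventually_elim auto
    then have "(\<integral>\<^sup>+x. ennreal (f x) \<partial>lborel) = 0" by (subst nn_integral_0_iff_AE) auto
    then have "emeasure (law_of f) (space (law_of f)) = 0"
      by (simp add: law_of_def emeasure_density)
    then show False using prob_space.emeasure_space_1[OF prob_space_law_of] by simp
  qed
  moreover have "0 \<le> (\<integral>x. f x powr (1 + \<alpha>) \<partial>lborel)" by (intro integral_nonneg_AE) simp
  ultimately show ?thesis by linarith
qed

end

text \<open>Hoelder's inequality for the exponents \<open>(1 + \<alpha>) / \<alpha>\<close> and \<open>1 + \<alpha>\<close>, obtained from the weighted inequality of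
arithmetic and geometric means for the normalized powers.\<close>

lemma cross_power_mean_le:
  fixes f f0 :: "'a::euclidean_space \<Rightarrow> real"
  assumes \<alpha>: "0 < \<alpha>" and f: "prob_density f" and f0: "prob_density f0"
    and int: "integrable lborel (\<lambda>x. f x powr (1 + \<alpha>))" "integrable lborel (\<lambda>x. f0 x powr (1 + \<alpha>))"
  shows "integrable (law_of f0) (\<lambda>x. f x powr \<alpha>)"
    and "(\<integral>x. f x powr \<alpha> \<partial>law_of f0)
      \<le> (\<integral>x. f x powr (1 + \<alpha>) \<partial>lborel) powr (\<alpha> / (1 + \<alpha>)) * (\<integral>x. f0 x powr (1 + \<alpha>) \<partial>lborel) powr (1 / (1 + \<alpha>))"
proof -
  note [measurable] = prob_density_measurable[OF f] prob_density_measurable[OF f0]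
  define I where "I = (\<integral>x. f x powr (1 + \<alpha>) \<partial>lborel)"
  define J where "J = (\<integral>x. f0 x powr (1 + \<alpha>) \<partial>lborel)"
  have I: "0 < I" and J: "0 < J"
    unfolding I_def J_def using prob_density_power_integral_pos[OF f] prob_density_power_integral_pos[OF f0] int by auto
  define c where "c = I powr (\<alpha> / (1 + \<alpha>)) * J powr (1 / (1 + \<alpha>))"
  have c: "0 < c" unfolding c_def using I J by simp
  define w where "w x = \<alpha> / (1 + \<alpha>) * (f x powr (1 + \<alpha>) / I) + 1 / (1 + \<alpha>) * (f0 x powr (1 + \<alpha>) / J)" for x
  have young: "f0 x * f x powr \<alpha> \<le> c * w x" for x
  proof (cases "f x = 0 \<or> f0 x = 0")
    case True
    then show ?thesis using I J c \<alpha> unfolding w_def by (auto intro!: mult_nonneg_nonneg add_nonneg_nonneg)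
  next
    case False
    then have pos: "0 < f x" "0 < f0 x" using prob_density_nonneg[OF f, of x] prob_density_nonneg[OF f0, of x] by auto
    have "(f x powr (1 + \<alpha>) / I) powr (\<alpha> / (1 + \<alpha>)) * (f0 x powr (1 + \<alpha>) / J) powr (1 / (1 + \<alpha>)) \<le> w x"
      unfolding w_def using pos I J \<alpha> by (intro Youngs_inequality_0) (auto simp: field_simps)
    moreover have "(f x powr (1 + \<alpha>) / I) powr (\<alpha> / (1 + \<alpha>)) * (f0 x powr (1 + \<alpha>) / J) powr (1 / (1 + \<alpha>))
        = f x powr \<alpha> * f0 x / c"
      unfolding c_def using pos I J \<alpha> by (simp add: powr_divide powr_powr)
    ultimately show ?thesis using c by (simp add: field_simps)
  qed
  have wi: "integrable lborel w" unfolding w_def using int by simp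
  have ww: "(\<integral>x. w x \<partial>lborel) = 1"
  proof -
    have "(\<integral>x. w x \<partial>lborel) = \<alpha> / (1 + \<alpha>) * (I / I) + 1 / (1 + \<alpha>) * (J / J)"
      unfolding w_def I_def J_def using int by simp
    then show ?thesis using I J \<alpha> by (simp add: add_divide_distrib[symmetric])
  qed
  have fi: "integrable lborel (\<lambda>x. f0 x * f x powr \<alpha>)"
  proof (rule Bochner_Integration.integrable_bound)
    show "integrable lborel (\<lambda>x. c * w x)" using wi by simp
    show "AE x in lborel. norm (f0 x * f x powr \<alpha>) \<le> norm (c * w x)"
    proof (rule AE_I2)
      fix x
      show "norm (f0 x * f x powr \<alpha>) \<le> norm (c * w x)"
      proof -
        have "0 \<le> f0 x * f x powr \<alpha>" using prob_density_nonneg[OF f0, of x] by simp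
        then show ?thesis using young[of x] unfolding real_norm_def by linarith
      qed
    qed
  qed measurable
  then show "integrable (law_of f0) (\<lambda>x. f x powr \<alpha>)" by (simp add: integrable_law_of[OF f0])
  have "(\<integral>x. f x powr \<alpha> \<partial>law_of f0) = (\<integral>x. f0 x * f x powr \<alpha> \<partial>lborel)"
    by (simp add: integral_law_of[OF f0])
  also have "\<dots> \<le> (\<integral>x. c * w x \<partial>lborel)" using fi wi young by (intro integral_mono) auto
  also have "\<dots> = c" by (simp add: ww)
  finally show "(\<integral>x. f x powr \<alpha> \<partial>law_of f0)
      \<le> (\<integral>x. f x powr (1 + \<alpha>) \<partial>lborel) powr (\<alpha> / (1 + \<alpha>)) * (\<integral>x. f0 x powr (1 + \<alpha>) \<partial>lborel) powr (1 / (1 + \<alpha>))"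
    unfolding c_def I_def J_def .
qed

text \<open>The normalization of \<open>h\<close> cancels the first factor of the Hoelder bound, and what remains is the value at
\<open>\<theta>0\<close>.\<close>

theorem h_mean_maximal:
  fixes p :: "'t \<Rightarrow> 'a::euclidean_space \<Rightarrow> real"
  assumes \<alpha>: "0 < \<alpha>" and dens: "prob_density (p \<theta>)" "prob_density (p \<theta>0)"
    and int: "integrable (law_of (p \<theta>)) (\<lambda>x. p \<theta> x powr \<alpha>)" "integrable (law_of (p \<theta>0)) (\<lambda>x. p \<theta>0 x powr \<alpha>)"
  shows "integrable (law_of (p \<theta>0)) (\<lambda>x. h_fun \<alpha> p x \<theta>)"
    and "(\<integral>x. h_fun \<alpha> p x \<theta> \<partial>law_of (p \<theta>0)) \<le> (\<integral>x. h_fun \<alpha> p x \<theta>0 \<partial>law_of (p \<theta>0))"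
proof -
  note [measurable] = prob_density_measurable[OF dens(1)] prob_density_measurable[OF dens(2)]
  define I where "I = (\<integral>x. p \<theta> x powr (1 + \<alpha>) \<partial>lborel)"
  define J where "J = (\<integral>x. p \<theta>0 x powr (1 + \<alpha>) \<partial>lborel)"
  have ii: "integrable lborel (\<lambda>x. p \<theta> x powr (1 + \<alpha>))" "integrable lborel (\<lambda>x. p \<theta>0 x powr (1 + \<alpha>))"
    using int by (simp_all add: integrable_law_of[OF dens(1)] integrable_law_of[OF dens(2)]
        prob_density_times_powr[OF dens(1)] prob_density_times_powr[OF dens(2)])
  have I: "0 < I" and J: "0 < J"
    unfolding I_def J_def using prob_density_power_integral_pos[OF dens(1)] prob_density_power_integral_pos[OF dens(2)] ii by auto
  note cross = cross_power_mean_le[OF \<alpha> dens ii]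
  show "integrable (law_of (p \<theta>0)) (\<lambda>x. h_fun \<alpha> p x \<theta>)" unfolding h_fun_def using cross(1) by simp
  have C: "C_fun \<alpha> p \<theta> = I powr (\<alpha> / (1 + \<alpha>))" "C_fun \<alpha> p \<theta>0 = J powr (\<alpha> / (1 + \<alpha>))"
    by (simp_all add: C_fun_def I_def J_def)
  have "(\<integral>x. h_fun \<alpha> p x \<theta> \<partial>law_of (p \<theta>0)) = (\<integral>x. p \<theta> x powr \<alpha> \<partial>law_of (p \<theta>0)) / I powr (\<alpha> / (1 + \<alpha>))"
    unfolding h_fun_def C by simp
  also have "\<dots> \<le> J powr (1 / (1 + \<alpha>))"
    using cross(2) I unfolding I_def[symmetric] J_def[symmetric] by (simp add: pos_divide_le_eq mult.commute)
  also have "\<dots> = J / J powr (\<alpha> / (1 + \<alpha>))"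
  proof -
    have "J powr (1 / (1 + \<alpha>)) * J powr (\<alpha> / (1 + \<alpha>)) = J"
      using J \<alpha> by (simp add: powr_add[symmetric] add_divide_distrib[symmetric])
    then show ?thesis using J by (simp add: field_simps)
  qed
  also have "\<dots> = (\<integral>x. h_fun \<alpha> p x \<theta>0 \<partial>law_of (p \<theta>0))"
    unfolding h_fun_def C J_def by (simp add: integral_law_of[OF dens(2)] prob_density_times_powr[OF dens(2)])
  finally show "(\<integral>x. h_fun \<alpha> p x \<theta> \<partial>law_of (p \<theta>0)) \<le> (\<integral>x. h_fun \<alpha> p x \<theta>0 \<partial>law_of (p \<theta>0))" .
qed

text \<open>The necessary conditions at a maximum of a function of one variable, for an expansion with a cubic
remainder.\<close>

lemma second_order_necessary:
  fixes A B c d :: real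
  assumes d: "0 < d" and le: "\<And>t. \<bar>t\<bar> < d \<Longrightarrow> t * A + t\<^sup>2 / 2 * B - \<bar>t\<bar> ^ 3 * c \<le> 0"
  shows "A = 0" and "B \<le> 0"
proof -
  have ev: "\<forall>\<^sub>F t in at_right 0. 0 < t \<and> t < d"
    using d by (auto simp: eventually_at_right_field)
  have l: "((\<lambda>t. t\<^sup>2 * c - t / 2 * B) \<longlongrightarrow> 0\<^sup>2 * c - 0 / 2 * B) (at_right 0)" by (intro tendsto_intros) auto
  have "\<forall>\<^sub>F t in at_right 0. A \<le> t\<^sup>2 * c - t / 2 * B"
    using ev
  proof eventually_elim
    case (elim t)
    then have "t * (A + t / 2 * B - t\<^sup>2 * c) \<le> 0"
      using le[of t] by (simp add: power2_eq_square power3_eq_cube algebra_simps)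
    then show ?case using elim by (simp add: mult_le_0_iff)
  qed
  from tendsto_lowerbound[OF l this] have A1: "A \<le> 0" by simp
  have "\<forall>\<^sub>F t in at_right 0. - A \<le> t\<^sup>2 * c - t / 2 * B"
    using ev
  proof eventually_elim
    case (elim t)
    then have "t * (- A + t / 2 * B - t\<^sup>2 * c) \<le> 0"
      using le[of "- t"] by (simp add: power2_eq_square power3_eq_cube algebra_simps)
    then show ?case using elim by (simp add: mult_le_0_iff)
  qed
  from tendsto_lowerbound[OF l this] have A2: "- A \<le> 0" by simp
  show A: "A = 0" using A1 A2 by simp
  have l: "((\<lambda>t. 2 * t * c) \<longlongrightarrow> 2 * 0 * c) (at_right 0)" by (intro tendsto_intros)
  have "\<forall>\<^sub>F t in at_right 0. B \<le> 2 * t * c"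
    using ev
  proof eventually_elim
    case (elim t)
    then have "t\<^sup>2 * (B / 2 - t * c) \<le> 0"
      using le[of t] A by (simp add: power2_eq_square power3_eq_cube algebra_simps)
    then show ?case using elim by (simp add: mult_le_0_iff)
  qed
  from tendsto_lowerbound[OF l this] show "B \<le> 0" by simp
qed

lemma bounded_linear_quadratic_form: "bounded_linear (\<lambda>A :: real^'m^'m. v \<bullet> (A *v w))"
  by (intro linear_conv_bounded_linear[THEN iffD1] linearI)
    (simp_all add: matrix_vector_mult_add_rdistrib inner_add_right scaleR_matrix_vector_assoc[symmetric])

text \<open>The integrated Taylor expansion at \<open>\<theta>0\<close> has its maximum at \<open>\<theta>0\<close>. This yields the first and second order
conditions without differentiating under the integral sign.\<close>

theorem mean_jet_at_maximum:
  fixes h :: "'b \<Rightarrow> real^'m \<Rightarrow> real" and g0 :: "'b \<Rightarrow> real^'m" and H0 :: "'b \<Rightarrow> real^'m^'m"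
  assumes jets: "AE x in P. \<exists>g H. jet (box a b) (G x) (h x) g H \<and> g \<theta>0 = g0 x \<and> H \<theta>0 = H0 x"
    and \<theta>0: "\<theta>0 \<in> box a b" and G: "integrable P G"
    and g0: "integrable P g0" and H0: "integrable P H0"
    and h: "\<And>\<theta>. \<theta> \<in> box a b \<Longrightarrow> integrable P (\<lambda>x. h x \<theta>)"
    and max: "\<And>\<theta>. \<theta> \<in> box a b \<Longrightarrow> (\<integral>x. h x \<theta> \<partial>P) \<le> (\<integral>x. h x \<theta>0 \<partial>P)"
  shows "(\<integral>x. g0 x \<partial>P) = 0" and "v \<bullet> ((\<integral>x. H0 x \<partial>P) *v v) \<le> 0"
proof -
  have key: "(\<integral>x. g0 x \<partial>P) \<bullet> v = 0 \<and> v \<bullet> ((\<integral>x. H0 x \<partial>P) *v v) \<le> 0" for v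
  proof -
    have Hi: "integrable P (\<lambda>x. v \<bullet> (H0 x *v v))"
      using integrable_bounded_linear[OF bounded_linear_quadratic_form H0] .
    have He: "(\<integral>x. v \<bullet> (H0 x *v v) \<partial>P) = v \<bullet> ((\<integral>x. H0 x \<partial>P) *v v)"
      using integral_bounded_linear[OF bounded_linear_quadratic_form H0] .
    have gi: "integrable P (\<lambda>x. g0 x \<bullet> v)" using g0 by simp
    obtain e where e: "0 < e" "ball \<theta>0 e \<subseteq> box a b"
      using \<theta>0 open_box open_contains_ball by blast
    define d where "d = e / (norm v + 1)"
    have nv: "0 < norm v + 1" by (intro add_nonneg_pos) auto
    have d: "0 < d" using e nv unfolding d_def by (intro divide_pos_pos)
    have inb: "\<theta>0 + t *\<^sub>R v \<in> box a b" if "\<bar>t\<bar> < d" for t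
    proof -
      have "\<bar>t\<bar> * norm v \<le> \<bar>t\<bar> * (norm v + 1)" by (intro mult_left_mono) auto
      also have "\<dots> < d * (norm v + 1)" using that nv by (intro mult_strict_right_mono)
      also have "\<dots> = e" unfolding d_def using nv by simp
      finally have "\<theta>0 + t *\<^sub>R v \<in> ball \<theta>0 e" by (simp add: dist_norm)
      then show ?thesis using e by blast
    qed
    define A where "A = (\<integral>x. g0 x \<bullet> v \<partial>P)"
    define B where "B = (\<integral>x. v \<bullet> (H0 x *v v) \<partial>P)"
    define c where "c = l1norm v ^ 3 * (\<integral>x. G x \<partial>P)"
    have "t * A + t\<^sup>2 / 2 * B - \<bar>t\<bar> ^ 3 * c \<le> 0" if t: "\<bar>t\<bar> < d" for t
    proof -
      have "AE x in P. t * (g0 x \<bullet> v) + t\<^sup>2 / 2 * (v \<bullet> (H0 x *v v)) - \<bar>t\<bar> ^ 3 * (l1norm v ^ 3 * G x)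
          \<le> h x (\<theta>0 + t *\<^sub>R v) - h x \<theta>0"
        using jets
      proof eventually_elim
        case (elim x)
        then obtain g H where gH: "jet (box a b) (G x) (h x) g H" "g \<theta>0 = g0 x" "H \<theta>0 = H0 x" by blast
        have "\<bar>h x (\<theta>0 + t *\<^sub>R v) - h x \<theta>0 - g \<theta>0 \<bullet> (\<theta>0 + t *\<^sub>R v - \<theta>0)
            - (\<theta>0 + t *\<^sub>R v - \<theta>0) \<bullet> (H \<theta>0 *v (\<theta>0 + t *\<^sub>R v - \<theta>0)) / 2\<bar> \<le> G x * l1norm (\<theta>0 + t *\<^sub>R v - \<theta>0) ^ 3"
          by (rule jet_taylor[OF gH(1) \<theta>0 inb[OF t]])
        then have "\<bar>h x (\<theta>0 + t *\<^sub>R v) - h x \<theta>0 - t * (g0 x \<bullet> v) - t\<^sup>2 / 2 * (v \<bullet> (H0 x *v v))\<bar>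
            \<le> \<bar>t\<bar> ^ 3 * (l1norm v ^ 3 * G x)"
          by (simp add: gH(2,3) matrix_vector_mult_scaleR power_mult_distrib power2_eq_square mult_ac)
        then show ?case by linarith
      qed
      then have "(\<integral>x. t * (g0 x \<bullet> v) + t\<^sup>2 / 2 * (v \<bullet> (H0 x *v v)) - \<bar>t\<bar> ^ 3 * (l1norm v ^ 3 * G x) \<partial>P)
          \<le> (\<integral>x. h x (\<theta>0 + t *\<^sub>R v) - h x \<theta>0 \<partial>P)"
        using gi Hi G h[OF inb[OF t]] h[OF \<theta>0] by (intro integral_mono_AE) auto
      also have "\<dots> \<le> 0" using max[OF inb[OF t]] h[OF inb[OF t]] h[OF \<theta>0] by simp
      also have "(\<integral>x. t * (g0 x \<bullet> v) + t\<^sup>2 / 2 * (v \<bullet> (H0 x *v v)) - \<bar>t\<bar> ^ 3 * (l1norm v ^ 3 * G x) \<partial>P)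
          = t * A + t\<^sup>2 / 2 * B - \<bar>t\<bar> ^ 3 * c"
        unfolding A_def B_def c_def using gi Hi G by simp
      finally show ?thesis .
    qed
    note res = second_order_necessary[OF d this]
    show ?thesis using res g0 unfolding A_def B_def He by simp
  qed
  show "v \<bullet> ((\<integral>x. H0 x \<partial>P) *v v) \<le> 0" using key by blast
  show "(\<integral>x. g0 x \<partial>P) = 0" using key[of "\<integral>x. g0 x \<partial>P"] by simp
qed

section \<open>Asymptotics of the local maximizer\<close>

lemma quadratic_regime_mono:
  "quadratic_regime S \<theta>0 r e f g \<Longrightarrow> r' \<le> r \<Longrightarrow> quadratic_regime S \<theta>0 r' e f g"
  unfolding quadratic_regime_def using subset_cball[of r' r \<theta>0] by blast

definition shrinking_radius :: "nat \<Rightarrow> real" where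
  "shrinking_radius n = real n powr (- (1 / 3))"

lemma shrinking_radius_pos: "0 < n \<Longrightarrow> 0 < shrinking_radius n"
  by (simp add: shrinking_radius_def)

lemma shrinking_radius_nonneg: "0 \<le> shrinking_radius n"
  by (simp add: shrinking_radius_def)

lemma shrinking_radius_tendsto: "shrinking_radius \<longlonglongrightarrow> 0"
proof -
  have "((\<lambda>x::real. x powr (- (1 / 3))) \<longlongrightarrow> 0) at_top" by (intro tendsto_neg_powr filterlim_ident) simp
  then show ?thesis
    unfolding shrinking_radius_def by (rule filterlim_compose[OF _ filterlim_real_sequentially])
qed

text \<open>What the asymptotic theory uses: a criterion with a dominated second order expansion on a box around
\<open>\<theta>0\<close>, a centered square integrable score and a coercive mean Hessian. The functions \<open>g0\<close> and \<open>H0\<close> are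
measurable versions of gradient and Hessian at \<open>\<theta>0\<close>, since the derivatives themselves are only determined
for almost every observation.\<close>

locale regular_m_estimation = prob_space W for W :: "'w measure" +
  fixes P :: "'b::topological_space measure" and X :: "nat \<Rightarrow> 'w \<Rightarrow> 'b"
    and h :: "'b \<Rightarrow> real^'m \<Rightarrow> real" and a b \<theta>0 :: "real^'m" and G :: "'b \<Rightarrow> real"
    and g0 :: "'b \<Rightarrow> real^'m" and H0 :: "'b \<Rightarrow> real^'m^'m" and S :: "real^'m^'m" and \<kappa> :: real
  assumes indep: "indep_vars (\<lambda>_. borel) X UNIV" and law: "\<And>i. distr W borel (X i) = P"
    and \<theta>0: "\<theta>0 \<in> box a b"
    and jets: "AE x in P. \<exists>g H. jet (box a b) (G x) (h x) g H \<and> g \<theta>0 = g0 x \<and> H \<theta>0 = H0 x"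
    and h_measurable: "\<And>\<theta>. \<theta> \<in> box a b \<Longrightarrow> (\<lambda>x. h x \<theta>) \<in> borel_measurable borel"
    and G: "integrable P G"
    and g0_measurable: "g0 \<in> borel_measurable borel"
    and g0_square: "integrable P (\<lambda>x. (norm (g0 x))\<^sup>2)" and g0_mean: "(\<integral>x. g0 x \<partial>P) = 0"
    and H0: "integrable P H0" and S: "S = - (\<integral>x. H0 x \<partial>P)"
    and S_symmetric: "transpose S = S"
    and \<kappa>: "0 < \<kappa>" and coercive: "\<And>u. \<kappa> * (norm u)\<^sup>2 \<le> u \<bullet> (S *v u)"
begin

definition emp :: "nat \<Rightarrow> 'w \<Rightarrow> real^'m \<Rightarrow> real" where
  "emp n \<omega> \<theta> = (\<Sum>i<n. h (X i \<omega>) \<theta>) / real n"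

definition score :: "nat \<Rightarrow> 'w \<Rightarrow> real^'m" where
  "score n \<omega> = (1 / real n) *\<^sub>R (\<Sum>i<n. g0 (X i \<omega>))"

lemma X_measurable [measurable]: "X i \<in> measurable W borel"
  using indep unfolding indep_vars_def by auto

lemma sets_P [simp, measurable_cong]: "sets P = sets borel"
  using law[of 0] by (metis sets_distr)

lemma prob_space_P: "prob_space P"
  unfolding law[of 0, symmetric] by (rule prob_space_distr) simp

lemma score_measurable [measurable]: "score n \<in> borel_measurable W"
  using g0_measurable unfolding score_def by measurable

lemma emp_measurable: "\<theta> \<in> box a b \<Longrightarrow> (\<lambda>\<omega>. emp n \<omega> \<theta>) \<in> borel_measurable W"
  using measurable_compose[OF X_measurable h_measurable] unfolding emp_def by measurable

lemma iid_transform: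
  fixes \<phi> :: "'b \<Rightarrow> real"
  assumes [measurable]: "\<phi> \<in> borel_measurable borel"
  shows "indep_vars (\<lambda>_. borel) (\<lambda>i \<omega>. \<phi> (X i \<omega>)) UNIV"
    and "distr W borel (\<lambda>\<omega>. \<phi> (X i \<omega>)) = distr W borel (\<lambda>\<omega>. \<phi> (X 0 \<omega>))"
    and "integrable W (\<lambda>\<omega>. \<phi> (X i \<omega>)) \<longleftrightarrow> integrable P \<phi>"
    and "expectation (\<lambda>\<omega>. \<phi> (X i \<omega>)) = (\<integral>x. \<phi> x \<partial>P)"
proof -
  show "indep_vars (\<lambda>_. borel) (\<lambda>i \<omega>. \<phi> (X i \<omega>)) UNIV"
    by (rule indep_vars_compose2[OF indep]) simp
  have "distr W borel (\<lambda>\<omega>. \<phi> (X i \<omega>)) = distr P borel \<phi>" for i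
    unfolding law[of i, symmetric] by (simp add: distr_distr comp_def)
  then show "distr W borel (\<lambda>\<omega>. \<phi> (X i \<omega>)) = distr W borel (\<lambda>\<omega>. \<phi> (X 0 \<omega>))" by simp
  show "integrable W (\<lambda>\<omega>. \<phi> (X i \<omega>)) \<longleftrightarrow> integrable P \<phi>"
    unfolding law[of i, symmetric] by (simp add: integrable_distr_eq)
  show "expectation (\<lambda>\<omega>. \<phi> (X i \<omega>)) = (\<integral>x. \<phi> x \<partial>P)"
    unfolding law[of i, symmetric] by (simp add: integral_distr)
qed

lemma mean_converges:
  fixes \<phi> :: "'b \<Rightarrow> real"
  assumes "integrable P \<phi>"
  shows "AE \<omega> in W. (\<lambda>n. (\<Sum>i<n. \<phi> (X i \<omega>)) / real n) \<longlonglongrightarrow> (\<integral>x. \<phi> x \<partial>P)"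
proof -
  have \<phi>: "\<phi> \<in> borel_measurable borel"
    using borel_measurable_integrable[OF assms] by (simp cong: measurable_cong_sets)
  show ?thesis
    using strong_law_of_large_numbers[OF iid_transform(1,2)[OF \<phi>]] iid_transform(3,4)[OF \<phi>] assms by simp
qed

lemma AE_sample_jets:
  "AE \<omega> in W. \<forall>i. \<exists>g H. jet (box a b) (G (X i \<omega>)) (h (X i \<omega>)) g H \<and> g \<theta>0 = g0 (X i \<omega>) \<and> H \<theta>0 = H0 (X i \<omega>)"
  unfolding AE_all_countable
proof
  fix i
  have "AE x in distr W borel (X i). \<exists>g H. jet (box a b) (G x) (h x) g H \<and> g \<theta>0 = g0 x \<and> H \<theta>0 = H0 x"
    using jets unfolding law .
  then show "AE \<omega> in W. \<exists>g H. jet (box a b) (G (X i \<omega>)) (h (X i \<omega>)) g H \<and> g \<theta>0 = g0 (X i \<omega>) \<and> H \<theta>0 = H0 (X i \<omega>)"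
    by (rule AE_distrD[OF X_measurable])
qed

text \<open>Gradients are chosen once for each path, so that the statements for different \<open>e\<close> concern the same
function.\<close>

definition quadratic_path :: "'w \<Rightarrow> bool" where
  "quadratic_path \<omega> \<longleftrightarrow> (\<exists>L g H. (\<forall>n. jet (box a b) (L n) (emp n \<omega>) (g n) (H n) \<and> g n \<theta>0 = score n \<omega>) \<and>
     (\<forall>e>0. \<forall>\<^sub>F n in sequentially. cball \<theta>0 (shrinking_radius n) \<subseteq> box a b \<and>
        quadratic_regime S \<theta>0 (shrinking_radius n) e (emp n \<omega>) (g n)))"

text \<open>The mean of the dominating functions converges, so the Lipschitz constants of the averaged Hessians stay
bounded while the balls shrink, and the averaged Hessian at \<open>\<theta>0\<close> tends to \<open>- S\<close>.\<close>

lemma AE_quadratic_path: "AE \<omega> in W. quadratic_path \<omega>"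
proof -
  have Hij: "integrable P (\<lambda>x. H0 x $ i $ j)" "(\<integral>x. H0 x $ i $ j \<partial>P) = - S $ i $ j" for i j
  proof -
    have bl: "bounded_linear (\<lambda>A :: real^'m^'m. A $ i $ j)"
      by (intro linear_conv_bounded_linear[THEN iffD1] linearI) simp_all
    show "integrable P (\<lambda>x. H0 x $ i $ j)" by (rule integrable_bounded_linear[OF bl H0])
    show "(\<integral>x. H0 x $ i $ j \<partial>P) = - S $ i $ j" using integral_bounded_linear[OF bl H0] by (simp add: S)
  qed
  have "AE \<omega> in W. \<forall>i\<in>UNIV. \<forall>j\<in>UNIV. (\<lambda>n. (\<Sum>k<n. H0 (X k \<omega>) $ i $ j) / real n) \<longlonglongrightarrow> - S $ i $ j"
    using mean_converges[OF Hij(1)] unfolding Hij(2) AE_finite_all[OF finite] by blast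
  with AE_sample_jets mean_converges[OF G] show ?thesis
  proof eventually_elim
    case (elim \<omega>)
    from elim(1) obtain g H where gH: "\<And>i. jet (box a b) (G (X i \<omega>)) (h (X i \<omega>)) (g i) (H i)"
      "\<And>i. g i \<theta>0 = g0 (X i \<omega>)" "\<And>i. H i \<theta>0 = H0 (X i \<omega>)"
      by metis
    define Ln where "Ln n = 1 / real n * (\<Sum>i<n. G (X i \<omega>))" for n
    define gn where "gn n \<theta> = (1 / real n) *\<^sub>R (\<Sum>i<n. g i \<theta>)" for n \<theta>
    define Hn where "Hn n \<theta> = (1 / real n) *\<^sub>R (\<Sum>i<n. H i \<theta>)" for n \<theta>
    have jet: "jet (box a b) (Ln n) (emp n \<omega>) (gn n) (Hn n)" for n
    proof -
      have "jet (box a b) (1 / real n * (\<Sum>i<n. G (X i \<omega>))) (\<lambda>\<theta>. 1 / real n * (\<Sum>i<n. h (X i \<omega>) \<theta>))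
        (\<lambda>\<theta>. (1 / real n) *\<^sub>R (\<Sum>i<n. g i \<theta>)) (\<lambda>\<theta>. (1 / real n) *\<^sub>R (\<Sum>i<n. H i \<theta>))"
        by (rule jet_scaled_sum) (auto intro: gH)
      then show ?thesis
        unfolding Ln_def gn_def[abs_def] Hn_def[abs_def] emp_def[abs_def] by simp
    qed
    moreover have "gn n \<theta>0 = score n \<omega>" for n unfolding gn_def score_def gH(2) ..
    moreover have "\<forall>e>0. \<forall>\<^sub>F n in sequentially. cball \<theta>0 (shrinking_radius n) \<subseteq> box a b \<and>
        quadratic_regime S \<theta>0 (shrinking_radius n) e (emp n \<omega>) (gn n)"
    proof (intro allI impI eventually_quadratic_regime[OF jet \<theta>0 _ _ shrinking_radius_tendsto S_symmetric])
      show "Ln \<longlonglongrightarrow> (\<integral>x. G x \<partial>P)" using elim(2) unfolding Ln_def by simp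
      show "(\<lambda>n. Hn n \<theta>0 $ i $ j) \<longlonglongrightarrow> - S $ i $ j" for i j
        using elim(3) unfolding Hn_def gH(3) by simp
    qed
    ultimately show ?case unfolding quadratic_path_def by blast
  qed
qed

lemma score_component:
  "integrable P (\<lambda>x. (w \<bullet> g0 x)\<^sup>2)" "(\<lambda>x. w \<bullet> g0 x) \<in> borel_measurable borel" "(\<integral>x. w \<bullet> g0 x \<partial>P) = 0"
proof -
  interpret P: prob_space P by (rule prob_space_P)
  note [measurable] = g0_measurable
  show m: "(\<lambda>x. w \<bullet> g0 x) \<in> borel_measurable borel" by measurable
  show "integrable P (\<lambda>x. (w \<bullet> g0 x)\<^sup>2)"
  proof (rule Bochner_Integration.integrable_bound)
    show "integrable P (\<lambda>x. (norm w)\<^sup>2 * (norm (g0 x))\<^sup>2)" using g0_square by simp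
    show "AE x in P. norm ((w \<bullet> g0 x)\<^sup>2) \<le> norm ((norm w)\<^sup>2 * (norm (g0 x))\<^sup>2)"
    proof (rule AE_I2)
      fix x
      have "\<bar>w \<bullet> g0 x\<bar>\<^sup>2 \<le> (norm w * norm (g0 x))\<^sup>2" by (intro power_mono Cauchy_Schwarz_ineq2) simp
      then show "norm ((w \<bullet> g0 x)\<^sup>2) \<le> norm ((norm w)\<^sup>2 * (norm (g0 x))\<^sup>2)" by (simp add: power_mult_distrib)
    qed
  qed measurable
  have "integrable P (\<lambda>x. norm (g0 x))"
    by (rule P.square_integrable_imp_integrable[OF _ g0_square]) measurable
  then have "integrable P g0" by (subst (asm) integrable_norm_iff) measurable
  then show "(\<integral>x. w \<bullet> g0 x \<partial>P) = 0" using g0_mean by simp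
qed

lemma inner_score: "w \<bullet> score n \<omega> = (\<Sum>i<n. w \<bullet> g0 (X i \<omega>)) / real n"
  unfolding score_def by (simp add: inner_sum_right)

lemma score_rate: "AE \<omega> in W. \<forall>e>0. \<forall>\<^sub>F n in sequentially. norm (score n \<omega>) < e * shrinking_radius n"
proof -
  have "AE \<omega> in W. \<forall>j\<in>UNIV. (\<lambda>n. (\<Sum>i<n. axis j 1 \<bullet> g0 (X i \<omega>)) / real n powr (2 / 3)) \<longlonglongrightarrow> 0"
  proof (subst AE_finite_all, simp, rule ballI)
    fix j :: 'm
    show "AE \<omega> in W. (\<lambda>n. (\<Sum>i<n. axis j 1 \<bullet> g0 (X i \<omega>)) / real n powr (2 / 3)) \<longlonglongrightarrow> 0"
    proof (rule iid_partial_sum_rate[OF iid_transform(1,2)[OF score_component(2)]])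
      show "expectation (\<lambda>\<omega>. axis j 1 \<bullet> g0 (X 0 \<omega>)) = 0"
        unfolding iid_transform(4)[OF score_component(2)] by (rule score_component(3))
      have "(\<lambda>x. (axis j 1 \<bullet> g0 x)\<^sup>2) \<in> borel_measurable borel" using g0_measurable by measurable
      from iid_transform(3)[OF this] show "integrable W (\<lambda>\<omega>. (axis j 1 \<bullet> g0 (X 0 \<omega>))\<^sup>2)"
        using score_component(1) by blast
    qed
  qed
  then show ?thesis
  proof eventually_elim
    case (elim \<omega>)
    have "(\<lambda>n. \<Sum>j\<in>(UNIV::'m set). \<bar>(\<Sum>i<n. axis j 1 \<bullet> g0 (X i \<omega>)) / real n powr (2 / 3)\<bar>) \<longlonglongrightarrow> (\<Sum>j\<in>(UNIV::'m set). \<bar>0\<bar>)"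
      using elim by (intro tendsto_sum tendsto_rabs) auto
    then have lim: "(\<lambda>n. \<Sum>j\<in>(UNIV::'m set). \<bar>(\<Sum>i<n. axis j 1 \<bullet> g0 (X i \<omega>)) / real n powr (2 / 3)\<bar>) \<longlonglongrightarrow> 0" by simp
    show ?case
    proof (intro allI impI)
      fix e :: real assume "0 < e"
      with lim have "\<forall>\<^sub>F n in sequentially. (\<Sum>j\<in>(UNIV::'m set). \<bar>(\<Sum>i<n. axis j 1 \<bullet> g0 (X i \<omega>)) / real n powr (2 / 3)\<bar>) < e"
        by (rule order_tendstoD(2))
      with eventually_gt_at_top[of "0::nat"]
      show "\<forall>\<^sub>F n in sequentially. norm (score n \<omega>) < e * shrinking_radius n"
      proof eventually_elim
        case (elim n)
        have split: "x / real n = x / real n powr (2 / 3) * shrinking_radius n" for x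
        proof -
          have "real n powr (2 / 3) * real n powr (1 / 3) = real n" using elim(1) by (simp add: powr_add[symmetric])
          then show ?thesis using elim(1) unfolding shrinking_radius_def powr_minus by (simp add: field_simps)
        qed
        have "norm (score n \<omega>) \<le> (\<Sum>j\<in>UNIV. \<bar>score n \<omega> $ j\<bar>)" by (rule norm_le_l1_cart)
        also have "\<dots> = (\<Sum>j\<in>UNIV. \<bar>(\<Sum>i<n. axis j 1 \<bullet> g0 (X i \<omega>)) / real n powr (2 / 3)\<bar> * shrinking_radius n)"
        proof (intro sum.cong refl)
          fix j :: 'm
          have "score n \<omega> $ j = axis j 1 \<bullet> score n \<omega>" by (simp add: inner_axis')
          then show "\<bar>score n \<omega> $ j\<bar> = \<bar>(\<Sum>i<n. axis j 1 \<bullet> g0 (X i \<omega>)) / real n powr (2 / 3)\<bar> * shrinking_radius n"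
            unfolding inner_score split using shrinking_radius_nonneg[of n] by (simp only: abs_mult abs_of_nonneg)
        qed
        also have "\<dots> < e * shrinking_radius n"
          unfolding sum_distrib_right[symmetric] using elim(2) shrinking_radius_pos[OF elim(1)]
          by (rule mult_strict_right_mono)
        finally show ?case .
      qed
    qed
  qed
qed

text \<open>The maximum is sought over the ball of half the radius, which keeps the maximizer away from the
boundary of the ball of radius \<open>n\<^sup>-\<^sup>1\<^sup>/\<^sup>3\<close>.\<close>

theorem measurable_local_maximizer_exists:
  "\<exists>est. (\<forall>n. est n \<in> borel_measurable W) \<and> (AE \<omega> in W. \<forall>\<^sub>F n in sequentially.
     est n \<omega> \<in> ball \<theta>0 (shrinking_radius n) \<and> (\<forall>\<^sub>F \<theta> in nhds (est n \<omega>). emp n \<omega> \<theta> \<le> emp n \<omega> (est n \<omega>)))"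
proof -
  define \<rho> where "\<rho> n = shrinking_radius n / 2" for n
  have "\<exists>q :: nat \<Rightarrow> real^'m. range q \<subseteq> cball \<theta>0 (\<rho> n) \<and> cball \<theta>0 (\<rho> n) \<subseteq> closure (range q)" for n
  proof -
    have "cball \<theta>0 (\<rho> n) \<noteq> {}" using shrinking_radius_nonneg[of n] by (simp add: \<rho>_def)
    then show ?thesis by (rule dense_sequence) blast
  qed
  then obtain q :: "nat \<Rightarrow> nat \<Rightarrow> real^'m"
    where q: "\<And>n. range (q n) \<subseteq> cball \<theta>0 (\<rho> n)" "\<And>n. cball \<theta>0 (\<rho> n) \<subseteq> closure (range (q n))"
    by metis
  define est where "est n \<omega> = (if cball \<theta>0 (\<rho> n) \<subseteq> box a b then lim (\<lambda>k. running_argmax (emp n \<omega>) (q n) k) else \<theta>0)" for n \<omega>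
  have "est n \<in> borel_measurable W" for n
  proof (cases "cball \<theta>0 (\<rho> n) \<subseteq> box a b")
    case True
    have "(\<lambda>\<omega>. running_argmax (emp n \<omega>) (q n) k) \<in> borel_measurable W" for k
    proof (rule measurable_running_argmax)
      fix k
      have "q n k \<in> box a b" using q(1)[of n] True by blast
      then show "(\<lambda>\<omega>. emp n \<omega> (q n k)) \<in> borel_measurable W" by (rule emp_measurable)
    qed
    then have "(\<lambda>\<omega>. lim (\<lambda>k. running_argmax (emp n \<omega>) (q n) k)) \<in> borel_measurable W"
      by (rule borel_measurable_lim_metric)
    then show ?thesis using True unfolding est_def by simp
  next
    case False then show ?thesis unfolding est_def by simp
  qed
  moreover have "AE \<omega> in W. \<forall>\<^sub>F n in sequentially.
     est n \<omega> \<in> ball \<theta>0 (shrinking_radius n) \<and> (\<forall>\<^sub>F \<theta> in nhds (est n \<omega>). emp n \<omega> \<theta> \<le> emp n \<omega> (est n \<omega>))"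
    using AE_quadratic_path score_rate
  proof eventually_elim
    case (elim \<omega>)
    from elim(1) obtain L g H where jet: "\<And>n. jet (box a b) (L n) (emp n \<omega>) (g n) (H n)"
      and score: "\<And>n. g n \<theta>0 = score n \<omega>"
      and reg: "\<And>e. 0 < e \<Longrightarrow> \<forall>\<^sub>F n in sequentially. cball \<theta>0 (shrinking_radius n) \<subseteq> box a b \<and>
        quadratic_regime S \<theta>0 (shrinking_radius n) e (emp n \<omega>) (g n)"
      unfolding quadratic_path_def by blast
    have "\<forall>\<^sub>F n in sequentially. norm (score n \<omega>) < \<kappa> / 8 * shrinking_radius n"
      by (rule elim(2)[rule_format]) (use \<kappa> in simp)
    moreover have "\<forall>\<^sub>F n in sequentially. cball \<theta>0 (shrinking_radius n) \<subseteq> box a b \<and>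
        quadratic_regime S \<theta>0 (shrinking_radius n) (\<kappa> / 4) (emp n \<omega>) (g n)"
      using \<kappa> by (intro reg) simp
    ultimately show ?case using eventually_gt_at_top[of "0::nat"]
    proof eventually_elim
      case (elim n)
      have \<rho>: "0 < \<rho> n" "\<rho> n < shrinking_radius n" using shrinking_radius_pos[OF elim(3)] by (simp_all add: \<rho>_def)
      have sub: "cball \<theta>0 (\<rho> n) \<subseteq> box a b" using elim(2) subset_cball[of "\<rho> n" "shrinking_radius n" \<theta>0] \<rho> by auto
      have q': "quadratic_regime S \<theta>0 (\<rho> n) (\<kappa> / 4) (emp n \<omega>) (g n)"
        using quadratic_regime_mono elim(2) \<rho>(2) by (metis less_imp_le)
      have small: "norm (g n \<theta>0) < \<kappa> / 4 * \<rho> n" using elim(1) unfolding score \<rho>_def by simp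
      obtain \<theta> where \<theta>: "\<theta> \<in> ball \<theta>0 (\<rho> n)" "\<And>y. y \<in> cball \<theta>0 (\<rho> n) \<Longrightarrow> emp n \<omega> y \<le> emp n \<omega> \<theta>"
          "\<And>y. y \<in> cball \<theta>0 (\<rho> n) \<Longrightarrow> emp n \<omega> y = emp n \<omega> \<theta> \<Longrightarrow> y = \<theta>"
        using quadratic_regime_interior_max[OF jet sub q' coercive \<kappa> \<rho>(1) small] by metis
      have "running_argmax (emp n \<omega>) (q n) \<longlonglongrightarrow> \<theta>"
        using \<theta> by (intro running_argmax_tendsto[OF compact_cball _ q] continuous_on_subset[OF continuous_on_jet[OF jet] sub]) auto
      then have est: "est n \<omega> = \<theta>" unfolding est_def using sub limI by auto
      have "\<forall>\<^sub>F z in nhds \<theta>. z \<in> ball \<theta>0 (\<rho> n)" using \<theta>(1) by (intro eventually_nhds_in_open) auto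
      then have "\<forall>\<^sub>F z in nhds \<theta>. emp n \<omega> z \<le> emp n \<omega> \<theta>" by eventually_elim (use \<theta>(2) in auto)
      moreover have "\<theta> \<in> ball \<theta>0 (shrinking_radius n)" using \<theta>(1) \<rho>(2) by auto
      ultimately show ?case unfolding est by blast
    qed
  qed
  ultimately show ?thesis by blast
qed

lemma local_maximizer_linearisation:
  assumes "AE \<omega> in W. \<forall>\<^sub>F n in sequentially. est n \<omega> \<in> cball \<theta>0 (shrinking_radius n) \<and>
     (\<forall>\<^sub>F \<theta> in nhds (est n \<omega>). emp n \<omega> \<theta> \<le> emp n \<omega> (est n \<omega>))"
  shows "AE \<omega> in W. \<forall>e>0. \<forall>\<^sub>F n in sequentially. norm (S *v (est n \<omega> - \<theta>0) - score n \<omega>) \<le> e * norm (score n \<omega>)"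
  using assms AE_quadratic_path
proof eventually_elim
  case (elim \<omega>)
  from elim(2) obtain L g H where jet: "\<And>n. jet (box a b) (L n) (emp n \<omega>) (g n) (H n)"
    and score: "\<And>n. g n \<theta>0 = score n \<omega>"
    and reg: "\<And>e. 0 < e \<Longrightarrow> \<forall>\<^sub>F n in sequentially. cball \<theta>0 (shrinking_radius n) \<subseteq> box a b \<and>
      quadratic_regime S \<theta>0 (shrinking_radius n) e (emp n \<omega>) (g n)"
    unfolding quadratic_path_def by blast
  show ?case
  proof (intro allI impI)
    fix e :: real assume e: "0 < e"
    \<comment> \<open>the linearization at error level \<open>d\<close> has relative error \<open>2 d / \<kappa>\<close>\<close>
    define d where "d = min (\<kappa> / 2) (e * \<kappa> / 2)"
    have d: "0 < d" "d \<le> \<kappa> / 2" "2 * d / \<kappa> \<le> e" using e \<kappa> by (auto simp: d_def min_def field_simps)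
    from elim(1) reg[OF d(1)]
    show "\<forall>\<^sub>F n in sequentially. norm (S *v (est n \<omega> - \<theta>0) - score n \<omega>) \<le> e * norm (score n \<omega>)"
    proof eventually_elim
      case (elim n)
      have "est n \<omega> \<in> box a b" using elim by blast
      then have "g n (est n \<omega>) = 0" using elim(1) by (intro jet_gradient_zero_at_local_max[OF jet]) auto
      then have "norm (S *v (est n \<omega> - \<theta>0) - g n \<theta>0) \<le> 2 * d / \<kappa> * norm (g n \<theta>0)"
        using elim d \<kappa> shrinking_radius_nonneg[of n]
        by (intro quadratic_regime_critical_point_linearisation[OF _ coercive]) auto
      also have "\<dots> \<le> e * norm (g n \<theta>0)" using d(3) by (intro mult_right_mono) auto
      finally show ?case unfolding score .
    qed
  qed
qed

lemma score_second_moment: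
  "integrable W (\<lambda>\<omega>. real n * (norm (score n \<omega>))\<^sup>2)"
  "expectation (\<lambda>\<omega>. real n * (norm (score n \<omega>))\<^sup>2) \<le> (\<Sum>j\<in>UNIV. \<integral>x. (axis j 1 \<bullet> g0 x)\<^sup>2 \<partial>P)"
proof -
  define D where "D j \<omega> = (\<Sum>i<n. axis j 1 \<bullet> g0 (X i \<omega>))\<^sup>2" for j \<omega>
  have D: "integrable W (D j)" "expectation (D j) = real n * (\<integral>x. (axis j 1 \<bullet> g0 x)\<^sup>2 \<partial>P)" for j
  proof -
    have m2: "(\<lambda>x. (axis j 1 \<bullet> g0 x)\<^sup>2) \<in> borel_measurable borel" using g0_measurable by measurable
    note b = iid_block_second_moment[OF iid_transform(1,2)[OF score_component(2)[of "axis j 1"]] _ _ finite_lessThan[of n]]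
    have mean: "expectation (\<lambda>\<omega>. axis j 1 \<bullet> g0 (X 0 \<omega>)) = 0"
      unfolding iid_transform(4)[OF score_component(2)] by (rule score_component(3))
    have sq: "integrable W (\<lambda>\<omega>. (axis j 1 \<bullet> g0 (X 0 \<omega>))\<^sup>2)"
      unfolding iid_transform(3)[OF m2] by (rule score_component(1))
    show "integrable W (D j)" unfolding D_def by (rule b(1)[OF mean sq])
    show "expectation (D j) = real n * (\<integral>x. (axis j 1 \<bullet> g0 x)\<^sup>2 \<partial>P)"
      unfolding D_def using b(2)[OF mean sq] iid_transform(4)[OF m2] by simp
  qed
  have eq: "real n * (norm (score n \<omega>))\<^sup>2 = (\<Sum>j\<in>UNIV. D j \<omega> / real n)" for \<omega>
  proof -
    have "(norm (score n \<omega>))\<^sup>2 = (\<Sum>j\<in>UNIV. (axis j 1 \<bullet> score n \<omega>)\<^sup>2)"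
      unfolding power2_norm_eq_inner inner_axis' by (simp add: inner_vec_def power2_eq_square)
    also have "\<dots> = (\<Sum>j\<in>UNIV. D j \<omega> / (real n)\<^sup>2)"
      unfolding inner_score D_def by (simp add: power_divide)
    finally show ?thesis by (cases "n = 0") (auto simp: sum_distrib_left power2_eq_square)
  qed
  show "integrable W (\<lambda>\<omega>. real n * (norm (score n \<omega>))\<^sup>2)" unfolding eq using D(1) by simp
  have "expectation (\<lambda>\<omega>. real n * (norm (score n \<omega>))\<^sup>2) = (\<Sum>j\<in>UNIV. expectation (D j) / real n)"
    unfolding eq using D(1) by (simp add: Bochner_Integration.integral_sum)
  also have "\<dots> \<le> (\<Sum>j\<in>UNIV. \<integral>x. (axis j 1 \<bullet> g0 x)\<^sup>2 \<partial>P)"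
    by (intro sum_mono) (auto simp: D(2) intro!: integral_nonneg_AE)
  finally show "expectation (\<lambda>\<omega>. real n * (norm (score n \<omega>))\<^sup>2) \<le> (\<Sum>j\<in>UNIV. \<integral>x. (axis j 1 \<bullet> g0 x)\<^sup>2 \<partial>P)" .
qed

lemma sqrt_mean_eq: "sqrt (real n) * (s / real n) = s / sqrt (real n)"
  by (cases "n = 0") (auto simp: field_simps)

lemma score_characteristic_function_limit:
  "(\<lambda>n. CLINT \<omega>|W. iexp (w \<bullet> (sqrt (real n) *\<^sub>R score n \<omega>)))
    \<longlonglongrightarrow> complex_of_real (exp (- (\<integral>x. (w \<bullet> g0 x)\<^sup>2 \<partial>P) / 2))"
proof -
  have m2: "(\<lambda>x. (w \<bullet> g0 x)\<^sup>2) \<in> borel_measurable borel" using g0_measurable by measurable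
  have mean: "expectation (\<lambda>\<omega>. w \<bullet> g0 (X 0 \<omega>)) = 0"
    unfolding iid_transform(4)[OF score_component(2)] by (rule score_component(3))
  have sq: "integrable W (\<lambda>\<omega>. (w \<bullet> g0 (X 0 \<omega>))\<^sup>2)"
    unfolding iid_transform(3)[OF m2] by (rule score_component(1))
  have eq: "w \<bullet> (sqrt (real n) *\<^sub>R score n \<omega>) = 1 * ((\<Sum>i<n. w \<bullet> g0 (X i \<omega>)) / sqrt (real n))" for n \<omega>
    by (simp only: inner_scaleR_right inner_score sqrt_mean_eq mult_1)
  show ?thesis
    unfolding eq
    using iid_characteristic_function_limit[OF iid_transform(1,2)[OF score_component(2)] mean sq, of 1] iid_transform(4)[OF m2]
    by simp
qed

text \<open>Here \<open>T\<close> is the inverse of \<open>S\<close>. In direction \<open>t\<close> the normalized estimator differs from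
\<open>T t \<bullet> sqrt n s\<^sub>n\<close> by a null factor times \<open>sqrt n |s\<^sub>n|\<close>, and the second moments of the latter are bounded.\<close>

theorem estimator_asymptotically_normal:
  fixes V T :: "real^'m^'m"
  assumes est [measurable]: "\<And>n. est n \<in> borel_measurable W"
    and max: "AE \<omega> in W. \<forall>\<^sub>F n in sequentially. est n \<omega> \<in> cball \<theta>0 (shrinking_radius n) \<and>
     (\<forall>\<^sub>F \<theta> in nhds (est n \<omega>). emp n \<omega> \<theta> \<le> emp n \<omega> (est n \<omega>))"
    and T: "transpose T = T" "T ** S = mat 1"
    and V: "transpose V = V" "\<And>t. t \<bullet> (V *v t) = (\<integral>x. ((T *v t) \<bullet> g0 x)\<^sup>2 \<partial>P)"
  shows "\<exists>\<mu>. centered_normal V \<mu> \<and>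
    weak_conv_vec (\<lambda>n. distr W borel (\<lambda>\<omega>. sqrt (real n) *\<^sub>R (est n \<omega> - \<theta>0))) \<mu>"
proof -
  have psd: "0 \<le> t \<bullet> (V *v t)" for t unfolding V(2) by (intro integral_nonneg_AE) simp
  obtain \<mu> where \<mu>: "centered_normal V \<mu>" using centered_normal_exists[OF V(1) psd] by blast
  then have \<mu>p: "prob_space \<mu>" and \<mu>s: "sets \<mu> = sets borel"
    and \<mu>n: "\<And>t. distr \<mu> borel (\<lambda>x. t \<bullet> x) = normal_law 0 (t \<bullet> (V *v t))"
    unfolding centered_normal_def by auto
  have char_\<mu>: "(CLINT y|\<mu>. iexp (t \<bullet> y)) = complex_of_real (exp (- (t \<bullet> (V *v t)) / 2))" for t
  proof -
    note [measurable_cong] = \<mu>s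
    have "(CLINT y|\<mu>. iexp (t \<bullet> y)) = char (distr \<mu> borel (\<lambda>x. t \<bullet> x)) 1"
      unfolding char_def by (subst integral_distr) auto
    then show ?thesis unfolding \<mu>n using char_normal_law[OF psd, of t 1] by simp
  qed
  have "weak_conv_vec (\<lambda>n. distr W borel (\<lambda>\<omega>. sqrt (real n) *\<^sub>R (est n \<omega> - \<theta>0))) \<mu>"
  proof (rule weak_convergence_from_characteristic_functions)
    fix t :: "real^'m"
    define w where "w = T *v t"
    define U where "U n \<omega> = t \<bullet> (sqrt (real n) *\<^sub>R (est n \<omega> - \<theta>0))" for n \<omega>
    define Z where "Z n \<omega> = w \<bullet> (sqrt (real n) *\<^sub>R score n \<omega>)" for n \<omega>
    have "(\<lambda>n. (CLINT \<omega>|W. iexp (U n \<omega>)) - (CLINT \<omega>|W. iexp (Z n \<omega>))) \<longlonglongrightarrow> 0"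
    proof (rule characteristic_functions_merge)
      show "U n \<in> borel_measurable W" "Z n \<in> borel_measurable W" for n
        unfolding U_def Z_def by measurable
      \<comment> \<open>\<open>sqrt n |s| \<le> 1 + n |s|\<^sup>2\<close> trades the first for the second moment\<close>
      show "integrable W (\<lambda>\<omega>. 1 + real n * (norm (score n \<omega>))\<^sup>2)" for n
        using score_second_moment(1) by simp
      show "0 \<le> 1 + real n * (norm (score n \<omega>))\<^sup>2" for n \<omega> by (simp add: add_nonneg_nonneg)
      show "expectation (\<lambda>\<omega>. 1 + real n * (norm (score n \<omega>))\<^sup>2) \<le> 1 + (\<Sum>j\<in>UNIV. \<integral>x. (axis j 1 \<bullet> g0 x)\<^sup>2 \<partial>P)" for n
        using score_second_moment[of n] by (simp add: prob_space)
      show "AE \<omega> in W. \<forall>e>0. \<forall>\<^sub>F n in sequentially. \<bar>U n \<omega> - Z n \<omega>\<bar> \<le> e * (1 + real n * (norm (score n \<omega>))\<^sup>2)"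
        using local_maximizer_linearisation[OF max]
      proof eventually_elim
        case (elim \<omega>)
        show ?case
        proof (intro allI impI)
          fix e :: real assume e: "0 < e"
          define d where "d = e / (norm w + 1)"
          have nw: "0 < norm w + 1" by (intro add_nonneg_pos) auto
          have d: "0 < d" using e nw by (simp add: d_def)
          have "norm w * d \<le> (norm w + 1) * d" using d by (intro mult_right_mono) auto
          then have dw: "norm w * d \<le> e" unfolding d_def using nw by simp
          from elim d have "\<forall>\<^sub>F n in sequentially. norm (S *v (est n \<omega> - \<theta>0) - score n \<omega>) \<le> d * norm (score n \<omega>)" by blast
          then show "\<forall>\<^sub>F n in sequentially. \<bar>U n \<omega> - Z n \<omega>\<bar> \<le> e * (1 + real n * (norm (score n \<omega>))\<^sup>2)"
          proof eventually_elim
            case (elim n)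
            define s where "s = norm (score n \<omega>)"
            have "t \<bullet> u = w \<bullet> (S *v u)" for u
            proof -
              have "t \<bullet> u = t \<bullet> ((T ** S) *v u)" unfolding T(2) by simp
              also have "\<dots> = t \<bullet> (T *v (S *v u))" by (simp add: matrix_vector_mul_assoc)
              also have "\<dots> = (S *v u) \<bullet> (T *v t)" by (rule symmetric_matrix_inner[OF T(1)])
              finally show ?thesis by (simp add: w_def inner_commute)
            qed
            then have "U n \<omega> - Z n \<omega> = sqrt (real n) * (w \<bullet> (S *v (est n \<omega> - \<theta>0) - score n \<omega>))"
              unfolding U_def Z_def by (simp add: inner_diff_right algebra_simps)
            then have "\<bar>U n \<omega> - Z n \<omega>\<bar> = sqrt (real n) * \<bar>w \<bullet> (S *v (est n \<omega> - \<theta>0) - score n \<omega>)\<bar>"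
              by (simp add: abs_mult)
            also have "\<dots> \<le> sqrt (real n) * (norm w * (d * s))"
              using elim unfolding s_def
              by (intro mult_left_mono order_trans[OF Cauchy_Schwarz_ineq2]) auto
            also have "\<dots> = (norm w * d) * (sqrt (real n) * s)" by simp
            also have "\<dots> \<le> e * (1 + real n * s\<^sup>2)"
            proof (intro mult_mono dw)
              have "0 \<le> (sqrt (real n) * s - 1)\<^sup>2 + (sqrt (real n) * s)\<^sup>2 + 1" by simp
              then have "2 * (sqrt (real n) * s) \<le> 2 * (1 + (sqrt (real n) * s)\<^sup>2)" by (simp add: power2_diff)
              then show "sqrt (real n) * s \<le> 1 + real n * s\<^sup>2" by (simp add: power_mult_distrib)
            qed (use e in \<open>auto simp: s_def\<close>)
            finally show ?case unfolding s_def .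
          qed
        qed
      qed
    qed
    from tendsto_add[OF this score_characteristic_function_limit[of w, folded Z_def]]
    have "(\<lambda>n. CLINT \<omega>|W. iexp (U n \<omega>)) \<longlonglongrightarrow> complex_of_real (exp (- (t \<bullet> (V *v t)) / 2))"
      by (simp add: V(2) w_def)
    then show "(\<lambda>n. CLINT y|distr W borel (\<lambda>\<omega>. sqrt (real n) *\<^sub>R (est n \<omega> - \<theta>0)). iexp (t \<bullet> y)) \<longlonglongrightarrow> (CLINT y|\<mu>. iexp (t \<bullet> y))"
      unfolding char_\<mu> U_def by (simp add: integral_distr)
  qed (use \<mu>p \<mu>s in \<open>auto intro!: prob_space_distr\<close>)
  with \<mu> show ?thesis by blast
qed

text \<open>The excess of the maximal value over the value at \<open>\<theta>0\<close> is at most \<open>|s\<^sub>n|\<^sup>2 / \<kappa>\<close>, because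
\<open>|s| r - \<kappa> r\<^sup>2 / 4 \<le> |s|\<^sup>2 / \<kappa>\<close> for every \<open>r\<close>.\<close>

theorem maximal_value_asymptotically_normal:
  assumes v [measurable]: "\<And>n. v n \<in> borel_measurable W"
    and attained: "AE \<omega> in W. \<forall>\<^sub>F n in sequentially.
      emp n \<omega> \<theta>0 \<le> v n \<omega> \<and> (\<exists>\<theta>\<in>cball \<theta>0 (shrinking_radius n). v n \<omega> = emp n \<omega> \<theta>)"
    and sq: "integrable P (\<lambda>x. (h x \<theta>0)\<^sup>2)"
  shows "weak_conv_m (\<lambda>n. distr W borel (\<lambda>\<omega>. sqrt (real n) * (v n \<omega> - (\<integral>x. h x \<theta>0 \<partial>P))))
    (normal_law 0 ((\<integral>x. (h x \<theta>0)\<^sup>2 \<partial>P) - (\<integral>x. h x \<theta>0 \<partial>P)\<^sup>2))"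
proof -
  interpret P: prob_space P by (rule prob_space_P)
  define m where "m = (\<integral>x. h x \<theta>0 \<partial>P)"
  define s2 where "s2 = (\<integral>x. (h x \<theta>0)\<^sup>2 \<partial>P) - m\<^sup>2"
  have hm [measurable]: "(\<lambda>x. h x \<theta>0) \<in> borel_measurable borel" by (rule h_measurable[OF \<theta>0])
  have hi: "integrable P (\<lambda>x. h x \<theta>0)"
    by (rule P.square_integrable_imp_integrable[OF _ sq]) measurable
  have cm: "(\<lambda>x. h x \<theta>0 - m) \<in> borel_measurable borel" "(\<lambda>x. (h x \<theta>0 - m)\<^sup>2) \<in> borel_measurable borel" by measurable
  have c2: "integrable P (\<lambda>x. (h x \<theta>0 - m)\<^sup>2)" "(\<integral>x. (h x \<theta>0 - m)\<^sup>2 \<partial>P) = s2"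
  proof -
    have eq: "(h x \<theta>0 - m)\<^sup>2 = (h x \<theta>0)\<^sup>2 - 2 * m * h x \<theta>0 + m\<^sup>2" for x
      by (simp add: power2_diff mult_ac)
    show "integrable P (\<lambda>x. (h x \<theta>0 - m)\<^sup>2)" unfolding eq using sq hi by simp
    show "(\<integral>x. (h x \<theta>0 - m)\<^sup>2 \<partial>P) = s2"
      unfolding eq s2_def using sq hi by (simp add: m_def[symmetric] P.prob_space power2_eq_square)
  qed
  have s2: "0 \<le> s2" unfolding c2(2)[symmetric] by (intro integral_nonneg_AE) simp
  have c1: "(\<integral>x. h x \<theta>0 - m \<partial>P) = 0" using hi by (simp add: m_def P.prob_space)
  have mean: "expectation (\<lambda>\<omega>. h (X 0 \<omega>) \<theta>0 - m) = 0" unfolding iid_transform(4)[OF cm(1)] by (rule c1)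
  have sq0: "integrable W (\<lambda>\<omega>. (h (X 0 \<omega>) \<theta>0 - m)\<^sup>2)" unfolding iid_transform(3)[OF cm(2)] by (rule c2(1))
  have em [measurable]: "(\<lambda>\<omega>. emp n \<omega> \<theta>0) \<in> borel_measurable W" for n by (rule emp_measurable[OF \<theta>0])
  have "weak_conv_m (\<lambda>n. distr W borel (\<lambda>\<omega>. sqrt (real n) * (v n \<omega> - m))) (normal_law 0 s2)"
  proof (rule levy_continuity)
    show "real_distribution (distr W borel (\<lambda>\<omega>. sqrt (real n) * (v n \<omega> - m)))" for n
      by (intro real_distribution_distr) measurable
    show "real_distribution (normal_law 0 s2)" by (rule real_distribution_normal_law[OF s2])
    fix t :: real
    define U where "U n \<omega> = t * (sqrt (real n) * (v n \<omega> - m))" for n \<omega>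
    define Z where "Z n \<omega> = t * (sqrt (real n) * (emp n \<omega> \<theta>0 - m))" for n \<omega>
    have Zlim: "(\<lambda>n. CLINT \<omega>|W. iexp (Z n \<omega>)) \<longlonglongrightarrow> complex_of_real (exp (- (s2 * t\<^sup>2) / 2))"
    proof -
      have "Z n \<omega> = t * ((\<Sum>i<n. h (X i \<omega>) \<theta>0 - m) / sqrt (real n))" for n \<omega>
      proof (cases "n = 0")
        case False
        then have "emp n \<omega> \<theta>0 - m = (\<Sum>i<n. h (X i \<omega>) \<theta>0 - m) / real n"
          by (simp add: emp_def sum_subtractf diff_divide_distrib)
        then show ?thesis unfolding Z_def by (simp only: sqrt_mean_eq)
      qed (simp add: Z_def)
      then show ?thesis
        using iid_characteristic_function_limit[OF iid_transform(1,2)[OF cm(1)] mean sq0, of t] iid_transform(4)[OF cm(2)] c2(2)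
        by simp
    qed
    have "(\<lambda>n. (CLINT \<omega>|W. iexp (U n \<omega>)) - (CLINT \<omega>|W. iexp (Z n \<omega>))) \<longlonglongrightarrow> 0"
    proof (rule characteristic_functions_merge)
      show "U n \<in> borel_measurable W" "Z n \<in> borel_measurable W" for n
        unfolding U_def Z_def by measurable
      show "integrable W (\<lambda>\<omega>. real n * (norm (score n \<omega>))\<^sup>2)" for n by (rule score_second_moment)
      show "0 \<le> real n * (norm (score n \<omega>))\<^sup>2" for n \<omega> by simp
      show "expectation (\<lambda>\<omega>. real n * (norm (score n \<omega>))\<^sup>2) \<le> (\<Sum>j\<in>UNIV. \<integral>x. (axis j 1 \<bullet> g0 x)\<^sup>2 \<partial>P)" for n
        by (rule score_second_moment)
      show "AE \<omega> in W. \<forall>e>0. \<forall>\<^sub>F n in sequentially. \<bar>U n \<omega> - Z n \<omega>\<bar> \<le> e * (real n * (norm (score n \<omega>))\<^sup>2)"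
        using attained AE_quadratic_path
      proof eventually_elim
        case (elim \<omega>)
        from elim(2) obtain L g H where score: "\<And>n. g n \<theta>0 = score n \<omega>"
          and reg: "\<And>e. 0 < e \<Longrightarrow> \<forall>\<^sub>F n in sequentially. cball \<theta>0 (shrinking_radius n) \<subseteq> box a b \<and>
            quadratic_regime S \<theta>0 (shrinking_radius n) e (emp n \<omega>) (g n)"
          unfolding quadratic_path_def by blast
        show ?case
        proof (intro allI impI)
          fix e :: real assume e: "0 < e"
          have "(\<lambda>n. \<bar>t\<bar> / \<kappa> * inverse (sqrt (real n))) \<longlonglongrightarrow> \<bar>t\<bar> / \<kappa> * 0"
            by (intro tendsto_mult tendsto_const tendsto_inverse_0_at_top filterlim_compose[OF sqrt_at_top filterlim_real_sequentially])
          then have "\<forall>\<^sub>F n in sequentially. \<bar>t\<bar> / \<kappa> * inverse (sqrt (real n)) < e"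
            using e by (intro order_tendstoD(2)) auto
          moreover have "\<forall>\<^sub>F n in sequentially. cball \<theta>0 (shrinking_radius n) \<subseteq> box a b \<and>
              quadratic_regime S \<theta>0 (shrinking_radius n) (\<kappa> / 4) (emp n \<omega>) (g n)"
            using \<kappa> by (intro reg) simp
          ultimately show "\<forall>\<^sub>F n in sequentially. \<bar>U n \<omega> - Z n \<omega>\<bar> \<le> e * (real n * (norm (score n \<omega>))\<^sup>2)"
            using elim(1) eventually_gt_at_top[of "0::nat"]
          proof eventually_elim
            case (elim n)
            define s where "s = norm (score n \<omega>)"
            obtain \<theta> where \<theta>: "\<theta> \<in> cball \<theta>0 (shrinking_radius n)" "v n \<omega> = emp n \<omega> \<theta>" using elim(3) by blast
            define r where "r = norm (\<theta> - \<theta>0)"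
            have "emp n \<omega> \<theta> - emp n \<omega> \<theta>0 \<le> s * r - \<kappa> / 4 * r\<^sup>2"
              using quadratic_regime_value_bound[OF _ coercive \<theta>(1), of "emp n \<omega>" "g n"] elim(2)
              unfolding score s_def r_def by blast
            also have "\<dots> \<le> s\<^sup>2 / \<kappa>"
            proof -
              have "0 \<le> (s - \<kappa> / 2 * r)\<^sup>2 / \<kappa>" using \<kappa> by simp
              also have "\<dots> = s\<^sup>2 / \<kappa> - (s * r - \<kappa> / 4 * r\<^sup>2)"
                using \<kappa> by (simp add: power2_eq_square field_simps)
              finally show ?thesis by simp
            qed
            finally have up: "v n \<omega> - emp n \<omega> \<theta>0 \<le> s\<^sup>2 / \<kappa>" using \<theta>(2) by simp
            have "U n \<omega> - Z n \<omega> = t * (sqrt (real n) * (v n \<omega> - emp n \<omega> \<theta>0))"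
              unfolding U_def Z_def by (simp add: algebra_simps)
            then have "\<bar>U n \<omega> - Z n \<omega>\<bar> = \<bar>t\<bar> * (sqrt (real n) * (v n \<omega> - emp n \<omega> \<theta>0))"
              using elim(3) by (simp add: abs_mult)
            also have "\<dots> \<le> \<bar>t\<bar> * (sqrt (real n) * (s\<^sup>2 / \<kappa>))"
              using up by (intro mult_left_mono) auto
            also have "\<dots> = (\<bar>t\<bar> / \<kappa> * inverse (sqrt (real n))) * (real n * s\<^sup>2)"
              using elim(4) \<kappa> by (simp add: field_simps)
            also have "\<dots> \<le> e * (real n * s\<^sup>2)" using elim(1) by (intro mult_right_mono) auto
            finally show ?case unfolding s_def .
          qed
        qed
      qed
    qed
    from tendsto_add[OF this Zlim] have "(\<lambda>n. CLINT \<omega>|W. iexp (U n \<omega>)) \<longlonglongrightarrow> char (normal_law 0 s2) t"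
      unfolding char_normal_law[OF s2] by simp
    then show "(\<lambda>n. char (distr W borel (\<lambda>\<omega>. sqrt (real n) * (v n \<omega> - m))) t) \<longlonglongrightarrow> char (normal_law 0 s2) t"
      unfolding U_def char_def by (simp add: integral_distr)
  qed
  then show ?thesis unfolding m_def s2_def .
qed

end

section \<open>The pseudodistance estimator\<close>

lemma partials_exist_on_subset:
  assumes "partials_exist_on k U f" "V \<subseteq> U"
  shows "partials_exist_on k V f"
  unfolding partials_exist_on_def
proof (intro allI impI ballI)
  fix ks :: "'a list" and i \<theta> assume "length ks < k" "\<theta> \<in> V"
  then show "(\<lambda>t. partials ks f (\<theta> + t *\<^sub>R axis i 1)) field_differentiable at 0"
    using assms(1)[unfolded partials_exist_on_def, rule_format, of ks \<theta> i] assms(2) by blast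
qed

text \<open>The derivative is the limit of difference quotients, which are measurable, wherever it exists.\<close>

lemma measurable_gradient_version:
  fixes h :: "'b::topological_space \<Rightarrow> real^'m \<Rightarrow> real"
  assumes jets: "AE x in P. jet (box a b) (G x) (h x) (g x) (H x)" and \<theta>0: "\<theta>0 \<in> box a b"
    and h: "\<And>\<theta>. \<theta> \<in> box a b \<Longrightarrow> (\<lambda>x. h x \<theta>) \<in> borel_measurable borel"
  obtains g0 where "g0 \<in> borel_measurable borel" "AE x in P. g x \<theta>0 = g0 x"
proof -
  obtain e where e: "0 < e" "ball \<theta>0 e \<subseteq> box a b"
    using \<theta>0 open_box open_contains_ball by blast
  define s where "s k = e / (2 * real (Suc k))" for k
  have s: "0 < s k" "s k < e" for k
  proof -
    show "0 < s k" using e(1) by (simp add: s_def)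
    have "e * 1 < e * (2 * real (Suc k))" using e(1) by (intro mult_strict_left_mono) auto
    then show "s k < e" unfolding s_def by (simp add: pos_divide_less_eq)
  qed
  have s0: "s \<longlonglongrightarrow> 0"
  proof -
    have "(\<lambda>k. e / 2 * inverse (real (Suc k))) \<longlonglongrightarrow> e / 2 * 0"
      by (intro tendsto_mult tendsto_const LIMSEQ_inverse_real_of_nat)
    then show ?thesis unfolding s_def by (simp add: field_simps)
  qed
  \<comment> \<open>the increments are small enough for all arguments to stay in the box\<close>
  define Q where "Q j k x = (h x (\<theta>0 + s k *\<^sub>R axis j 1) - h x \<theta>0) / s k" for j k x
  define g0 where "g0 x = (\<Sum>j\<in>UNIV. lim (\<lambda>k. Q j k x) *\<^sub>R axis j (1::real))" for x
  have inb: "\<theta>0 + s k *\<^sub>R axis j 1 \<in> box a b" for j k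
  proof -
    have "\<theta>0 + s k *\<^sub>R axis j 1 \<in> ball \<theta>0 e" using s[of k] by (simp add: dist_norm)
    then show ?thesis using e(2) by blast
  qed
  have [measurable]: "Q j k \<in> borel_measurable borel" for j k
    unfolding Q_def using h[OF inb[of k j]] h[OF \<theta>0] by measurable
  have "g0 \<in> borel_measurable borel" unfolding g0_def by measurable
  moreover have "AE x in P. g x \<theta>0 = g0 x"
    using jets
  proof eventually_elim
    case (elim x)
    have "lim (\<lambda>k. Q j k x) = g x \<theta>0 $ j" for j
    proof (rule limI)
      have "((\<lambda>t. (h x (\<theta>0 + (0 + t) *\<^sub>R axis j 1) - h x (\<theta>0 + 0 *\<^sub>R axis j 1)) / t) \<longlongrightarrow> g x \<theta>0 $ j) (at 0)"
        using jet_has_partial[OF elim \<theta>0, of j] unfolding DERIV_def .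
      moreover have "filterlim s (at 0) sequentially"
        using s0 s(1) by (auto simp: filterlim_at intro!: always_eventually less_imp_neq[symmetric])
      ultimately have "((\<lambda>k. (h x (\<theta>0 + (0 + s k) *\<^sub>R axis j 1) - h x (\<theta>0 + 0 *\<^sub>R axis j 1)) / s k) \<longlongrightarrow> g x \<theta>0 $ j) sequentially"
        by (rule filterlim_compose)
      then show "(\<lambda>k. Q j k x) \<longlonglongrightarrow> g x \<theta>0 $ j" unfolding Q_def by simp
    qed
    then have "g0 x = (\<Sum>j\<in>UNIV. g x \<theta>0 $ j *\<^sub>R axis j 1)" unfolding g0_def by simp
    then show ?case by (simp add: vec_eq_iff axis_def sum.delta' if_distrib cong: if_cong)
  qed
  ultimately show ?thesis by (rule that)
qed

lemma matrix_inv_inverse: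
  fixes S :: "real^'m^'m"
  assumes "invertible S"
  shows "S ** matrix_inv S = mat 1" "matrix_inv S ** S = mat 1"
  using someI_ex[OF assms[unfolded invertible_def]] unfolding matrix_inv_def by blast+

lemma inverse_symmetric:
  fixes S :: "real^'m^'m"
  assumes "transpose S = S" "invertible S"
  shows "transpose (matrix_inv S) = matrix_inv S"
proof -
  have SI: "S ** matrix_inv S = mat 1" by (rule matrix_inv_inverse(1)[OF assms(2)])
  have "transpose (matrix_inv S) = transpose (matrix_inv S) ** (transpose S ** matrix_inv S)"
    unfolding assms(1) SI by simp
  also have "\<dots> = transpose (S ** matrix_inv S) ** matrix_inv S"
    by (simp add: matrix_mul_assoc matrix_transpose_mul)
  finally show ?thesis unfolding SI by simp
qed

lemma bounded_linear_transpose: "bounded_linear (transpose :: real^'m^'m \<Rightarrow> real^'m^'m)"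
  by (intro linear_conv_bounded_linear[THEN iffD1] linearI) (simp_all add: transpose_def vec_eq_iff)

lemma integral_symmetric_matrix:
  fixes A :: "'b \<Rightarrow> real^'m^'m"
  assumes A: "integrable P A" and sym: "AE x in P. transpose (A x) = A x"
  shows "transpose (\<integral>x. A x \<partial>P) = (\<integral>x. A x \<partial>P)"
proof -
  have "transpose (\<integral>x. A x \<partial>P) = (\<integral>x. transpose (A x) \<partial>P)"
    by (rule integral_bounded_linear[OF bounded_linear_transpose A, symmetric])
  also have "\<dots> = (\<integral>x. A x \<partial>P)"
    using sym borel_measurable_integrable[OF integrable_bounded_linear[OF bounded_linear_transpose A]]
      borel_measurable_integrable[OF A] by (intro integral_cong_AE)
  finally show ?thesis .
qed

lemma outer_prod_quadratic_form: "w \<bullet> (outer_prod u u *v w) = (w \<bullet> u)\<^sup>2"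
  by (simp add: outer_prod_vector_mult inner_commute power2_eq_square)

lemma transpose_outer_prod: "transpose (outer_prod u u) = outer_prod u u"
  by (simp add: transpose_def outer_prod_def vec_eq_iff mult.commute)

lemma is_local_max_on_interior:
  assumes "\<theta> \<in> interior \<Theta>"
  shows "is_local_max_on \<Theta> f \<theta> \<longleftrightarrow> (\<forall>\<^sub>F \<theta>' in nhds \<theta>. f \<theta>' \<le> f \<theta>)"
proof -
  have "\<theta> \<in> \<Theta>" using assms interior_subset by blast
  then show ?thesis
    unfolding is_local_max_on_def at_within_interior[OF assms] eventually_nhds_conv_at by simp
qed

theorem theorem4:
  fixes p :: "real^'m \<Rightarrow> real^'d \<Rightarrow> real"
    and \<Theta> :: "(real^'m) set" and \<theta>0 :: "real^'m"
    and Q0 :: "(real^'d \<Rightarrow> real) set"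
    and \<alpha> \<beta> :: real
    and W :: "'w measure" and X :: "nat \<Rightarrow> 'w \<Rightarrow> real^'d"
    and N :: "(real^'m) set" and G :: "real^'d \<Rightarrow> real"
  assumes alpha: "0 < \<alpha>" and theta0: "\<theta>0 \<in> \<Theta>"
    and densities: "\<And>f. f \<in> p ` \<Theta> \<union> Q0 \<Longrightarrow> prob_density f"
    and identifiable: "inj_on (\<lambda>\<theta>. law_of (p \<theta>)) \<Theta>"
    and same_support: "\<And>\<theta>. \<theta> \<in> \<Theta> \<Longrightarrow>
          measure_support (law_of (p \<theta>)) = measure_support (law_of (p \<theta>0))"
    and beta: "0 < \<beta>" "\<alpha> \<le> \<beta>"
    and standing: "\<And>f g. f \<in> p ` \<Theta> \<Longrightarrow> g \<in> p ` \<Theta> \<union> Q0 \<Longrightarrow>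
          integrable (law_of g) (\<lambda>x. f x powr \<beta>) \<and>
          integrable (law_of g) (\<lambda>x. g x powr \<beta>) \<and>
          (AE x in law_of g. f x > 0) \<and> integrable (law_of g) (\<lambda>x. ln (f x))"
    and sample_space: "prob_space W"
    and sample_indep: "prob_space.indep_vars W (\<lambda>_. borel) X UNIV"
    and sample_law: "\<And>i. distr W borel (X i) = law_of (p \<theta>0)"
    and i: "AE x in lborel. partials_exist_on 3 (interior \<Theta>) (\<lambda>\<theta>. p \<theta> x) \<and>
          (\<forall>is. length is \<le> 3 \<longrightarrow> continuous_on (interior \<Theta>) (partials is (\<lambda>\<theta>. p \<theta> x)))"
    and ii_nbhd: "open N" "\<theta>0 \<in> N" "N \<subseteq> \<Theta>"
    and ii_integrable: "integrable (law_of (p \<theta>0)) G"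
    and ii_dominated: "AE x in law_of (p \<theta>0). partials_exist_on 3 N (h_fun \<alpha> p x) \<and>
          (\<forall>is. 1 \<le> length is \<and> length is \<le> 3 \<longrightarrow>
             (\<forall>\<theta>\<in>N. \<bar>partials is (h_fun \<alpha> p x) \<theta>\<bar> \<le> G x))"
    and iii_S: "integrable (law_of (p \<theta>0)) (\<lambda>x. hessian (h_fun \<alpha> p x) \<theta>0)"
    and iii_M: "integrable (law_of (p \<theta>0))
          (\<lambda>x. outer_prod (grad (h_fun \<alpha> p x) \<theta>0) (grad (h_fun \<alpha> p x) \<theta>0))"
    and S_invertible: "invertible (S_mat \<alpha> p \<theta>0)"
  shows "((\<exists>est. local_max_estimate W \<alpha> p \<Theta> \<theta>0 X est) \<and>
           (\<forall>est. local_max_estimate W \<alpha> p \<Theta> \<theta>0 X est \<longrightarrow>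
              (AE \<omega> in W. (\<lambda>n. norm (est n \<omega> - \<theta>0)) \<in> O(\<lambda>n. real n powr (- (1/3))))))
    \<and>
         (\<forall>est. local_max_estimate W \<alpha> p \<Theta> \<theta>0 X est \<longrightarrow>
            (\<exists>\<mu>. centered_normal (V_mat \<alpha> p \<theta>0) \<mu> \<and>
               weak_conv_vec (\<lambda>n. distr W borel (\<lambda>\<omega>. sqrt (real n) *\<^sub>R (est n \<omega> - \<theta>0))) \<mu>))
    \<and>
         (integrable (law_of (p \<theta>0)) (\<lambda>x. (h_fun \<alpha> p x \<theta>0)\<^sup>2) \<and>
          (\<forall>n. R_emp \<alpha> p \<Theta> X n \<in> borel_measurable W) \<and>
          (AE \<omega> in W. \<forall>\<^sub>F n in sequentially.
             \<exists>\<theta>\<in>interior (B_set \<Theta> \<theta>0 n). \<forall>\<theta>'\<in>\<Theta>.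
               emp_mean \<alpha> p X n \<omega> \<theta>' \<le> emp_mean \<alpha> p X n \<omega> \<theta>) \<longrightarrow>
          weak_conv_m
            (\<lambda>n. distr W borel
               (\<lambda>\<omega>. sqrt (real n) * (R_emp \<alpha> p \<Theta> X n \<omega> - R_true \<alpha> p \<Theta> \<theta>0)))
            (normal_law 0 (sigma2 \<alpha> p \<theta>0)))"
proof -
  define P where "P = law_of (p \<theta>0)"
  define h where "h = h_fun \<alpha> p"
  define S where "S = S_mat \<alpha> p \<theta>0"
  define M where "M = M_mat \<alpha> p \<theta>0"
  have dens: "prob_density (p \<theta>)" if "\<theta> \<in> \<Theta>" for \<theta> using densities that by blast
  have power_int: "integrable (law_of (p \<theta>)) (\<lambda>x. p \<theta> x powr \<alpha>)" if \<theta>: "\<theta> \<in> \<Theta>" for \<theta>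
  proof (rule integrable_powr_mono[OF _ _ _ alpha beta(2)])
    show "finite_measure (law_of (p \<theta>))" using prob_space_law_of[OF dens[OF \<theta>]] by (simp add: prob_space_def)
    show "p \<theta> \<in> borel_measurable (law_of (p \<theta>))"
      using prob_density_measurable[OF dens[OF \<theta>]] by (simp cong: measurable_cong_sets)
    show "integrable (law_of (p \<theta>)) (\<lambda>x. p \<theta> x powr \<beta>)" using standing[of "p \<theta>" "p \<theta>"] \<theta> by blast
  qed (rule prob_density_nonneg[OF dens[OF \<theta>]])
  have h_max: "integrable P (\<lambda>x. h x \<theta>)" "(\<integral>x. h x \<theta> \<partial>P) \<le> (\<integral>x. h x \<theta>0 \<partial>P)" if \<theta>: "\<theta> \<in> \<Theta>" for \<theta>
    unfolding P_def h_def
    by (rule h_mean_maximal[OF alpha dens[OF \<theta>] dens[OF theta0] power_int[OF \<theta>] power_int[OF theta0]])+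
  have h_meas: "(\<lambda>x. h x \<theta>) \<in> borel_measurable borel" if \<theta>: "\<theta> \<in> \<Theta>" for \<theta>
    using prob_density_measurable[OF dens[OF \<theta>]] unfolding h_def h_fun_def by measurable
  interpret P: prob_space P unfolding P_def by (rule prob_space_law_of[OF dens[OF theta0]])
  interpret W: prob_space W by (rule sample_space)
  obtain a b where ab: "\<theta>0 \<in> box a b" "box a b \<subseteq> N"
    by (rule open_contains_box[OF ii_nbhd(1,2)])
  have ab\<Theta>: "box a b \<subseteq> \<Theta>" using ab(2) ii_nbhd(3) by blast
  have jets: "AE x in P. jet (box a b) (G x) (h x) (grad (h x)) (hessian (h x))"
    using ii_dominated unfolding P_def[symmetric] h_def[symmetric]
  proof eventually_elim
    case (elim x)
    show ?case
    proof (rule jet_of_bounded_partials)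
      show "partials_exist_on 3 (box a b) (h x)"
        using conjunct1[OF elim] ab(2) by (rule partials_exist_on_subset)
      show "\<bar>partials ks (h x) \<theta>\<bar> \<le> G x" if "\<theta> \<in> box a b" "length ks = 3" for \<theta> ks
        using conjunct2[OF elim, rule_format, of ks \<theta>] subsetD[OF ab(2) that(1)] that(2) by simp
      have "\<bar>partials [undefined] (h x) \<theta>0\<bar> \<le> G x"
        using conjunct2[OF elim, rule_format, of "[undefined]" \<theta>0] ii_nbhd(2) by simp
      then show "0 \<le> G x" by linarith
    qed
  qed
  obtain g0 where g0: "g0 \<in> borel_measurable borel" "AE x in P. grad (h x) \<theta>0 = g0 x"
    using measurable_gradient_version[OF jets ab(1) h_meas] ab\<Theta> by blast
  have P_sets [measurable_cong]: "sets P = sets borel" by (simp add: P_def)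
  note [measurable] = g0(1)
  have M_int: "integrable P (\<lambda>x. outer_prod (grad (h x) \<theta>0) (grad (h x) \<theta>0))"
    using iii_M unfolding P_def h_def .
  have H_int: "integrable P (\<lambda>x. hessian (h x) \<theta>0)" using iii_S unfolding P_def h_def .
  have M_form: "w \<bullet> (M *v w) = (\<integral>x. (w \<bullet> g0 x)\<^sup>2 \<partial>P)" and M_form_int: "integrable P (\<lambda>x. (w \<bullet> g0 x)\<^sup>2)" for w
  proof -
    have int: "integrable P (\<lambda>x. (w \<bullet> grad (h x) \<theta>0)\<^sup>2)"
      using integrable_bounded_linear[OF bounded_linear_quadratic_form[of w w] M_int]
      by (simp only: outer_prod_quadratic_form)
    have ae: "AE x in P. (w \<bullet> grad (h x) \<theta>0)\<^sup>2 = (w \<bullet> g0 x)\<^sup>2" using g0(2) by eventually_elim simp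
    have m: "(\<lambda>x. (w \<bullet> g0 x)\<^sup>2) \<in> borel_measurable P" by measurable
    show "integrable P (\<lambda>x. (w \<bullet> g0 x)\<^sup>2)"
      using integrable_cong_AE[OF borel_measurable_integrable[OF int] m ae] int by blast
    have "w \<bullet> (M *v w) = (\<integral>x. (w \<bullet> grad (h x) \<theta>0)\<^sup>2 \<partial>P)"
      using integral_bounded_linear[OF bounded_linear_quadratic_form[of w w] M_int]
      unfolding M_def M_mat_def P_def[symmetric] h_def[symmetric] by (simp only: outer_prod_quadratic_form)
    also have "\<dots> = (\<integral>x. (w \<bullet> g0 x)\<^sup>2 \<partial>P)"
      by (rule integral_cong_AE[OF borel_measurable_integrable[OF int] m ae])
    finally show "w \<bullet> (M *v w) = (\<integral>x. (w \<bullet> g0 x)\<^sup>2 \<partial>P)" .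
  qed
  have M_sym: "transpose M = M"
    unfolding M_def M_mat_def P_def[symmetric] h_def[symmetric]
    by (rule integral_symmetric_matrix[OF M_int]) (simp add: transpose_outer_prod)
  have g0_sq: "integrable P (\<lambda>x. (norm (g0 x))\<^sup>2)"
  proof -
    have "(norm (g0 x))\<^sup>2 = (\<Sum>j\<in>UNIV. (axis j 1 \<bullet> g0 x)\<^sup>2)" for x
      unfolding power2_norm_eq_inner inner_axis' by (simp add: inner_vec_def power2_eq_square)
    then show ?thesis using M_form_int by simp
  qed
  have g0_int: "integrable P g0"
  proof -
    have "integrable P (\<lambda>x. norm (g0 x))"
      by (rule P.square_integrable_imp_integrable[OF _ g0_sq]) measurable
    then show ?thesis by (subst (asm) integrable_norm_iff) measurable
  qed
  have jets': "AE x in P. \<exists>g H. jet (box a b) (G x) (h x) g H \<and> g \<theta>0 = g0 x \<and> H \<theta>0 = hessian (h x) \<theta>0"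
    using jets g0(2) by eventually_elim blast
  have G_int: "integrable P G" using ii_integrable unfolding P_def .
  note mean_jet = mean_jet_at_maximum[OF jets' ab(1) G_int g0_int H_int]
  have g0_mean: "(\<integral>x. g0 x \<partial>P) = 0" using mean_jet(1) h_max ab\<Theta> by blast
  have S_eq: "S = - (\<integral>x. hessian (h x) \<theta>0 \<partial>P)" unfolding S_def S_mat_def P_def h_def ..
  have S_psd: "0 \<le> u \<bullet> (S *v u)" for u
  proof -
    have "u \<bullet> ((\<integral>x. hessian (h x) \<theta>0 \<partial>P) *v u) \<le> 0" using mean_jet(2) h_max ab\<Theta> by blast
    moreover have "(- A) *v u = - (A *v u)" for A :: "real^'m^'m"
      by (simp add: vec_eq_iff matrix_vector_mult_def sum_negf)
    ultimately show ?thesis unfolding S_eq by simp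
  qed
  have S_sym: "transpose S = S"
  proof -
    have "transpose (\<integral>x. hessian (h x) \<theta>0 \<partial>P) = (\<integral>x. hessian (h x) \<theta>0 \<partial>P)"
    proof (rule integral_symmetric_matrix[OF H_int])
      show "AE x in P. transpose (hessian (h x) \<theta>0) = hessian (h x) \<theta>0"
        using jets
      proof eventually_elim
        case (elim x)
        show ?case using jet_hessian_symmetric[OF elim ab(1)] by (simp add: transpose_def vec_eq_iff)
      qed
    qed
    then show ?thesis unfolding S_eq by (simp add: transpose_def vec_eq_iff)
  qed
  have S_inv: "invertible S" using S_invertible unfolding S_def .
  obtain \<kappa> where \<kappa>: "0 < \<kappa>" "\<And>u. \<kappa> * (norm u)\<^sup>2 \<le> u \<bullet> (S *v u)"
    using psd_invertible_coercive[OF S_sym S_psd S_inv] by blast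
  interpret R: regular_m_estimation W P X h a b \<theta>0 G g0 "\<lambda>x. hessian (h x) \<theta>0" S \<kappa>
  proof (unfold_locales)
    show "W.indep_vars (\<lambda>_. borel) X UNIV" by (rule sample_indep)
    show "distr W borel (X i) = P" for i unfolding P_def by (rule sample_law)
    show "(\<lambda>x. h x \<theta>) \<in> borel_measurable borel" if "\<theta> \<in> box a b" for \<theta> using h_meas that ab\<Theta> by blast
  qed (fact ab(1) jets' G_int g0(1) g0_sq g0_mean H_int S_eq S_sym \<kappa>)+
  have emp: "emp_mean \<alpha> p X n \<omega> = R.emp n \<omega>" for n \<omega>
    by (rule ext) (simp only: R.emp_def, simp only: emp_mean_def h_def)
  have B_sub: "B_set \<Theta> \<theta>0 n \<subseteq> cball \<theta>0 (shrinking_radius n)" for n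
    by (auto simp: B_set_def shrinking_radius_def dist_norm norm_minus_commute)
  have B_int: "interior (B_set \<Theta> \<theta>0 n) \<subseteq> interior \<Theta>" for n
    by (intro interior_mono) (auto simp: B_set_def)
  have est_max: "AE \<omega> in W. \<forall>\<^sub>F n in sequentially. est n \<omega> \<in> cball \<theta>0 (shrinking_radius n) \<and>
      (\<forall>\<^sub>F \<theta> in nhds (est n \<omega>). R.emp n \<omega> \<theta> \<le> R.emp n \<omega> (est n \<omega>))"
    if "local_max_estimate W \<alpha> p \<Theta> \<theta>0 X est" for est
  proof -
    have "AE \<omega> in W. \<forall>\<^sub>F n in sequentially. est n \<omega> \<in> interior (B_set \<Theta> \<theta>0 n) \<and>
        is_local_max_on \<Theta> (R.emp n \<omega>) (est n \<omega>)"
      using that unfolding local_max_estimate_def emp by blast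
    then show ?thesis
    proof eventually_elim
      case (elim \<omega>)
      then show ?case
      proof eventually_elim
        case (elim n)
        then show ?case
          using B_sub[of n] B_int[of n] interior_subset[of "B_set \<Theta> \<theta>0 n"] is_local_max_on_interior by blast
      qed
    qed
  qed
  have est_meas: "est n \<in> borel_measurable W" if "local_max_estimate W \<alpha> p \<Theta> \<theta>0 X est" for est n
    using that unfolding local_max_estimate_def by blast
  have part_a1: "\<exists>est. local_max_estimate W \<alpha> p \<Theta> \<theta>0 X est"
  proof -
    obtain est where est: "\<And>n. est n \<in> borel_measurable W" "AE \<omega> in W. \<forall>\<^sub>F n in sequentially.
        est n \<omega> \<in> ball \<theta>0 (shrinking_radius n) \<and> (\<forall>\<^sub>F \<theta> in nhds (est n \<omega>). R.emp n \<omega> \<theta> \<le> R.emp n \<omega> (est n \<omega>))"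
      using R.measurable_local_maximizer_exists by blast
    obtain d where d: "0 < d" "ball \<theta>0 d \<subseteq> \<Theta>"
      using ii_nbhd open_contains_ball by (metis subset_trans)
    have ev: "\<forall>\<^sub>F n in sequentially. shrinking_radius n < d"
      using shrinking_radius_tendsto d(1) by (rule order_tendstoD(2))
    have "AE \<omega> in W. \<forall>\<^sub>F n in sequentially. est n \<omega> \<in> interior (B_set \<Theta> \<theta>0 n) \<and>
        is_local_max_on \<Theta> (R.emp n \<omega>) (est n \<omega>)"
      using est(2)
    proof eventually_elim
      case (elim \<omega>)
      then show ?case using ev
      proof eventually_elim
        case (elim n)
        have "ball \<theta>0 (shrinking_radius n) \<subseteq> ball \<theta>0 d" using elim(2) by (intro subset_ball) simp
        then have "ball \<theta>0 (shrinking_radius n) \<subseteq> B_set \<Theta> \<theta>0 n"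
          using d(2) by (auto simp: B_set_def shrinking_radius_def dist_norm norm_minus_commute)
        then have "ball \<theta>0 (shrinking_radius n) \<subseteq> interior (B_set \<Theta> \<theta>0 n)" by (intro interior_maximal) auto
        then show ?case using elim(1) B_int[of n] is_local_max_on_interior by blast
      qed
    qed
    then show ?thesis using est(1) unfolding local_max_estimate_def emp by blast
  qed
  have part_a2: "AE \<omega> in W. (\<lambda>n. norm (est n \<omega> - \<theta>0)) \<in> O(\<lambda>n. real n powr (- (1/3)))"
    if "local_max_estimate W \<alpha> p \<Theta> \<theta>0 X est" for est
    using est_max[OF that]
  proof eventually_elim
    case (elim \<omega>)
    then have "\<forall>\<^sub>F n in sequentially. norm (norm (est n \<omega> - \<theta>0)) \<le> 1 * norm (real n powr (- (1/3)))"
      by eventually_elim (simp add: shrinking_radius_def dist_norm norm_minus_commute)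
    then show ?case by (rule bigoI)
  qed
  have part_b: "\<exists>\<mu>. centered_normal (V_mat \<alpha> p \<theta>0) \<mu> \<and>
      weak_conv_vec (\<lambda>n. distr W borel (\<lambda>\<omega>. sqrt (real n) *\<^sub>R (est n \<omega> - \<theta>0))) \<mu>"
    if est: "local_max_estimate W \<alpha> p \<Theta> \<theta>0 X est" for est
  proof (rule R.estimator_asymptotically_normal[OF est_meas[OF est] est_max[OF est]])
    define T where "T = matrix_inv S"
    have T_sym: "transpose T = T" unfolding T_def by (rule inverse_symmetric[OF S_sym S_inv])
    show "transpose (matrix_inv S) = matrix_inv S" by (rule inverse_symmetric[OF S_sym S_inv])
    show "matrix_inv S ** S = mat 1" by (rule matrix_inv_inverse(2)[OF S_inv])
    have V: "V_mat \<alpha> p \<theta>0 = T ** M ** T" by (simp add: V_mat_def T_def S_def M_def)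
    show "transpose (V_mat \<alpha> p \<theta>0) = V_mat \<alpha> p \<theta>0"
      unfolding V by (simp add: matrix_transpose_mul T_sym M_sym matrix_mul_assoc)
    fix t
    have "t \<bullet> (V_mat \<alpha> p \<theta>0 *v t) = t \<bullet> (T *v (M *v (T *v t)))"
      unfolding V by (simp add: matrix_vector_mul_assoc matrix_mul_assoc)
    also have "\<dots> = (M *v (T *v t)) \<bullet> (T *v t)" by (rule symmetric_matrix_inner[OF T_sym])
    also have "\<dots> = (\<integral>x. ((T *v t) \<bullet> g0 x)\<^sup>2 \<partial>P)" by (simp only: inner_commute[of "M *v (T *v t)"] M_form)
    finally show "t \<bullet> (V_mat \<alpha> p \<theta>0 *v t) = (\<integral>x. ((matrix_inv S *v t) \<bullet> g0 x)\<^sup>2 \<partial>P)" unfolding T_def .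
  qed
  have part_c: "weak_conv_m
      (\<lambda>n. distr W borel (\<lambda>\<omega>. sqrt (real n) * (R_emp \<alpha> p \<Theta> X n \<omega> - R_true \<alpha> p \<Theta> \<theta>0)))
      (normal_law 0 (sigma2 \<alpha> p \<theta>0))"
    if sq: "integrable (law_of (p \<theta>0)) (\<lambda>x. (h_fun \<alpha> p x \<theta>0)\<^sup>2)"
      and meas: "\<And>n. R_emp \<alpha> p \<Theta> X n \<in> borel_measurable W"
      and att: "AE \<omega> in W. \<forall>\<^sub>F n in sequentially. \<exists>\<theta>\<in>interior (B_set \<Theta> \<theta>0 n). \<forall>\<theta>'\<in>\<Theta>.
               emp_mean \<alpha> p X n \<omega> \<theta>' \<le> emp_mean \<alpha> p X n \<omega> \<theta>"
  proof -
    have R_true: "R_true \<alpha> p \<Theta> \<theta>0 = (\<integral>x. h x \<theta>0 \<partial>P)"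
      unfolding R_true_def P_def[symmetric] h_def[symmetric]
      using theta0 h_max(2) by (intro cSup_eq_maximum) auto
    have "AE \<omega> in W. \<forall>\<^sub>F n in sequentially. R.emp n \<omega> \<theta>0 \<le> R_emp \<alpha> p \<Theta> X n \<omega> \<and>
        (\<exists>\<theta>\<in>cball \<theta>0 (shrinking_radius n). R_emp \<alpha> p \<Theta> X n \<omega> = R.emp n \<omega> \<theta>)"
      using att
    proof eventually_elim
      case (elim \<omega>)
      then show ?case
      proof eventually_elim
        case (elim n)
        then obtain \<theta> where \<theta>: "\<theta> \<in> interior (B_set \<Theta> \<theta>0 n)" "\<And>\<theta>'. \<theta>' \<in> \<Theta> \<Longrightarrow> R.emp n \<omega> \<theta>' \<le> R.emp n \<omega> \<theta>"
          unfolding emp by blast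
        have \<theta>B: "\<theta> \<in> B_set \<Theta> \<theta>0 n" using \<theta>(1) interior_subset by blast
        then have "\<theta> \<in> \<Theta>" by (simp add: B_set_def)
        then have "R_emp \<alpha> p \<Theta> X n \<omega> = R.emp n \<omega> \<theta>"
          unfolding R_emp_def emp using \<theta>(2) by (intro cSup_eq_maximum) auto
        then show ?case using \<theta>(2)[OF theta0] \<theta>B B_sub by auto
      qed
    qed
    from R.maximal_value_asymptotically_normal[OF meas this] sq
    show ?thesis unfolding R_true sigma2_def P_def h_def by blast
  qed
  show ?thesis using part_a1 part_a2 part_b part_c by blast
qed

end
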